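(* Fix $n\ge 1$. Let $\mu,\nu$ be probability measures on $\mathbb{R}^n$ with finite second moments. Let $B\subset\mathbb{R}^n$ be a closed ball with radius $r(B)\geq c_3^{-1}$, and suppose that $\mu(\mathrm{int}\,B)>0$ and $\nu(\mathrm{int}\,B)>0$, where $\mathrm{int}\,B$ is the interior of $B$. Assume that $\mu$ is absolutely continuous with respect to Lebesgue measure on $B$, so that the restriction of $\mu$ to $B$ is $f(x)\,dx$, where the density $f$ satisfies $c_4^{-1}\chi_B(x)\leq f(x)\leq c_4\chi_B(x)$ for a.e. $x\in B$ and some constant $c_4>0$. Let $\varphi:\mathbb{R}^n\to[0,1]$ be a radial (with respect to the center of $B$) Lipschitz function supported on $B$ such that $$c_2^{-1}\,\mathrm{dist}(x,\partial B)^2\leq\varphi(x)\leq c_2\,\mathrm{dist}(x,\partial B)^2\quad\text{and}\quad|\nabla\varphi(x)|\leq c_2\,\mathrm{dist}(x,\partial B)$$ for all $x\in B$. Then $$W_2(\varphi\mu,\,a\,\varphi\nu)\leq c\,W_2(\mu,\nu),$$ where $a=\int\varphi\,d\mu\big/\int\varphi\,d\nu$ and $c$ depends only on $c_2$, $c_3$ and $c_4$.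
   Context: For two Borel measures $\sigma,\tau$ on $\mathbb{R}^n$ of the same finite mass with finite $p$-th moments, $1\le p<\infty$, $W_p(\sigma,\tau)=\inf_\pi\left(\int|x-y|^p\,d\pi(x,y)\right)^{1/p}$, where the infimum is over all measures $\pi$ on $\mathbb{R}^n\times\mathbb{R}^n$ whose marginals are $\sigma$ and $\tau$. $\varphi\mu$ denotes the measure with density $\varphi$ with respect to $\mu$. The gradient bound on the Lipschitz function $\varphi$ is understood wherever $\nabla\varphi$ exists. *)

theory Defs
  imports "HOL-Probability.Probability"
begin

definition couplings ::
  "(real ^ 'n) measure \<Rightarrow> (real ^ 'n) measure \<Rightarrow> ((real ^ 'n) \<times> (real ^ 'n)) measure set" where
  "couplings \<sigma> \<tau> =
     {\<pi>. sets \<pi> = sets borel \<and> distr \<pi> borel fst = \<sigma> \<and> distr \<pi> borel snd = \<tau>}"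

definition enn_root :: "real \<Rightarrow> ennreal \<Rightarrow> ennreal" where
  "enn_root p t = (if t = \<infinity> then \<infinity> else ennreal (enn2real t powr (1 / p)))"

(* Meant for 1 <= p and Borel measures of the same finite mass with finite p-th moments;
   the value is then finite.  Extended values avoid any junk: a non-integrable cost counts
   as infinity, and so does the infimum when there is no coupling. *)
definition wasserstein :: "real \<Rightarrow> (real ^ 'n) measure \<Rightarrow> (real ^ 'n) measure \<Rightarrow> ennreal" where
  "wasserstein p \<sigma> \<tau> =
     (INF \<pi> \<in> couplings \<sigma> \<tau>. enn_root p (\<integral>\<^sup>+ (x, y). ennreal (norm (x - y) powr p) \<partial>\<pi>))"

definition borel_prob_second_moment :: "(real ^ 'n) measure \<Rightarrow> bool" where
  "borel_prob_second_moment \<mu> \<longleftrightarrow>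
     prob_space \<mu> \<and> sets \<mu> = sets borel \<and> integrable \<mu> (\<lambda>x. (norm x)\<^sup>2)"

definition radial_about :: "real ^ 'n \<Rightarrow> (real ^ 'n \<Rightarrow> real) \<Rightarrow> bool" where
  "radial_about z \<phi> \<longleftrightarrow> (\<exists>g. \<forall>x. \<phi> x = g (dist z x))"

end

theory Submission
  imports Defs
begin

text \<open>
  Fix a coupling \<open>\<pi>\<close> of \<open>\<mu>\<close> and \<open>\<nu>\<close> with quadratic cost \<open>E\<close>, and write \<open>d\<close> for the depth of a point in the
  ball \<open>B\<close>, its distance to the complement. Since \<open>\<phi>\<close> is at most 1 and comparable to \<open>d\<^sup>2\<close>, the radius
  is at most the square root of \<open>c2\<close>. So a mass of order \<open>E\<close> may be moved freely inside \<open>B\<close>, and when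
  \<open>E\<close> is bounded below every coupling of the two cut-off measures is good enough. Let \<open>E\<close> be small.

  Call a pair \<open>(x, y)\<close> good if \<open>|x - y| < d(x) / 2\<close>. On bad pairs both \<open>\<phi>(x)\<close> and \<open>\<phi>(y)\<close> are at most a
  constant times \<open>|x - y|\<^sup>2\<close>, so bad pairs carry mass of order \<open>E\<close>. On good pairs the mass at \<open>y\<close>,
  a constant multiple of \<open>\<phi>(y)\<close>, is moved to \<open>x\<close> along \<open>\<pi>\<close>, at cost of order \<open>E\<close>. What is left is to transport, on
  the side of \<open>\<mu>\<close>, the marginal with weight \<open>\<phi>(x)\<close> to the one with weight \<open>b \<phi>(y)\<close> on good pairs and
  \<open>\<phi>(x)\<close> on bad pairs, where \<open>b\<close> equalises the masses and \<open>|1 - b|\<close> is of order \<open>\<surd>E\<close>. The gradient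
  bound makes the two weights differ by at most \<open>d(x) v(x, y)\<close>, where \<open>v\<close> has square integral of order \<open>E\<close>.

  The excess \<open>\<eta> \<le> d v\<close> has mass of order \<open>\<surd>E\<close> only, so sending it directly across the ball would
  cost too much. Both weights are at least a constant times \<open>d\<^sup>2\<close>, though, and this common
  background can be pushed instead. Put mass \<open>\<theta>\<close>, uniformly spread, on the segment from \<open>x\<close> to \<open>q\<close>, and
  an atom of mass \<open>\<eta>\<close> at \<open>x\<close>. Shifting everything along the segment turns the atom at \<open>x\<close> into an
  atom at \<open>q\<close> at a cost of order \<open>\<eta>\<^sup>2 / \<theta>\<close>, quadratic in \<open>\<eta>\<close> (\<open>segment_shift_coupling\<close>). With \<open>\<theta>\<close> a
  small multiple of \<open>d(x)\<^sup>2\<close> and \<open>q\<close> uniform in the half ball, the superposition of all these segments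
  has density at most the background (\<open>segment_background_le\<close>), because depth is concave and \<open>\<mu>\<close>
  has bounded density on \<open>B\<close>. The cost becomes the integral of \<open>v\<^sup>2\<close>, as needed
  (\<open>move_excess_to_uniform\<close>). Doing this for the positive and for the negative part of the difference
  of the weights sends both to the same measure.

  The steps are composed by gluing couplings over small cells, which costs an arbitrarily
  small error (\<open>approximate_gluing\<close>). The gradient bound holds only where the
  gradient exists, so its use requires that a Lipschitz function of one variable be the integral of
  its derivative (\<open>lipschitz_increment_bound\<close>); \<open>\<phi>\<close> being radial reduces to that case.
\<close>

section \<open>Couplings: sums, exchange, and gluing\<close>

definition add_measure :: "'a measure \<Rightarrow> 'a measure \<Rightarrow> 'a measure" where
  "add_measure M N = measure_of (space M) (sets M) (\<lambda>A. emeasure M A + emeasure N A)"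

lemma space_add_measure [simp]: "space (add_measure M N) = space M"
  and sets_add_measure [simp, measurable_cong]: "sets (add_measure M N) = sets M"
  by (auto simp: add_measure_def)

lemma emeasure_add_measure:
  assumes sets: "sets N = sets M" and A: "A \<in> sets M"
  shows "emeasure (add_measure M N) A = emeasure M A + emeasure N A"
  unfolding add_measure_def
proof (rule emeasure_measure_of_sigma)
  show "sigma_algebra (space M) (sets M)" ..
  show "positive (sets M) (\<lambda>A. emeasure M A + emeasure N A)"
    by (simp add: positive_def)
  show "countably_additive (sets M) (\<lambda>A. emeasure M A + emeasure N A)"
  proof (intro countably_additiveI)
    fix F :: "nat \<Rightarrow> _" assume F: "range F \<subseteq> sets M" "disjoint_family F" "\<Union>(range F) \<in> sets M"
    have "(\<Sum>i. emeasure M (F i) + emeasure N (F i)) = (\<Sum>i. emeasure M (F i)) + (\<Sum>i. emeasure N (F i))"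
      by (rule suminf_add[symmetric]) auto
    also have "\<dots> = emeasure M (\<Union>(range F)) + emeasure N (\<Union>(range F))"
      using F by (simp add: suminf_emeasure sets)
    finally show "(\<Sum>i. emeasure M (F i) + emeasure N (F i)) = \<dots>" .
  qed
qed (rule A)

lemma nn_integral_add_measure:
  assumes sets: "sets N = sets M" and f: "f \<in> borel_measurable M"
  shows "(\<integral>\<^sup>+x. f x \<partial>add_measure M N) = (\<integral>\<^sup>+x. f x \<partial>M) + (\<integral>\<^sup>+x. f x \<partial>N)"
  using f
proof induction
  case (cong f g)
  moreover have "space N = space M" using sets by (rule sets_eq_imp_space_eq)
  ultimately show ?case by (simp cong: nn_integral_cong_simp)
next
  case (set A)
  then show ?case by (simp add: emeasure_add_measure sets)
next
  case (mult u c)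
  then show ?case
    by (simp add: nn_integral_cmult distrib_left measurable_cong_sets[OF sets refl]
        measurable_cong_sets[OF sets_add_measure refl])
next
  case (add u v)
  then show ?case
    by (simp add: nn_integral_add measurable_cong_sets[OF sets refl]
        measurable_cong_sets[OF sets_add_measure refl] algebra_simps)
next
  case (seq U)
  have m: "U i \<in> borel_measurable N" "U i \<in> borel_measurable (add_measure M N)" for i
    using seq by (simp_all add: measurable_cong_sets[OF sets refl] measurable_cong_sets[OF sets_add_measure refl])
  have inc: "incseq (\<lambda>i. \<integral>\<^sup>+x. U i x \<partial>M)" "incseq (\<lambda>i. \<integral>\<^sup>+x. U i x \<partial>N)"
    using seq by (auto simp: incseq_def le_fun_def intro!: nn_integral_mono)
  have S: "Sup (range U) = (\<lambda>x. SUP i. U i x)" by (auto simp: fun_eq_iff image_image)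
  show ?case
    unfolding S using seq m inc
    by (simp add: nn_integral_monotone_convergence_SUP ennreal_SUP_add)
qed

lemma emeasure_distr_eq:
  assumes [measurable]: "X \<in> M \<rightarrow>\<^sub>M L" "C \<in> sets L"
  shows "emeasure (distr M L X) C = (\<integral>\<^sup>+w. indicator C (X w) \<partial>M)"
proof -
  have "emeasure (distr M L X) C = (\<integral>\<^sup>+x. indicator C x \<partial>distr M L X)"
    by (rule nn_integral_indicator[symmetric]) simp
  also have "\<dots> = (\<integral>\<^sup>+w. indicator C (X w) \<partial>M)" by (rule nn_integral_distr) simp_all
  finally show ?thesis .
qed

text \<open>
  Costs are kept in squared form: with constants left free, sums of squares replace the triangle
  inequality in \<open>L\<^sup>2\<close> throughout, and the root is taken only at the end.
\<close>
definition quad_cost :: "((real ^ 'n) \<times> (real ^ 'n)) measure \<Rightarrow> ennreal" where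
  "quad_cost \<pi> = (\<integral>\<^sup>+p. ennreal ((norm (fst p - snd p))\<^sup>2) \<partial>\<pi>)"

lemma couplingsD:
  assumes "\<pi> \<in> couplings \<sigma> \<tau>"
  shows "sets \<pi> = sets borel" "distr \<pi> borel fst = \<sigma>" "distr \<pi> borel snd = \<tau>"
    "sets \<sigma> = sets borel" "sets \<tau> = sets borel"
  using assms by (auto simp: couplings_def)

text \<open>
  The way most couplings below arise: \<open>M\<close> labels the particles of mass, \<open>X\<close> gives their initial and
  \<open>Y\<close> their final positions.
\<close>
lemma distr_pair_in_couplings:
  fixes X Y :: "'a \<Rightarrow> real ^ 'n"
  assumes [measurable]: "X \<in> M \<rightarrow>\<^sub>M borel" "Y \<in> M \<rightarrow>\<^sub>M borel"
  shows "distr M borel (\<lambda>w. (X w, Y w)) \<in> couplings (distr M borel X) (distr M borel Y)"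
proof -
  have m: "(\<lambda>w. (X w, Y w)) \<in> M \<rightarrow>\<^sub>M borel" by (simp add: borel_prod[symmetric])
  have f: "(fst :: (real^'n)\<times>(real^'n) \<Rightarrow> _) \<in> borel \<rightarrow>\<^sub>M borel" "(snd :: (real^'n)\<times>(real^'n) \<Rightarrow> _) \<in> borel \<rightarrow>\<^sub>M borel"
    by (simp_all add: borel_prod[symmetric])
  show ?thesis
    unfolding couplings_def by (simp add: distr_distr[OF f(1) m] distr_distr[OF f(2) m] comp_def)
qed

lemma quad_cost_distr_pair:
  fixes X Y :: "'a \<Rightarrow> real ^ 'n"
  assumes [measurable]: "X \<in> M \<rightarrow>\<^sub>M borel" "Y \<in> M \<rightarrow>\<^sub>M borel"
  shows "quad_cost (distr M borel (\<lambda>w. (X w, Y w))) = (\<integral>\<^sup>+w. ennreal ((norm (X w - Y w))\<^sup>2) \<partial>M)"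
  unfolding quad_cost_def
proof -
  have m: "(\<lambda>w. (X w, Y w)) \<in> M \<rightarrow>\<^sub>M borel" by (simp add: borel_prod[symmetric])
  have f: "(\<lambda>p. ennreal ((norm (fst p - snd p :: real^'n))\<^sup>2)) \<in> borel_measurable borel"
    by (simp add: borel_prod[symmetric])
  show "(\<integral>\<^sup>+p. ennreal ((norm (fst p - snd p))\<^sup>2) \<partial>distr M borel (\<lambda>w. (X w, Y w))) =
      (\<integral>\<^sup>+w. ennreal ((norm (X w - Y w))\<^sup>2) \<partial>M)"
    by (subst nn_integral_distr[OF m]) (use f in simp_all)
qed

lemma distr_add_measure:
  assumes sets: "sets N = sets M" and f: "f \<in> M \<rightarrow>\<^sub>M L"
  shows "distr (add_measure M N) L f = add_measure (distr M L f) (distr N L f)"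
proof (rule measure_eqI)
  have sp: "space N = space M" using sets by (rule sets_eq_imp_space_eq)
  have f': "f \<in> N \<rightarrow>\<^sub>M L" "f \<in> add_measure M N \<rightarrow>\<^sub>M L"
    using f by (simp_all add: measurable_cong_sets[OF sets refl] measurable_cong_sets[OF sets_add_measure refl])
  fix A assume "A \<in> sets (distr (add_measure M N) L f)"
  then have A: "A \<in> sets L" by simp
  show "emeasure (distr (add_measure M N) L f) A = emeasure (add_measure (distr M L f) (distr N L f)) A"
    using A f f' measurable_sets[OF f A] sets
    by (simp add: emeasure_distr emeasure_add_measure sp)
qed simp

text \<open>
  Superposition: parts of the mass may be transported independently. In particular a common
  part of source and target can stay at rest.
\<close>
lemma couplings_add:
  assumes 1: "\<pi>1 \<in> couplings \<sigma>1 \<tau>1" and 2: "\<pi>2 \<in> couplings \<sigma>2 \<tau>2"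
  shows "add_measure \<pi>1 \<pi>2 \<in> couplings (add_measure \<sigma>1 \<sigma>2) (add_measure \<tau>1 \<tau>2)"
proof -
  note d = couplingsD[OF 1] couplingsD[OF 2]
  have f: "fst \<in> \<pi>1 \<rightarrow>\<^sub>M borel" "snd \<in> \<pi>1 \<rightarrow>\<^sub>M borel"
    using d(1) by (auto simp: measurable_cong_sets[OF d(1) refl] borel_prod[symmetric])
  show ?thesis
    using f d unfolding couplings_def by (simp add: distr_add_measure)
qed

lemma quad_cost_add:
  assumes "sets \<pi>1 = sets borel" "sets \<pi>2 = sets borel"
  shows "quad_cost (add_measure \<pi>1 \<pi>2) = quad_cost \<pi>1 + quad_cost \<pi>2"
  unfolding quad_cost_def
  by (rule nn_integral_add_measure)
    (use assms in \<open>simp_all add: measurable_cong_sets[OF assms(1) refl] borel_prod[symmetric]\<close>)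

lemma diagonal_coupling:
  assumes "sets \<sigma> = sets borel"
  shows "\<exists>\<gamma>\<in>couplings \<sigma> \<sigma>. quad_cost \<gamma> = 0"
proof -
  have m: "(\<lambda>x. x) \<in> \<sigma> \<rightarrow>\<^sub>M borel" using assms by (rule measurable_ident_sets)
  have "distr \<sigma> borel (\<lambda>x. x) = \<sigma>" using assms by (intro distr_id2) auto
  then have "distr \<sigma> borel (\<lambda>w. (w, w)) \<in> couplings \<sigma> \<sigma>"
    using distr_pair_in_couplings[OF m m] by simp
  moreover have "quad_cost (distr \<sigma> borel (\<lambda>w. (w, w))) = 0"
    using quad_cost_distr_pair[OF m m] by simp
  ultimately show ?thesis by blast
qed

text \<open>
  The normalised product measure is a coupling; its cost is at most the mass times the squared
  diameter. It serves for masses that are themselves of the order of the admissible cost.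
\<close>
lemma equal_mass_coupling_in_ball:
  fixes \<sigma> \<tau> :: "(real ^ 'n) measure"
  assumes s: "sets \<sigma> = sets borel" "sets \<tau> = sets borel"
    and m: "emeasure \<sigma> UNIV = emeasure \<tau> UNIV" and fin: "emeasure \<sigma> UNIV \<noteq> \<infinity>"
    and supp: "AE x in \<sigma>. dist z x \<le> r" "AE y in \<tau>. dist z y \<le> r"
  shows "\<exists>\<gamma>\<in>couplings \<sigma> \<tau>. quad_cost \<gamma> \<le> ennreal (4 * r\<^sup>2) * emeasure \<sigma> UNIV"
proof -
  have sp: "space \<sigma> = UNIV" "space \<tau> = UNIV"
    using s[THEN sets_eq_imp_space_eq] by auto
  interpret A: finite_measure \<sigma> by standard (use fin sp in auto)
  interpret B: finite_measure \<tau> by standard (use fin m sp in auto)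
  interpret AB: pair_sigma_finite \<sigma> \<tau> ..
  note [measurable_cong] = s
  \<comment> \<open>If both masses vanish, \<open>k\<close> is infinite, but then the product measure is null.\<close>
  define k where "k = 1 / emeasure \<sigma> UNIV"
  have k: "emeasure \<sigma> UNIV * k = 1" if "emeasure \<sigma> UNIV \<noteq> 0"
    using that fin unfolding k_def by (simp add: ennreal_times_divide less_top[symmetric])
  have unscale: "emeasure \<rho> C * (emeasure \<sigma> UNIV * k) = emeasure \<rho> C"
    if "space \<rho> = space \<sigma>" "emeasure \<rho> UNIV = emeasure \<sigma> UNIV" for \<rho> C
    using emeasure_space[of \<rho> C] that sp by (cases "emeasure \<sigma> UNIV = 0") (auto simp: k)
  define D where "D = density (\<sigma> \<Otimes>\<^sub>M \<tau>) (\<lambda>_. k)"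
  have sD[measurable_cong]: "sets D = sets (\<sigma> \<Otimes>\<^sub>M \<tau>)" by (simp add: D_def)
  have Dint: "(\<integral>\<^sup>+w. u w \<partial>D) = (\<integral>\<^sup>+x. \<integral>\<^sup>+y. k * u (x, y) \<partial>\<tau> \<partial>\<sigma>)"
    if [measurable]: "u \<in> borel_measurable (\<sigma> \<Otimes>\<^sub>M \<tau>)" for u
    unfolding D_def by (subst nn_integral_density) (simp_all add: B.nn_integral_fst[symmetric])
  have 1: "distr D borel fst = \<sigma>"
  proof (rule measure_eqI)
    fix C assume "C \<in> sets (distr D borel fst)"
    then have [measurable]: "C \<in> sets borel" by simp
    have "emeasure (distr D borel fst) C = (\<integral>\<^sup>+x. \<integral>\<^sup>+y. k * indicator C x \<partial>\<tau> \<partial>\<sigma>)"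
      by (subst emeasure_distr_eq) (auto simp: Dint)
    also have "\<dots> = emeasure \<sigma> C * (emeasure \<sigma> UNIV * k)"
      by (simp add: nn_integral_cmult sp m nn_integral_multc mult_ac)
    also have "\<dots> = emeasure \<sigma> C" by (rule unscale[OF refl refl])
    finally show "emeasure (distr D borel fst) C = emeasure \<sigma> C" .
  qed (simp add: s)
  have 2: "distr D borel snd = \<tau>"
  proof (rule measure_eqI)
    fix C assume "C \<in> sets (distr D borel snd)"
    then have [measurable]: "C \<in> sets borel" by simp
    have "emeasure (distr D borel snd) C = (\<integral>\<^sup>+x. \<integral>\<^sup>+y. k * indicator C y \<partial>\<tau> \<partial>\<sigma>)"
      by (subst emeasure_distr_eq) (auto simp: Dint)
    also have "\<dots> = emeasure \<tau> C * (emeasure \<sigma> UNIV * k)"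
      by (simp add: nn_integral_cmult sp m nn_integral_multc mult_ac)
    also have "\<dots> = emeasure \<tau> C" by (rule unscale[OF sp(2)[folded sp(1)] m[symmetric]])
    finally show "emeasure (distr D borel snd) C = emeasure \<tau> C" .
  qed (simp add: s)
  have "sets D = sets borel" unfolding sD sets_pair_measure_cong[OF s] by (simp only: borel_prod)
  then have "D \<in> couplings \<sigma> \<tau>" unfolding couplings_def using 1 2 by simp
  moreover have "quad_cost D \<le> ennreal (4 * r\<^sup>2) * emeasure \<sigma> UNIV"
  proof -
    have "quad_cost D = (\<integral>\<^sup>+x. \<integral>\<^sup>+y. k * ennreal ((norm (x - y))\<^sup>2) \<partial>\<tau> \<partial>\<sigma>)"
      unfolding quad_cost_def using Dint[of "\<lambda>p. ennreal ((norm (fst p - snd p))\<^sup>2)"] by simp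
    also have "\<dots> \<le> (\<integral>\<^sup>+x. \<integral>\<^sup>+y. k * ennreal (4 * r\<^sup>2) \<partial>\<tau> \<partial>\<sigma>)"
      using supp(1)
    proof (intro nn_integral_mono_AE, eventually_elim)
      fix x assume x: "dist z x \<le> r"
      show "(\<integral>\<^sup>+y. k * ennreal ((norm (x - y))\<^sup>2) \<partial>\<tau>) \<le> (\<integral>\<^sup>+y. k * ennreal (4 * r\<^sup>2) \<partial>\<tau>)"
        using supp(2)
      proof (intro nn_integral_mono_AE, eventually_elim)
        fix y assume "dist z y \<le> r"
        then have "norm (x - y) \<le> 2 * r"
          using x dist_triangle3[of x y z] by (simp add: dist_norm)
        then have "(norm (x - y))\<^sup>2 \<le> (2 * r)\<^sup>2" by (intro power_mono) auto
        then show "k * ennreal ((norm (x - y))\<^sup>2) \<le> k * ennreal (4 * r\<^sup>2)"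
          by (intro mult_left_mono ennreal_leI) (auto simp: power_mult_distrib)
      qed
    qed
    also have "\<dots> = ennreal (4 * r\<^sup>2) * emeasure \<sigma> UNIV * (emeasure \<sigma> UNIV * k)"
      by (simp add: sp m mult_ac)
    also have "\<dots> \<le> ennreal (4 * r\<^sup>2) * emeasure \<sigma> UNIV"
      by (cases "emeasure \<sigma> UNIV = 0") (auto simp: k)
    finally show ?thesis .
  qed
  ultimately show ?thesis by blast
qed

text \<open>
  The cell of a point is the index of the first member of a dense sequence that is close to it.
\<close>
lemma measurable_cell_index:
  assumes "\<delta> > (0::real)"
  obtains j :: "'a::{second_countable_topology, metric_space} \<Rightarrow> nat" where "j \<in> borel \<rightarrow>\<^sub>M count_space UNIV"
    "\<And>x y. j x = j y \<Longrightarrow> dist x y \<le> \<delta>"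
proof -
  obtain D :: "'a set" where D: "countable D" "\<And>X. open X \<Longrightarrow> X \<noteq> {} \<Longrightarrow> \<exists>d\<in>D. d \<in> X"
    using countable_dense_exists by blast
  define e where "e = from_nat_into D"
  have ex: "\<exists>i. dist y (e i) < \<delta> / 2" for y
  proof -
    obtain d where "d \<in> D" "d \<in> ball y (\<delta>/2)" using D(2)[of "ball y (\<delta>/2)"] assms by auto
    then obtain i where "e i = d" using from_nat_into_surj[OF D(1), of d] by (auto simp: e_def)
    then show ?thesis using \<open>d \<in> ball y (\<delta>/2)\<close> by auto
  qed
  define j where "j y = (LEAST i. dist y (e i) < \<delta> / 2)" for y
  have jd: "dist y (e (j y)) < \<delta> / 2" for y unfolding j_def by (rule LeastI_ex[OF ex])
  show ?thesis
  proof
    show "j \<in> borel \<rightarrow>\<^sub>M count_space UNIV" unfolding j_def by measurable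
    fix x y assume "j x = j y"
    then show "dist x y \<le> \<delta>" using jd[of x] jd[of y] dist_triangle2[of x y "e (j x)"] by simp
  qed
qed

text \<open>
  Exact gluing would disintegrate both couplings over the middle measure. Instead the middle space is cut
  into countably many small cells, and the two couplings are made independent conditionally on
  the event that both middle points lie in the same cell. This preserves the outer marginals
  exactly, and the middle points differ by at most the cell diameter.
\<close>
lemma approximate_gluing:
  fixes \<sigma>1 \<sigma>2 \<sigma>3 :: "(real ^ 'n) measure"
  assumes \<pi>1: "\<pi>1 \<in> couplings \<sigma>1 \<sigma>2" and \<pi>2: "\<pi>2 \<in> couplings \<sigma>2 \<sigma>3"
    and fin: "emeasure \<sigma>2 UNIV \<noteq> \<infinity>" and e: "e > (0::real)"
  shows "\<exists>\<gamma>\<in>couplings \<sigma>1 \<sigma>3. quad_cost \<gamma> \<le> 3 * (quad_cost \<pi>1 + quad_cost \<pi>2) + ennreal e"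
proof -
  note s1 = couplingsD[OF \<pi>1] and s2 = couplingsD[OF \<pi>2]
  have [measurable_cong]: "sets \<pi>1 = sets (borel \<Otimes>\<^sub>M borel)" "sets \<pi>2 = sets (borel \<Otimes>\<^sub>M borel)"
    unfolding borel_prod by (rule s1(1), rule s2(1))
  note [measurable_cong] = s1(4) s1(5) s2(5)
  have sp: "space \<pi>1 = UNIV" "space \<pi>2 = UNIV" "space \<sigma>2 = UNIV"
    using sets_eq_imp_space_eq[OF s1(1)] sets_eq_imp_space_eq[OF s2(1)] sets_eq_imp_space_eq[OF s1(5)] by simp_all
  interpret S: finite_measure \<sigma>2 by standard (use fin sp in auto)
  interpret P1: finite_measure \<pi>1
  proof
    have "emeasure (distr \<pi>1 borel snd) UNIV = emeasure \<pi>1 UNIV" by (simp add: emeasure_distr sp)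
    then show "emeasure \<pi>1 (space \<pi>1) \<noteq> \<infinity>" using fin s1 sp by simp
  qed
  interpret P2: finite_measure \<pi>2
  proof
    have "emeasure (distr \<pi>2 borel fst) UNIV = emeasure \<pi>2 UNIV" by (simp add: emeasure_distr sp)
    then show "emeasure \<pi>2 (space \<pi>2) \<noteq> \<infinity>" using fin s2 sp by simp
  qed
  interpret PP: pair_sigma_finite \<pi>1 \<pi>2 ..
  define M where "M = measure \<sigma>2 UNIV"
  have M: "emeasure \<sigma>2 UNIV = ennreal M" "M \<ge> 0" using S.emeasure_eq_measure[of UNIV] by (auto simp: M_def)
  \<comment> \<open>Chosen so that the error \<open>3 * \<delta>\<^sup>2 * M\<close> is at most \<open>e\<close>, also when \<open>M = 0\<close>.\<close>
  define \<delta> where "\<delta> = sqrt (e / (3 * (M + 1)))"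
  have \<delta>: "\<delta> > 0" using e M by (simp add: \<delta>_def)
  obtain j :: "real ^ 'n \<Rightarrow> nat" where j[measurable]: "j \<in> borel \<rightarrow>\<^sub>M count_space UNIV"
    and jd: "\<And>x y. j x = j y \<Longrightarrow> dist x y \<le> \<delta>"
    using measurable_cell_index[OF \<delta>] by blast
  \<comment> \<open>The density \<open>k\<close>, with respect to the product of the couplings, of conditional independence given
    the cell; cells of measure zero do not matter because they are only countably many.\<close>
  define s where "s i = emeasure \<sigma>2 {y. j y = i}" for i
  define k where "k y y' = (if j y = j y' then 1 / s (j y) else 0)" for y y'
  have [measurable]: "s \<in> borel_measurable (count_space UNIV)" by simp
  have "Measurable.pred (borel \<Otimes>\<^sub>M borel) (\<lambda>p. \<exists>i. j (fst p) = i \<and> j (snd p) = i)" by measurable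
  then have [measurable]: "Measurable.pred (borel \<Otimes>\<^sub>M borel) (\<lambda>p. j (fst p) = j (snd p))"
    by (rule measurable_cong[THEN iffD1, rotated]) auto
  have km: "(\<lambda>p. k (fst p) (snd p)) \<in> borel_measurable (borel \<Otimes>\<^sub>M borel)"
    unfolding k_def by measurable
  have [measurable (raw)]: "(\<lambda>w. k (f w) (g w)) \<in> borel_measurable N"
    if "f \<in> N \<rightarrow>\<^sub>M borel" "g \<in> N \<rightarrow>\<^sub>M borel" for f g and N :: "'w measure"
    using measurable_compose[OF measurable_Pair[OF that] km] by simp
  have sfin: "s i \<noteq> \<infinity>" for i unfolding s_def by (metis S.emeasure_finite infinity_ennreal_def)
  have inner: "(\<integral>\<^sup>+w. k y (h w) \<partial>\<rho>) = (if s (j y) = 0 then 0 else 1)"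
    if d: "distr \<rho> borel h = \<sigma>2" and [measurable]: "h \<in> \<rho> \<rightarrow>\<^sub>M borel" for y \<rho> and h :: "_ \<Rightarrow> real ^ 'n"
  proof -
    have "(\<integral>\<^sup>+w. k y (h w) \<partial>\<rho>) = (\<integral>\<^sup>+y'. k y y' \<partial>distr \<rho> borel h)"
      by (subst nn_integral_distr) auto
    also have "\<dots> = (\<integral>\<^sup>+y'. 1 / s (j y) * indicator {y'. j y' = j y} y' \<partial>\<sigma>2)"
      unfolding d by (intro nn_integral_cong) (auto simp: k_def)
    also have "\<dots> = 1 / s (j y) * s (j y)"
    proof -
      have "{y'. j y' = j y} \<in> sets \<sigma>2" unfolding s1(5) by measurable
      then show ?thesis by (subst nn_integral_cmult_indicator) (auto simp: s_def)
    qed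
    also have "\<dots> = (if s (j y) = 0 then 0 else 1)"
      using sfin by (auto simp: ennreal_divide_times less_top[symmetric])
    finally show ?thesis .
  qed
  have ksym: "k y y' = k y' y" for y y' by (auto simp: k_def)
  have i1: "(\<integral>\<^sup>+q. k y (fst q) \<partial>\<pi>2) = (if s (j y) = 0 then 0 else 1)" for y
    by (rule inner[OF s2(2)]) measurable
  have i2: "(\<integral>\<^sup>+p. k (snd p) y \<partial>\<pi>1) = (if s (j y) = 0 then 0 else 1)" for y
    unfolding ksym[of _ y] by (rule inner[OF s1(3)]) measurable
  have nul: "AE y in \<sigma>2. s (j y) \<noteq> 0"
  proof (rule AE_I)
    show "{y \<in> space \<sigma>2. \<not> s (j y) \<noteq> 0} \<subseteq> (\<Union>i\<in>{i. s i = 0}. {y. j y = i})" by auto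
    have ms: "{y. j y = i} \<in> sets \<sigma>2" for i unfolding s1(5) by measurable
    show "(\<Union>i\<in>{i. s i = 0}. {y. j y = i}) \<in> sets \<sigma>2" using ms by (intro sets.countable_UN'') auto
    have "(\<Union>i\<in>{i. s i = 0}. {y. j y = i}) \<in> null_sets \<sigma>2"
      by (intro null_sets_UN') (use ms in \<open>auto simp: s_def\<close>)
    then show "emeasure \<sigma>2 (\<Union>i\<in>{i. s i = 0}. {y. j y = i}) = 0" by auto
  qed
  have n1: "AE p in \<pi>1. s (j (snd p)) \<noteq> 0"
    using nul unfolding s1(3)[symmetric] by (subst (asm) AE_distr_iff) auto
  have n2: "AE q in \<pi>2. s (j (fst q)) \<noteq> 0"
    using nul unfolding s2(2)[symmetric] by (subst (asm) AE_distr_iff) auto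
  have Dm: "(\<lambda>(p, q). k (snd p) (fst q)) \<in> borel_measurable (\<pi>1 \<Otimes>\<^sub>M \<pi>2)"
    using measurable_compose[OF measurable_Pair km, of "\<lambda>w. snd (fst w)" "\<pi>1 \<Otimes>\<^sub>M \<pi>2" "\<lambda>w. fst (snd w)"]
    by (simp add: split_beta)
  define D where "D = density (\<pi>1 \<Otimes>\<^sub>M \<pi>2) (\<lambda>(p, q). k (snd p) (fst q))"
  have Dint: "(\<integral>\<^sup>+w. u w \<partial>D) = (\<integral>\<^sup>+p. \<integral>\<^sup>+q. k (snd p) (fst q) * u (p, q) \<partial>\<pi>2 \<partial>\<pi>1)"
    if [measurable]: "u \<in> borel_measurable (\<pi>1 \<Otimes>\<^sub>M \<pi>2)" for u
    unfolding D_def by (subst nn_integral_density) (simp_all add: P2.nn_integral_fst[symmetric])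
  have Dint': "(\<integral>\<^sup>+w. u w \<partial>D) = (\<integral>\<^sup>+q. \<integral>\<^sup>+p. k (snd p) (fst q) * u (p, q) \<partial>\<pi>1 \<partial>\<pi>2)"
    if [measurable]: "u \<in> borel_measurable (\<pi>1 \<Otimes>\<^sub>M \<pi>2)" for u
    unfolding D_def by (subst nn_integral_density) (simp_all add: PP.nn_integral_snd[symmetric])
  have D1: "(\<integral>\<^sup>+w. u (fst w) \<partial>D) = (\<integral>\<^sup>+p. u p \<partial>\<pi>1)" if [measurable]: "u \<in> borel_measurable \<pi>1" for u
  proof -
    have "(\<integral>\<^sup>+w. u (fst w) \<partial>D) = (\<integral>\<^sup>+p. u p * (\<integral>\<^sup>+q. k (snd p) (fst q) \<partial>\<pi>2) \<partial>\<pi>1)"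
      by (subst Dint) (auto simp: nn_integral_cmult[symmetric] mult.commute)
    also have "\<dots> = (\<integral>\<^sup>+p. u p \<partial>\<pi>1)"
      by (rule nn_integral_cong_AE) (use n1 in \<open>eventually_elim, simp add: i1\<close>)
    finally show ?thesis .
  qed
  have D2: "(\<integral>\<^sup>+w. u (snd w) \<partial>D) = (\<integral>\<^sup>+p. u p \<partial>\<pi>2)" if [measurable]: "u \<in> borel_measurable \<pi>2" for u
  proof -
    have "(\<integral>\<^sup>+w. u (snd w) \<partial>D) = (\<integral>\<^sup>+q. u q * (\<integral>\<^sup>+p. k (snd p) (fst q) \<partial>\<pi>1) \<partial>\<pi>2)"
      by (subst Dint') (auto simp: nn_integral_cmult[symmetric] mult.commute)
    also have "\<dots> = (\<integral>\<^sup>+p. u p \<partial>\<pi>2)"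
      by (rule nn_integral_cong_AE) (use n2 in \<open>eventually_elim, simp add: i2\<close>)
    finally show ?thesis .
  qed
  have sD[measurable_cong]: "sets D = sets (\<pi>1 \<Otimes>\<^sub>M \<pi>2)" by (simp add: D_def)
  define X where "X w = fst (fst w)" for w :: "((real^'n)\<times>(real^'n)) \<times> ((real^'n)\<times>(real^'n))"
  define Z where "Z w = snd (snd w)" for w :: "((real^'n)\<times>(real^'n)) \<times> ((real^'n)\<times>(real^'n))"
  have [measurable]: "X \<in> D \<rightarrow>\<^sub>M borel" "Z \<in> D \<rightarrow>\<^sub>M borel" unfolding X_def Z_def by measurable
  have dX: "distr D borel X = \<sigma>1"
  proof (rule measure_eqI)
    fix C assume "C \<in> sets (distr D borel X)"
    then have [measurable]: "C \<in> sets borel" by simp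
    have "emeasure (distr D borel X) C = (\<integral>\<^sup>+w. indicator C (fst (fst w)) \<partial>D)"
      by (subst emeasure_distr_eq) (simp_all add: X_def)
    also have "\<dots> = (\<integral>\<^sup>+p. indicator C (fst p) \<partial>\<pi>1)" by (rule D1) measurable
    also have "\<dots> = emeasure \<sigma>1 C"
      unfolding s1(2)[symmetric] by (subst emeasure_distr_eq) simp_all
    finally show "emeasure (distr D borel X) C = emeasure \<sigma>1 C" .
  qed (simp add: s1)
  have dZ: "distr D borel Z = \<sigma>3"
  proof (rule measure_eqI)
    fix C assume "C \<in> sets (distr D borel Z)"
    then have [measurable]: "C \<in> sets borel" by simp
    have "emeasure (distr D borel Z) C = (\<integral>\<^sup>+w. indicator C (snd (snd w)) \<partial>D)"
      by (subst emeasure_distr_eq) (simp_all add: Z_def)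
    also have "\<dots> = (\<integral>\<^sup>+p. indicator C (snd p) \<partial>\<pi>2)" by (rule D2) measurable
    also have "\<dots> = emeasure \<sigma>3 C"
      unfolding s2(3)[symmetric] by (subst emeasure_distr_eq) simp_all
    finally show "emeasure (distr D borel Z) C = emeasure \<sigma>3 C" .
  qed (simp add: s2)
  let ?c = "\<lambda>p::(real^'n)\<times>(real^'n). ennreal ((norm (fst p - snd p))\<^sup>2)"
  have "distr D borel (\<lambda>w. (X w, Z w)) \<in> couplings \<sigma>1 \<sigma>3"
    using distr_pair_in_couplings[of X D Z] by (simp add: dX dZ)
  moreover have "quad_cost (distr D borel (\<lambda>w. (X w, Z w))) \<le> 3 * (quad_cost \<pi>1 + quad_cost \<pi>2) + ennreal e"
  proof -
    have AEk: "AE w in D. j (snd (fst w)) = j (fst (snd w))"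
      unfolding D_def by (subst AE_density[OF Dm]) (auto simp: k_def split_beta)
    have "quad_cost (distr D borel (\<lambda>w. (X w, Z w))) = (\<integral>\<^sup>+w. ennreal ((norm (X w - Z w))\<^sup>2) \<partial>D)"
      by (rule quad_cost_distr_pair) measurable
    also have "\<dots> \<le> (\<integral>\<^sup>+w. 3 * ?c (fst w) + (3 * ?c (snd w) + ennreal (3 * \<delta>\<^sup>2)) \<partial>D)"
      using AEk
    proof (intro nn_integral_mono_AE, eventually_elim)
      fix w :: "((real^'n)\<times>(real^'n)) \<times> ((real^'n)\<times>(real^'n))" assume jw: "j (snd (fst w)) = j (fst (snd w))"
      define p q t where "p = norm (fst (fst w) - snd (fst w))" and "q = norm (fst (snd w) - snd (snd w))"
        and "t = norm (snd (fst w) - fst (snd w))"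
      have t: "t \<le> \<delta>" using jd[OF jw] by (simp add: t_def dist_norm)
      have "X w - Z w = (fst (fst w) - snd (fst w)) + (snd (fst w) - fst (snd w)) + (fst (snd w) - snd (snd w))"
        by (simp add: X_def Z_def)
      then have "norm (X w - Z w) \<le> p + t + q"
        unfolding p_def q_def t_def by (metis add.commute add_right_mono norm_triangle_le norm_triangle_ineq)
      also have "\<dots> \<le> p + \<delta> + q" using t by simp
      finally have "(norm (X w - Z w))\<^sup>2 \<le> (p + \<delta> + q)\<^sup>2" by (intro power_mono) auto
      also have "\<dots> \<le> 3 * p\<^sup>2 + (3 * q\<^sup>2 + 3 * \<delta>\<^sup>2)"
      proof -
        have "0 \<le> (p - \<delta>)\<^sup>2 + (\<delta> - q)\<^sup>2 + (p - q)\<^sup>2" by simp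
        then show ?thesis by (simp add: power2_eq_square algebra_simps)
      qed
      finally have "ennreal ((norm (X w - Z w))\<^sup>2) \<le> ennreal (3 * p\<^sup>2 + (3 * q\<^sup>2 + 3 * \<delta>\<^sup>2))" by (rule ennreal_leI)
      also have "\<dots> = 3 * ?c (fst w) + (3 * ?c (snd w) + ennreal (3 * \<delta>\<^sup>2))"
        by (simp add: ennreal_plus ennreal_mult p_def q_def)
      finally show "ennreal ((norm (X w - Z w))\<^sup>2) \<le> 3 * ?c (fst w) + (3 * ?c (snd w) + ennreal (3 * \<delta>\<^sup>2))" .
    qed
    also have "\<dots> = 3 * (\<integral>\<^sup>+w. ?c (fst w) \<partial>D) + (3 * (\<integral>\<^sup>+w. ?c (snd w) \<partial>D) + (\<integral>\<^sup>+w. ennreal (3 * \<delta>\<^sup>2) \<partial>D))"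
      by (simp add: nn_integral_add nn_integral_cmult del: nn_integral_const)
    also have "(\<integral>\<^sup>+w. ?c (fst w) \<partial>D) = quad_cost \<pi>1" unfolding quad_cost_def by (rule D1) measurable
    also have "(\<integral>\<^sup>+w. ?c (snd w) \<partial>D) = quad_cost \<pi>2" unfolding quad_cost_def by (rule D2) measurable
    also have "(\<integral>\<^sup>+w. ennreal (3 * \<delta>\<^sup>2) \<partial>D) \<le> ennreal e"
    proof -
      have "(\<integral>\<^sup>+w. ennreal (3 * \<delta>\<^sup>2) \<partial>D) = (\<integral>\<^sup>+p. ennreal (3 * \<delta>\<^sup>2) \<partial>\<pi>1)" by (rule D1) measurable
      also have "\<dots> = ennreal (3 * \<delta>\<^sup>2) * emeasure \<pi>1 UNIV" by (simp add: sp)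
      also have "emeasure \<pi>1 UNIV = ennreal M"
        using M unfolding s1(3)[symmetric] by (simp add: emeasure_distr sp)
      also have "ennreal (3 * \<delta>\<^sup>2) * ennreal M = ennreal (3 * \<delta>\<^sup>2 * M)" using M by (simp add: ennreal_mult)
      also have "\<dots> \<le> ennreal e"
      proof (rule ennreal_leI)
        have "3 * \<delta>\<^sup>2 * M = e * (M / (M + 1))" using e M by (simp add: \<delta>_def divide_simps)
        also have "\<dots> \<le> e * 1" using e M by (intro mult_left_mono) auto
        finally show "3 * \<delta>\<^sup>2 * M \<le> e" by simp
      qed
      finally show ?thesis .
    qed
    finally show ?thesis by (simp add: distrib_left add.assoc add_left_mono)
  qed
  ultimately show ?thesis by blast
qed

lemma couplings_flip:
  fixes \<sigma> \<tau> :: "(real ^ 'n) measure"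
  assumes "\<gamma> \<in> couplings \<sigma> \<tau>"
  shows "\<exists>\<gamma>'\<in>couplings \<tau> \<sigma>. quad_cost \<gamma>' = quad_cost \<gamma>"
proof -
  note d = couplingsD[OF assms]
  have [measurable_cong]: "sets \<gamma> = sets (borel \<Otimes>\<^sub>M borel)" unfolding borel_prod by (rule d(1))
  have m: "snd \<in> \<gamma> \<rightarrow>\<^sub>M borel" "fst \<in> \<gamma> \<rightarrow>\<^sub>M borel" by measurable
  have "distr \<gamma> borel (\<lambda>w. (snd w, fst w)) \<in> couplings \<tau> \<sigma>"
    using distr_pair_in_couplings[OF m] d by simp
  moreover have "quad_cost (distr \<gamma> borel (\<lambda>w. (snd w, fst w))) = quad_cost \<gamma>"
    using quad_cost_distr_pair[OF m] by (simp add: quad_cost_def norm_minus_commute)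
  ultimately show ?thesis by blast
qed

lemma distr_density_add:
  assumes [measurable]: "F \<in> borel_measurable M" "H \<in> borel_measurable M" "X \<in> M \<rightarrow>\<^sub>M L"
    and nn: "\<And>w. 0 \<le> F w" "\<And>w. 0 \<le> H w" and eq: "\<And>w. Q w = F w + H w"
  shows "distr (density M (\<lambda>w. ennreal (Q w))) L X =
    add_measure (distr (density M (\<lambda>w. ennreal (F w))) L X) (distr (density M (\<lambda>w. ennreal (H w))) L X)"
proof (rule measure_eqI)
  fix C assume "C \<in> sets (distr (density M (\<lambda>w. ennreal (Q w))) L X)"
  then have [measurable]: "C \<in> sets L" by simp
  have Q[measurable]: "Q \<in> borel_measurable M"
    using borel_measurable_add[of F M H] by (simp add: eq[abs_def] fun_eq_iff cong: measurable_cong)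
  have d: "emeasure (distr (density M (\<lambda>w. ennreal (T w))) L X) C = (\<integral>\<^sup>+w. ennreal (T w) * indicator C (X w) \<partial>M)"
    if [measurable]: "T \<in> borel_measurable M" for T
    by (subst emeasure_distr_eq) (auto simp: nn_integral_density)
  have "emeasure (distr (density M (\<lambda>w. ennreal (Q w))) L X) C = (\<integral>\<^sup>+w. ennreal (Q w) * indicator C (X w) \<partial>M)"
    by (rule d[OF Q])
  also have "\<dots> = (\<integral>\<^sup>+w. ennreal (F w) * indicator C (X w) + ennreal (H w) * indicator C (X w) \<partial>M)"
    by (intro nn_integral_cong) (simp add: eq nn ennreal_plus distrib_right)
  also have "\<dots> = (\<integral>\<^sup>+w. ennreal (F w) * indicator C (X w) \<partial>M) + (\<integral>\<^sup>+w. ennreal (H w) * indicator C (X w) \<partial>M)"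
    by (rule nn_integral_add) measurable
  finally show "emeasure (distr (density M (\<lambda>w. ennreal (Q w))) L X) C = emeasure (add_measure
      (distr (density M (\<lambda>w. ennreal (F w))) L X) (distr (density M (\<lambda>w. ennreal (H w))) L X)) C"
    by (simp add: emeasure_add_measure d)
qed simp

lemma ennreal_glue_bound:
  assumes "0 \<le> s" "0 \<le> t" "0 \<le> u"
  shows "3 * (ennreal s + ennreal t) + ennreal u = ennreal (3 * (s + t) + u)"
proof -
  have "ennreal (3 * (s + t) + u) = ennreal (3 * (s + t)) + ennreal u" using assms by (intro ennreal_plus) auto
  also have "ennreal (3 * (s + t)) = ennreal 3 * ennreal (s + t)" using assms by (intro ennreal_mult) auto
  also have "ennreal (s + t) = ennreal s + ennreal t" using assms by (intro ennreal_plus) auto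
  finally show ?thesis by simp
qed

section \<open>Shifting mass along segments\<close>

text \<open>
  The next two lemmas compute the marginals of the monotone rearrangement on a line. Parametrise the mass
  by \<open>u\<close> in \<open>[0, 1 + \<tau>]\<close>. At the start the first \<open>\<tau>\<close> units sit at 0 and the rest is spread over
  \<open>[0, 1]\<close>, so \<open>u\<close> is at \<open>max 0 (u - \<tau>)\<close>; at the end the last \<open>\<tau>\<close> units sit at 1, so \<open>u\<close> is at
  \<open>min u 1\<close>. The two positions never differ by more than \<open>min \<tau> 1\<close>.
\<close>
lemma nn_integral_shift_max:
  fixes h :: "real \<Rightarrow> ennreal" and \<tau> :: real
  assumes [measurable]: "h \<in> borel_measurable borel" and \<tau>: "0 \<le> \<tau>"
  shows "(\<integral>\<^sup>+u. indicator {0..1+\<tau>} u * h (max 0 (u - \<tau>)) \<partial>lborel) =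
    ennreal \<tau> * h 0 + (\<integral>\<^sup>+s. indicator {0..1} s * h s \<partial>lborel)"
proof -
  have "(\<integral>\<^sup>+u. indicator {0..1+\<tau>} u * h (max 0 (u - \<tau>)) \<partial>lborel) =
      (\<integral>\<^sup>+u. h 0 * indicator {0..<\<tau>} u + indicator {0..1} (u - \<tau>) * h (u - \<tau>) \<partial>lborel)"
    using \<tau> by (intro nn_integral_cong) (auto simp: indicator_def max_def)
  also have "\<dots> = (\<integral>\<^sup>+u. h 0 * indicator {0..<\<tau>} u \<partial>lborel) + (\<integral>\<^sup>+u. indicator {0..1} (u - \<tau>) * h (u - \<tau>) \<partial>lborel)"
    by (rule nn_integral_add) measurable
  also have "(\<integral>\<^sup>+u. h 0 * indicator {0..<\<tau>} u \<partial>lborel) = ennreal \<tau> * h 0"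
    using \<tau> by (simp add: nn_integral_cmult_indicator mult.commute)
  also have "(\<integral>\<^sup>+u. indicator {0..1} (u - \<tau>) * h (u - \<tau>) \<partial>lborel) = (\<integral>\<^sup>+s. indicator {0..1} s * h s \<partial>lborel)"
    by (subst nn_integral_real_affine[where c = 1 and t = \<tau>]) simp_all
  finally show ?thesis .
qed

lemma nn_integral_shift_min:
  fixes h :: "real \<Rightarrow> ennreal" and \<tau> :: real
  assumes [measurable]: "h \<in> borel_measurable borel" and \<tau>: "0 \<le> \<tau>"
  shows "(\<integral>\<^sup>+u. indicator {0..1+\<tau>} u * h (min u 1) \<partial>lborel) =
    ennreal \<tau> * h 1 + (\<integral>\<^sup>+s. indicator {0..1} s * h s \<partial>lborel)"
proof -
  have "(\<integral>\<^sup>+u. indicator {0..1+\<tau>} u * h (min u 1) \<partial>lborel) =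
      (\<integral>\<^sup>+u. h 1 * indicator {1<..1+\<tau>} u + indicator {0..1} u * h u \<partial>lborel)"
    using \<tau> by (intro nn_integral_cong) (auto simp: indicator_def min_def)
  also have "\<dots> = (\<integral>\<^sup>+u. h 1 * indicator {1<..1+\<tau>} u \<partial>lborel) + (\<integral>\<^sup>+u. indicator {0..1} u * h u \<partial>lborel)"
    by (rule nn_integral_add) measurable
  also have "(\<integral>\<^sup>+u. h 1 * indicator {1<..1+\<tau>} u \<partial>lborel) = ennreal \<tau> * h 1"
    using \<tau> by (simp add: nn_integral_cmult_indicator mult.commute)
  finally show ?thesis .
qed

text \<open>
  Points \<open>(w, q, u)\<close> label the mass travelling along the segment from \<open>X w\<close> to \<open>q\<close>: the
  background of mass \<open>\<theta> w\<close> and the atom of mass \<open>\<theta> w * \<tau> w\<close>, with \<open>u\<close> as in the two lemmas above.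
\<close>
definition segment_space ::
  "'a measure \<Rightarrow> 'b measure \<Rightarrow> ('a \<Rightarrow> real) \<Rightarrow> ('a \<Rightarrow> real) \<Rightarrow> ('a \<times> 'b \<times> real) measure" where
  "segment_space M U \<theta> \<tau> =
     density (M \<Otimes>\<^sub>M (U \<Otimes>\<^sub>M lborel)) (\<lambda>(w, q, u). ennreal (\<theta> w) * indicator {0..1 + \<tau> w} u)"

lemma sets_segment_space [simp, measurable_cong]:
  "sets (segment_space M U \<theta> \<tau>) = sets (M \<Otimes>\<^sub>M (U \<Otimes>\<^sub>M lborel))"
  by (simp add: segment_space_def)

lemma nn_integral_segment_space:
  fixes \<theta> \<tau> :: "'a \<Rightarrow> real"
  assumes U: "sigma_finite_measure U"
    and [measurable]: "\<theta> \<in> borel_measurable M" "\<tau> \<in> borel_measurable M"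
    and g: "g \<in> borel_measurable (M \<Otimes>\<^sub>M (U \<Otimes>\<^sub>M lborel))"
  shows "(\<integral>\<^sup>+v. g v \<partial>segment_space M U \<theta> \<tau>) =
    (\<integral>\<^sup>+w. ennreal (\<theta> w) * (\<integral>\<^sup>+q. \<integral>\<^sup>+u. indicator {0..1 + \<tau> w} u * g (w, q, u) \<partial>lborel \<partial>U) \<partial>M)"
proof -
  interpret U: sigma_finite_measure U by (rule U)
  interpret UL: pair_sigma_finite U "lborel :: real measure" ..
  have eq: "(\<lambda>v. indicator {0..1 + \<tau> (fst v)} (snd (snd v)) :: ennreal) =
      (\<lambda>v. if 0 \<le> snd (snd v) \<and> snd (snd v) \<le> 1 + \<tau> (fst v) then 1 else 0)"
    by (auto simp: indicator_def fun_eq_iff)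
  have i: "(\<lambda>v. indicator {0..1 + \<tau> (fst v)} (snd (snd v)) :: ennreal) \<in> borel_measurable (M \<Otimes>\<^sub>M (U \<Otimes>\<^sub>M lborel))"
    unfolding eq by measurable
  let ?k = "\<lambda>(w, q, u). ennreal (\<theta> w) * indicator {0..1 + \<tau> w} u"
  have k: "?k \<in> borel_measurable (M \<Otimes>\<^sub>M (U \<Otimes>\<^sub>M lborel))" using i by (simp add: split_beta)
  let ?f = "\<lambda>v. indicator {0..1 + \<tau> (fst v)} (snd (snd v)) * g v :: ennreal"
  have f: "?f \<in> borel_measurable (M \<Otimes>\<^sub>M (U \<Otimes>\<^sub>M lborel))" using i g by (intro borel_measurable_times_ennreal)
  let ?h = "\<lambda>w v. indicator {0..1 + \<tau> w} (snd v) * g (w, v) :: ennreal"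
  have h: "?h w \<in> borel_measurable (U \<Otimes>\<^sub>M lborel)" if "w \<in> space M" for w
    using measurable_compose[OF measurable_Pair1'[OF that] f] by simp
  have "(\<integral>\<^sup>+v. g v \<partial>segment_space M U \<theta> \<tau>) = (\<integral>\<^sup>+v. ?k v * g v \<partial>(M \<Otimes>\<^sub>M (U \<Otimes>\<^sub>M lborel)))"
    unfolding segment_space_def by (rule nn_integral_density[OF k g])
  also have "\<dots> = (\<integral>\<^sup>+v. ennreal (\<theta> (fst v)) * ?f v \<partial>(M \<Otimes>\<^sub>M (U \<Otimes>\<^sub>M lborel)))"
    by (intro nn_integral_cong) (auto simp: mult_ac)
  also have "\<dots> = (\<integral>\<^sup>+w. \<integral>\<^sup>+v. ennreal (\<theta> (fst (w, v))) * ?f (w, v) \<partial>(U \<Otimes>\<^sub>M lborel) \<partial>M)"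
    by (rule UL.P.nn_integral_fst[symmetric]) (intro borel_measurable_times_ennreal f, measurable)
  also have "\<dots> = (\<integral>\<^sup>+w. ennreal (\<theta> w) * (\<integral>\<^sup>+v. ?h w v \<partial>(U \<Otimes>\<^sub>M lborel)) \<partial>M)"
    by (intro nn_integral_cong) (simp add: nn_integral_cmult h)
  also have "\<dots> = (\<integral>\<^sup>+w. ennreal (\<theta> w) * (\<integral>\<^sup>+q. \<integral>\<^sup>+u. ?h w (q, u) \<partial>lborel \<partial>U) \<partial>M)"
    by (intro nn_integral_cong arg_cong2[where f = "(*)"] refl lborel.nn_integral_fst[symmetric] h)
  finally show ?thesis by simp
qed

text \<open>
  The superposition of the uniform measures of mass \<open>\<theta> w\<close> on the segments from \<open>X w\<close> to \<open>q\<close>.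
\<close>
definition segment_background ::
  "'a measure \<Rightarrow> (real ^ 'n) measure \<Rightarrow> ('a \<Rightarrow> real ^ 'n) \<Rightarrow> ('a \<Rightarrow> real) \<Rightarrow> (real ^ 'n) measure" where
  "segment_background M U X \<theta> =
     distr (segment_space M U \<theta> (\<lambda>_. 0)) borel (\<lambda>(w, q, s). X w + s *\<^sub>R (q - X w))"

lemma emeasure_segment_background:
  fixes X :: "'a \<Rightarrow> real ^ 'n"
  assumes U: "prob_space U" "sets U = sets borel"
    and [measurable]: "X \<in> M \<rightarrow>\<^sub>M borel" "\<theta> \<in> borel_measurable M" "C \<in> sets borel"
  shows "emeasure (segment_background M U X \<theta>) C =
    (\<integral>\<^sup>+w. ennreal (\<theta> w) * (\<integral>\<^sup>+q. \<integral>\<^sup>+s. indicator {0..1} s * indicator C (X w + s *\<^sub>R (q - X w)) \<partial>lborel \<partial>U) \<partial>M)"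
proof -
  interpret U: prob_space U by (rule U(1))
  note [measurable_cong] = U(2)
  have m: "(\<lambda>(w, q, s). X w + s *\<^sub>R (q - X w)) \<in> segment_space M U \<theta> (\<lambda>_. 0) \<rightarrow>\<^sub>M borel"
    by (simp add: split_beta)
  show ?thesis
    unfolding segment_background_def
    by (subst emeasure_distr_eq[OF m], simp, subst nn_integral_segment_space)
      (simp_all add: U.sigma_finite_measure_axioms split_beta)
qed

text \<open>
  On each segment the total mass is \<open>\<theta> (1 + \<tau>)\<close> and is displaced by at most \<open>min \<tau> 1\<close> times the
  length, and \<open>(1 + \<tau>) (min \<tau> 1)\<^sup>2 \<le> 2 \<tau>\<^sup>2\<close> for all \<open>\<tau>\<close>. With \<open>\<eta> = \<theta> \<tau>\<close> the cost is thus of order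
  \<open>\<eta>\<^sup>2 / \<theta>\<close>, quadratic in the atom \<open>\<eta>\<close> even when the atom outweighs the background.
\<close>
lemma segment_shift_coupling:
  fixes X :: "'a \<Rightarrow> real ^ 'n" and \<theta> \<tau> :: "'a \<Rightarrow> real"
  assumes U: "prob_space U" "sets U = sets borel"
    and [measurable]: "X \<in> M \<rightarrow>\<^sub>M borel" "\<theta> \<in> borel_measurable M" "\<tau> \<in> borel_measurable M"
    and \<theta>: "\<And>w. 0 \<le> \<theta> w" and \<tau>: "\<And>w. 0 \<le> \<tau> w"
    and R: "\<And>w. w \<in> space M \<Longrightarrow> \<theta> w \<noteq> 0 \<Longrightarrow> AE q in U. norm (q - X w) \<le> R"
  shows "\<exists>\<gamma>\<in>couplings
      (add_measure (segment_background M U X \<theta>) (distr (density M (\<lambda>w. ennreal (\<theta> w * \<tau> w))) borel X))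
      (add_measure (segment_background M U X \<theta>) (scale_measure (\<integral>\<^sup>+w. ennreal (\<theta> w * \<tau> w) \<partial>M) U)).
    quad_cost \<gamma> \<le> (\<integral>\<^sup>+w. ennreal (2 * R\<^sup>2 * (\<theta> w * (\<tau> w)\<^sup>2)) \<partial>M)"
proof -
  interpret U: prob_space U by (rule U(1))
  note [measurable_cong] = U(2)
  let ?D = "segment_space M U \<theta> \<tau>"
  define S where "S = (\<lambda>v. X (fst v) + max 0 (snd (snd v) - \<tau> (fst v)) *\<^sub>R (fst (snd v) - X (fst v)))"
  define T where "T = (\<lambda>v. X (fst v) + min (snd (snd v)) 1 *\<^sub>R (fst (snd v) - X (fst v)))"
  have Sm: "S \<in> (M \<Otimes>\<^sub>M (U \<Otimes>\<^sub>M lborel)) \<rightarrow>\<^sub>M borel" unfolding S_def by measurable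
  have Tm: "T \<in> (M \<Otimes>\<^sub>M (U \<Otimes>\<^sub>M lborel)) \<rightarrow>\<^sub>M borel" unfolding T_def by measurable
  let ?c = "\<lambda>w q. \<integral>\<^sup>+u. indicator {0..1 + \<tau> w} u * ennreal ((norm (S (w, q, u) - T (w, q, u)))\<^sup>2) \<partial>lborel"
  have [measurable]: "S \<in> ?D \<rightarrow>\<^sub>M borel" "T \<in> ?D \<rightarrow>\<^sub>M borel" using Sm Tm by measurable
  let ?b = "\<lambda>C w. \<integral>\<^sup>+q. \<integral>\<^sup>+s. indicator {0..1} s * indicator C (X w + s *\<^sub>R (q - X w)) \<partial>lborel \<partial>U :: ennreal"
  let ?\<beta> = "segment_background M U X \<theta>"
  have s\<beta>: "sets ?\<beta> = sets borel" by (simp add: segment_background_def)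
  have [measurable]: "?b C \<in> borel_measurable M" if [measurable]: "C \<in> sets borel" for C
    by (intro U.borel_measurable_nn_integral lborel.borel_measurable_nn_integral) measurable
  have DS: "distr ?D borel S = add_measure ?\<beta> (distr (density M (\<lambda>w. ennreal (\<theta> w * \<tau> w))) borel X)"
  proof (rule measure_eqI)
    fix C assume "C \<in> sets (distr ?D borel S)"
    then have [measurable]: "C \<in> sets borel" by simp
    have "emeasure (distr ?D borel S) C = (\<integral>\<^sup>+v. indicator C (S v) \<partial>?D)"
      by (rule emeasure_distr_eq) measurable
    also have "\<dots> = (\<integral>\<^sup>+w. ennreal (\<theta> w) * (\<integral>\<^sup>+q. \<integral>\<^sup>+u. indicator {0..1 + \<tau> w} u * indicator C (S (w, q, u)) \<partial>lborel \<partial>U) \<partial>M)"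
      using Sm by (intro nn_integral_segment_space) (auto simp: U.sigma_finite_measure_axioms)
    also have "\<dots> = (\<integral>\<^sup>+w. ennreal (\<theta> w) * (\<integral>\<^sup>+q. ennreal (\<tau> w) * indicator C (X w)
        + (\<integral>\<^sup>+s. indicator {0..1} s * indicator C (X w + s *\<^sub>R (q - X w)) \<partial>lborel) \<partial>U) \<partial>M)"
      unfolding S_def fst_conv snd_conv
      by (intro nn_integral_cong arg_cong2[where f = "(*)"] refl,
          subst nn_integral_shift_max[where h = "\<lambda>s. indicator C (X _ + s *\<^sub>R (_ - X _))"]) (auto simp: \<tau>)
    also have "\<dots> = (\<integral>\<^sup>+w. ennreal (\<theta> w) * (ennreal (\<tau> w) * indicator C (X w) + ?b C w) \<partial>M)"
      by (intro nn_integral_cong arg_cong2[where f = "(*)"] refl, subst nn_integral_add)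
        (auto simp: U.emeasure_space_1)
    also have "\<dots> = (\<integral>\<^sup>+w. ennreal (\<theta> w) * ?b C w + ennreal (\<theta> w * \<tau> w) * indicator C (X w) \<partial>M)"
      using \<theta> \<tau> by (intro nn_integral_cong) (auto simp: distrib_left ennreal_mult mult_ac add_ac)
    also have "\<dots> = (\<integral>\<^sup>+w. ennreal (\<theta> w) * ?b C w \<partial>M) + (\<integral>\<^sup>+w. ennreal (\<theta> w * \<tau> w) * indicator C (X w) \<partial>M)"
      by (rule nn_integral_add) measurable
    also have "(\<integral>\<^sup>+w. ennreal (\<theta> w) * ?b C w \<partial>M) = emeasure ?\<beta> C"
      using U by (intro emeasure_segment_background[symmetric]) measurable
    also have "(\<integral>\<^sup>+w. ennreal (\<theta> w * \<tau> w) * indicator C (X w) \<partial>M) =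
        emeasure (distr (density M (\<lambda>w. ennreal (\<theta> w * \<tau> w))) borel X) C"
      by (subst emeasure_distr_eq) (auto simp: nn_integral_density)
    finally show "emeasure (distr ?D borel S) C = emeasure (add_measure ?\<beta> (distr (density M (\<lambda>w. ennreal (\<theta> w * \<tau> w))) borel X)) C"
      by (simp add: emeasure_add_measure s\<beta>)
  qed (simp add: s\<beta>)
  have DT: "distr ?D borel T = add_measure ?\<beta> (scale_measure (\<integral>\<^sup>+w. ennreal (\<theta> w * \<tau> w) \<partial>M) U)"
  proof (rule measure_eqI)
    fix C assume "C \<in> sets (distr ?D borel T)"
    then have [measurable]: "C \<in> sets borel" by simp
    have "emeasure (distr ?D borel T) C = (\<integral>\<^sup>+v. indicator C (T v) \<partial>?D)"
      by (rule emeasure_distr_eq) measurable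
    also have "\<dots> = (\<integral>\<^sup>+w. ennreal (\<theta> w) * (\<integral>\<^sup>+q. \<integral>\<^sup>+u. indicator {0..1 + \<tau> w} u * indicator C (T (w, q, u)) \<partial>lborel \<partial>U) \<partial>M)"
      using Tm by (intro nn_integral_segment_space) (auto simp: U.sigma_finite_measure_axioms)
    also have "\<dots> = (\<integral>\<^sup>+w. ennreal (\<theta> w) * (\<integral>\<^sup>+q. ennreal (\<tau> w) * indicator C q
        + (\<integral>\<^sup>+s. indicator {0..1} s * indicator C (X w + s *\<^sub>R (q - X w)) \<partial>lborel) \<partial>U) \<partial>M)"
      unfolding T_def fst_conv snd_conv
      by (intro nn_integral_cong arg_cong2[where f = "(*)"] refl,
          subst nn_integral_shift_min[where h = "\<lambda>s. indicator C (X _ + s *\<^sub>R (_ - X _))"]) (auto simp: \<tau>)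
    also have "\<dots> = (\<integral>\<^sup>+w. ennreal (\<theta> w) * (ennreal (\<tau> w) * emeasure U C + ?b C w) \<partial>M)"
      by (intro nn_integral_cong arg_cong2[where f = "(*)"] refl, subst nn_integral_add)
        (auto simp: nn_integral_cmult_indicator U(2))
    also have "\<dots> = (\<integral>\<^sup>+w. ennreal (\<theta> w) * ?b C w + ennreal (\<theta> w * \<tau> w) * emeasure U C \<partial>M)"
      using \<theta> \<tau> by (intro nn_integral_cong) (auto simp: distrib_left ennreal_mult mult_ac add_ac)
    also have "\<dots> = (\<integral>\<^sup>+w. ennreal (\<theta> w) * ?b C w \<partial>M) + (\<integral>\<^sup>+w. ennreal (\<theta> w * \<tau> w) * emeasure U C \<partial>M)"
      by (rule nn_integral_add) measurable
    also have "(\<integral>\<^sup>+w. ennreal (\<theta> w) * ?b C w \<partial>M) = emeasure ?\<beta> C"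
      using U by (intro emeasure_segment_background[symmetric]) measurable
    also have "(\<integral>\<^sup>+w. ennreal (\<theta> w * \<tau> w) * emeasure U C \<partial>M) =
        emeasure (scale_measure (\<integral>\<^sup>+w. ennreal (\<theta> w * \<tau> w) \<partial>M) U) C"
      by (simp add: nn_integral_multc)
    finally show "emeasure (distr ?D borel T) C = emeasure (add_measure ?\<beta> (scale_measure (\<integral>\<^sup>+w. ennreal (\<theta> w * \<tau> w) \<partial>M) U)) C"
      by (simp add: emeasure_add_measure s\<beta> U(2))
  qed (simp add: s\<beta>)
  have "distr ?D borel (\<lambda>v. (S v, T v)) \<in> couplings (distr ?D borel S) (distr ?D borel T)"
    by (rule distr_pair_in_couplings) measurable
  moreover have "quad_cost (distr ?D borel (\<lambda>v. (S v, T v))) \<le> (\<integral>\<^sup>+w. ennreal (2 * R\<^sup>2 * (\<theta> w * (\<tau> w)\<^sup>2)) \<partial>M)"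
  proof -
    have "quad_cost (distr ?D borel (\<lambda>v. (S v, T v))) = (\<integral>\<^sup>+v. ennreal ((norm (S v - T v))\<^sup>2) \<partial>?D)"
      by (rule quad_cost_distr_pair) measurable
    also have "\<dots> = (\<integral>\<^sup>+w. ennreal (\<theta> w) * (\<integral>\<^sup>+q. ?c w q \<partial>U) \<partial>M)"
      using Sm Tm by (intro nn_integral_segment_space) (auto simp: U.sigma_finite_measure_axioms)
    also have "\<dots> \<le> (\<integral>\<^sup>+w. ennreal (2 * R\<^sup>2 * (\<theta> w * (\<tau> w)\<^sup>2)) \<partial>M)"
    proof (rule nn_integral_mono)
      fix w assume w: "w \<in> space M"
      define t where "t = \<tau> w"
      have t: "t \<ge> 0" using \<tau> by (simp add: t_def)
      show "ennreal (\<theta> w) * (\<integral>\<^sup>+q. ?c w q \<partial>U)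
        \<le> ennreal (2 * R\<^sup>2 * (\<theta> w * (\<tau> w)\<^sup>2))"
      proof (cases "\<theta> w = 0")
        case False
        have "(\<integral>\<^sup>+q. ?c w q \<partial>U)
          \<le> (\<integral>\<^sup>+q. ennreal (2 * R\<^sup>2 * t\<^sup>2) \<partial>U)"
          using R[OF w False]
        proof (intro nn_integral_mono_AE, eventually_elim)
          fix q assume q: "norm (q - X w) \<le> R"
          have "?c w q
            \<le> (\<integral>\<^sup>+u. ennreal ((min t 1 * R)\<^sup>2) * indicator {0..1 + t} u \<partial>lborel)"
          proof (rule nn_integral_mono)
            fix u :: real
            show "indicator {0..1 + \<tau> w} u * ennreal ((norm (S (w, q, u) - T (w, q, u)))\<^sup>2)
              \<le> ennreal ((min t 1 * R)\<^sup>2) * indicator {0..1 + t} u"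
            proof (cases "u \<in> {0..1 + t}")
              case True
              have "S (w, q, u) - T (w, q, u) = (max 0 (u - t) - min u 1) *\<^sub>R (q - X w)"
                by (simp add: S_def T_def t_def scaleR_left_diff_distrib)
              then have "norm (S (w, q, u) - T (w, q, u)) = \<bar>max 0 (u - t) - min u 1\<bar> * norm (q - X w)"
                by simp
              also have "\<dots> \<le> min t 1 * R"
                using True t q by (intro mult_mono) (auto simp: min_def max_def)
              finally have "(norm (S (w, q, u) - T (w, q, u)))\<^sup>2 \<le> (min t 1 * R)\<^sup>2"
                by (intro power_mono) auto
              then show ?thesis using True by (auto simp: t_def intro: ennreal_leI)
            qed (simp add: t_def)
          qed
          also have "\<dots> = ennreal ((min t 1 * R)\<^sup>2 * (1 + t))"
            using t by (simp add: nn_integral_cmult_indicator ennreal_mult)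
          also have "\<dots> \<le> ennreal (2 * R\<^sup>2 * t\<^sup>2)"
          proof (rule ennreal_leI)
            have "(min t 1)\<^sup>2 * (1 + t) \<le> 2 * t\<^sup>2"
            proof (cases "t \<le> 1")
              case True
              then have "t\<^sup>2 * (1 + t) \<le> t\<^sup>2 * 2" by (intro mult_left_mono) auto
              then show ?thesis using True by (simp add: mult.commute)
            next
              case False
              then have "1 * t \<le> t * t" by (intro mult_right_mono) auto
              then have "1 + t \<le> 2 * (t * t)" using False by linarith
              then show ?thesis using False by (simp add: power2_eq_square)
            qed
            then have "R\<^sup>2 * ((min t 1)\<^sup>2 * (1 + t)) \<le> R\<^sup>2 * (2 * t\<^sup>2)" by (rule mult_left_mono) simp
            then show "(min t 1 * R)\<^sup>2 * (1 + t) \<le> 2 * R\<^sup>2 * t\<^sup>2" by (simp add: power_mult_distrib mult_ac)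
          qed
          finally show "?c w q
            \<le> ennreal (2 * R\<^sup>2 * t\<^sup>2)" .
        qed
        also have "\<dots> = ennreal (2 * R\<^sup>2 * t\<^sup>2)" by (simp add: U.emeasure_space_1)
        finally have "ennreal (\<theta> w) * (\<integral>\<^sup>+q. ?c w q \<partial>U)
          \<le> ennreal (\<theta> w) * ennreal (2 * R\<^sup>2 * t\<^sup>2)" by (rule mult_left_mono) simp
        also have "\<dots> = ennreal (2 * R\<^sup>2 * (\<theta> w * (\<tau> w)\<^sup>2))"
          using \<theta>[of w] by (simp add: ennreal_mult[symmetric] t_def mult_ac)
        finally show ?thesis .
      qed simp
    qed
    finally show ?thesis .
  qed
  ultimately show ?thesis unfolding DS DT by blast
qed

section \<open>Depth in a ball and moving mass against a background\<close>

text \<open>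
  In Euclidean space, the distance to the complement of the ball around \<open>z\<close> of radius \<open>r\<close>.
\<close>
definition depth :: "'a::metric_space \<Rightarrow> real \<Rightarrow> 'a \<Rightarrow> real" where
  "depth z r x = max 0 (r - dist z x)"

lemma depth_nonneg [simp]: "0 \<le> depth z r x"
  by (simp add: depth_def)

lemma depth_le_radius: "0 \<le> r \<Longrightarrow> depth z r x \<le> r"
  by (simp add: depth_def)

lemma depth_eq_0_iff: "depth z r x = 0 \<longleftrightarrow> r \<le> dist z x"
  by (auto simp: depth_def)

lemma borel_measurable_depth [measurable]:
  "depth z r \<in> borel_measurable borel"
  unfolding depth_def by (intro borel_measurable_continuous_onI continuous_intros)

lemma depth_lipschitz:
  fixes x y :: "'a::real_normed_vector"
  shows "\<bar>depth z r x - depth z r y\<bar> \<le> norm (x - y)"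
proof -
  have "\<bar>dist z x - dist z y\<bar> \<le> dist x y"
    using dist_triangle[of z x y] dist_triangle[of z y x] by (simp add: dist_commute abs_le_iff)
  then show ?thesis by (simp add: depth_def dist_norm)
qed

text \<open>
  Concavity of the depth inside the ball, with endpoints \<open>x\<close> and \<open>q\<close>, where the depth of \<open>q\<close> is
  at least half the radius.
\<close>
lemma depth_towards_half_ball:
  fixes x q :: "'a::real_normed_vector"
  assumes s: "0 \<le> s" "s \<le> 1" and q: "dist z q \<le> r / 2" and x: "dist z x \<le> r"
  shows "(1 - s) * depth z r x + s * (r / 2) \<le> depth z r (x + s *\<^sub>R (q - x))"
proof -
  have "z - (x + s *\<^sub>R (q - x)) = (1 - s) *\<^sub>R (z - x) + s *\<^sub>R (z - q)" by (simp add: algebra_simps)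
  then have "dist z (x + s *\<^sub>R (q - x)) \<le> (1 - s) * dist z x + s * dist z q"
    using s norm_triangle_ineq[of "(1 - s) *\<^sub>R (z - x)" "s *\<^sub>R (z - q)"] by (simp add: dist_norm)
  also have "\<dots> \<le> (1 - s) * dist z x + s * (r / 2)" using s q by (intro add_left_mono mult_left_mono) auto
  finally have "r - dist z (x + s *\<^sub>R (q - x)) \<ge> (1 - s) * (r - dist z x) + s * (r / 2)"
    by (simp add: algebra_simps)
  moreover have "depth z r x = r - dist z x" using x by (simp add: depth_def)
  ultimately show ?thesis by (simp add: depth_def)
qed

lemma nn_integral_affine_le:
  fixes g :: "real ^ 'n \<Rightarrow> ennreal"
  assumes [measurable]: "g \<in> borel_measurable borel" and c: "1 / 2 \<le> c"
  shows "(\<integral>\<^sup>+x. g (t + c *\<^sub>R x) \<partial>lborel) \<le> ennreal (2 ^ CARD('n)) * (\<integral>\<^sup>+x. g x \<partial>lborel)"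
proof -
  have "(\<integral>\<^sup>+x. g x \<partial>lborel) = ennreal (c ^ CARD('n)) * (\<integral>\<^sup>+x. g (t + c *\<^sub>R x) \<partial>lborel)"
    using c by (subst lborel_affine[of c t]) (simp_all add: nn_integral_density nn_integral_distr nn_integral_cmult)
  then have "ennreal (2 ^ CARD('n)) * (\<integral>\<^sup>+x. g x \<partial>lborel) =
      ennreal ((2 * c) ^ CARD('n)) * (\<integral>\<^sup>+x. g (t + c *\<^sub>R x) \<partial>lborel)"
    using c by (simp add: mult.assoc[symmetric] ennreal_mult[symmetric] power_mult_distrib)
  moreover have "ennreal 1 \<le> ennreal ((2 * c) ^ CARD('n))"
    using c by (intro ennreal_leI one_le_power) auto
  ultimately show ?thesis by (metis ennreal_1 mult_right_mono mult_1 zero_le)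
qed

text \<open>
  Near \<open>x\<close>, the density of the segments is controlled by substituting \<open>x\<close> for fixed \<open>q\<close>. The Jacobian is at
  least \<open>2\<close> to the power minus the dimension, and the depth has at most halved on the way.
\<close>
lemma near_part_background:
  fixes X :: "'a \<Rightarrow> real ^ 'n"
  assumes [measurable]: "X \<in> M \<rightarrow>\<^sub>M borel" "C \<in> sets borel"
    and r: "0 < r" and s: "0 \<le> s" "s \<le> 1 / 2" and q: "dist z q \<le> r / 2" and c4: "0 \<le> c4"
    and law: "\<And>g. g \<in> borel_measurable borel \<Longrightarrow>
      (\<integral>\<^sup>+w. g (X w) * indicator (cball z r) (X w) \<partial>M) \<le> ennreal c4 * (\<integral>\<^sup>+x. g x * indicator (cball z r) x \<partial>lborel)"
  shows "(\<integral>\<^sup>+w. ennreal ((depth z r (X w))\<^sup>2) * indicator C (X w + s *\<^sub>R (q - X w)) \<partial>M)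
    \<le> ennreal (4 * c4 * 2 ^ CARD('n)) * (\<integral>\<^sup>+x. ennreal ((depth z r x)\<^sup>2) * indicator C x \<partial>lborel)"
proof -
  let ?g = "\<lambda>x. ennreal ((depth z r x)\<^sup>2) * indicator C (x + s *\<^sub>R (q - x))"
  let ?d = "\<lambda>x. ennreal ((depth z r x)\<^sup>2) * indicator C x"
  have "(\<integral>\<^sup>+w. ?g (X w) \<partial>M) = (\<integral>\<^sup>+w. ?g (X w) * indicator (cball z r) (X w) \<partial>M)"
    by (intro nn_integral_cong) (auto simp: indicator_def depth_eq_0_iff)
  also have "\<dots> \<le> ennreal c4 * (\<integral>\<^sup>+x. ?g x * indicator (cball z r) x \<partial>lborel)"
    by (rule law) measurable
  also have "(\<integral>\<^sup>+x. ?g x * indicator (cball z r) x \<partial>lborel) \<le> (\<integral>\<^sup>+x. 4 * ?d (s *\<^sub>R q + (1 - s) *\<^sub>R x) \<partial>lborel)"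
  proof (rule nn_integral_mono)
    fix x
    have e: "x + s *\<^sub>R (q - x) = s *\<^sub>R q + (1 - s) *\<^sub>R x" by (simp add: algebra_simps)
    show "?g x * indicator (cball z r) x \<le> 4 * ?d (s *\<^sub>R q + (1 - s) *\<^sub>R x)"
    proof (cases "dist z x \<le> r \<and> s *\<^sub>R q + (1 - s) *\<^sub>R x \<in> C")
      case True
      have "(1 / 2) * depth z r x \<le> (1 - s) * depth z r x" using s by (intro mult_right_mono) auto
      also have "\<dots> \<le> depth z r (s *\<^sub>R q + (1 - s) *\<^sub>R x)"
      proof -
        have "0 \<le> s * (r / 2)" using s r by simp
        then show ?thesis using depth_towards_half_ball[of s z q r x] s q True unfolding e by linarith
      qed
      finally have "(depth z r x)\<^sup>2 \<le> (2 * depth z r (s *\<^sub>R q + (1 - s) *\<^sub>R x))\<^sup>2"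
        by (intro power_mono) auto
      then have "ennreal ((depth z r x)\<^sup>2) \<le> ennreal (4 * (depth z r (s *\<^sub>R q + (1 - s) *\<^sub>R x))\<^sup>2)"
        by (intro ennreal_leI) (simp add: power_mult_distrib)
      also have "\<dots> = 4 * ennreal ((depth z r (s *\<^sub>R q + (1 - s) *\<^sub>R x))\<^sup>2)" by (simp add: ennreal_mult)
      finally show ?thesis using True by (simp add: e)
    qed (auto simp: indicator_def e)
  qed
  also have "\<dots> = 4 * (\<integral>\<^sup>+x. ?d (s *\<^sub>R q + (1 - s) *\<^sub>R x) \<partial>lborel)"
    by (rule nn_integral_cmult) measurable
  also have "(\<integral>\<^sup>+x. ?d (s *\<^sub>R q + (1 - s) *\<^sub>R x) \<partial>lborel) \<le> ennreal (2 ^ CARD('n)) * (\<integral>\<^sup>+x. ?d x \<partial>lborel)"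
    using s by (intro nn_integral_affine_le) auto
  finally have "(\<integral>\<^sup>+w. ?g (X w) \<partial>M) \<le> ennreal c4 * (4 * (ennreal (2 ^ CARD('n)) * (\<integral>\<^sup>+x. ?d x \<partial>lborel)))"
    by (simp add: mult_left_mono)
  also have "\<dots> = ennreal (4 * c4 * 2 ^ CARD('n)) * (\<integral>\<^sup>+x. ?d x \<partial>lborel)"
    using c4 by (simp add: ennreal_mult mult_ac)
  finally show ?thesis .
qed

text \<open>
  Near \<open>q\<close>, the substitution of \<open>q\<close> for fixed \<open>x\<close> is the one with controlled Jacobian, and the point is at
  depth at least a quarter of the radius.
\<close>
lemma far_part_background:
  fixes x :: "real ^ 'n"
  assumes [measurable]: "C \<in> sets borel"
    and r: "0 < r" and s: "1 / 2 \<le> s" "s \<le> 1" and x: "dist z x \<le> r"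
    and V: "0 < V" "V \<le> measure lborel (cball z (r / 2))"
  shows "(\<integral>\<^sup>+q. indicator C (x + s *\<^sub>R (q - x)) \<partial>uniform_measure lborel (cball z (r / 2)))
    \<le> ennreal (16 * 2 ^ CARD('n) / (V * r\<^sup>2)) * (\<integral>\<^sup>+x. ennreal ((depth z r x)\<^sup>2) * indicator C x \<partial>lborel)"
proof -
  let ?d = "\<lambda>x. ennreal ((depth z r x)\<^sup>2) * indicator C x"
  let ?V = "measure lborel (cball z (r / 2))"
  have V': "emeasure lborel (cball z (r / 2)) = ennreal ?V"
    by (rule emeasure_eq_ennreal_measure) (use emeasure_lborel_cball_finite[of z "r / 2"] in auto)
  have "(\<integral>\<^sup>+q. indicator C (x + s *\<^sub>R (q - x)) \<partial>uniform_measure lborel (cball z (r / 2)))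
      = (\<integral>\<^sup>+q. indicator C (x + s *\<^sub>R (q - x)) * indicator (cball z (r / 2)) q \<partial>lborel) / ennreal ?V"
    unfolding V'[symmetric] by (rule nn_integral_uniform_measure) measurable
  also have "(\<integral>\<^sup>+q. indicator C (x + s *\<^sub>R (q - x)) * indicator (cball z (r / 2)) q \<partial>lborel)
     \<le> (\<integral>\<^sup>+q. ennreal (16 / r\<^sup>2) * ?d ((1 - s) *\<^sub>R x + s *\<^sub>R q) \<partial>lborel)"
  proof (rule nn_integral_mono)
    fix q
    have e: "x + s *\<^sub>R (q - x) = (1 - s) *\<^sub>R x + s *\<^sub>R q" by (simp add: algebra_simps)
    show "indicator C (x + s *\<^sub>R (q - x)) * indicator (cball z (r / 2)) q \<le> ennreal (16 / r\<^sup>2) * ?d ((1 - s) *\<^sub>R x + s *\<^sub>R q)"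
    proof (cases "dist z q \<le> r / 2 \<and> (1 - s) *\<^sub>R x + s *\<^sub>R q \<in> C")
      case True
      have "(1 / 2) * (r / 2) \<le> s * (r / 2)" using s r by (intro mult_right_mono) auto
      also have "\<dots> \<le> (1 - s) * depth z r x + s * (r / 2)" using s by simp
      also have "\<dots> \<le> depth z r ((1 - s) *\<^sub>R x + s *\<^sub>R q)"
        using depth_towards_half_ball[of s z q r x] s True x by (simp add: e)
      finally have "(r / 4)\<^sup>2 \<le> (depth z r ((1 - s) *\<^sub>R x + s *\<^sub>R q))\<^sup>2"
        using r by (intro power_mono) auto
      then have "1 \<le> 16 / r\<^sup>2 * (depth z r ((1 - s) *\<^sub>R x + s *\<^sub>R q))\<^sup>2"
        using r by (simp add: field_simps power2_eq_square)
      then have "ennreal 1 \<le> ennreal (16 / r\<^sup>2 * (depth z r ((1 - s) *\<^sub>R x + s *\<^sub>R q))\<^sup>2)"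
        by (rule ennreal_leI)
      also have "ennreal (16 / r\<^sup>2 * (depth z r ((1 - s) *\<^sub>R x + s *\<^sub>R q))\<^sup>2) =
          ennreal (16 / r\<^sup>2) * ennreal ((depth z r ((1 - s) *\<^sub>R x + s *\<^sub>R q))\<^sup>2)"
        by (rule ennreal_mult) auto
      finally show ?thesis using True by (simp add: e)
    qed (auto simp: indicator_def e)
  qed
  also have "\<dots> = ennreal (16 / r\<^sup>2) * (\<integral>\<^sup>+q. ?d ((1 - s) *\<^sub>R x + s *\<^sub>R q) \<partial>lborel)"
    by (rule nn_integral_cmult) measurable
  also have "(\<integral>\<^sup>+q. ?d ((1 - s) *\<^sub>R x + s *\<^sub>R q) \<partial>lborel) \<le> ennreal (2 ^ CARD('n)) * (\<integral>\<^sup>+x. ?d x \<partial>lborel)"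
    using s by (intro nn_integral_affine_le) auto
  finally have "(\<integral>\<^sup>+q. indicator C (x + s *\<^sub>R (q - x)) \<partial>uniform_measure lborel (cball z (r / 2)))
     \<le> ennreal (16 / r\<^sup>2) * (ennreal (2 ^ CARD('n)) * (\<integral>\<^sup>+x. ?d x \<partial>lborel)) / ennreal ?V"
    by (simp add: divide_right_mono_ennreal mult_left_mono)
  also have "\<dots> = ennreal (16 / r\<^sup>2 * 2 ^ CARD('n)) * (\<integral>\<^sup>+x. ?d x \<partial>lborel) * (1 / ennreal ?V)"
  proof -
    have "ennreal (16 / r\<^sup>2 * 2 ^ CARD('n)) = ennreal (16 / r\<^sup>2) * ennreal (2 ^ CARD('n))"
      by (rule ennreal_mult) auto
    then show ?thesis by (simp only: mult.assoc ennreal_times_divide mult_1_right)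
  qed
  also have "1 / ennreal ?V = ennreal (1 / ?V)" using V r by (subst divide_ennreal[symmetric]) auto
  also have "ennreal (16 / r\<^sup>2 * 2 ^ CARD('n)) * (\<integral>\<^sup>+x. ?d x \<partial>lborel) * ennreal (1 / ?V)
     \<le> ennreal (16 / r\<^sup>2 * 2 ^ CARD('n)) * (\<integral>\<^sup>+x. ?d x \<partial>lborel) * ennreal (1 / V)"
    using V r by (intro mult_left_mono ennreal_leI) (auto simp: frac_le)
  also have "\<dots> = ennreal (16 * 2 ^ CARD('n) / (V * r\<^sup>2)) * (\<integral>\<^sup>+x. ?d x \<partial>lborel)"
  proof -
    have "16 * 2 ^ CARD('n) / (V * r\<^sup>2) = (16 / r\<^sup>2 * 2 ^ CARD('n)) * (1 / V)" by simp
    then have "ennreal (16 * 2 ^ CARD('n) / (V * r\<^sup>2)) = ennreal (16 / r\<^sup>2 * 2 ^ CARD('n)) * ennreal (1 / V)"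
      using V by (simp only:) (rule ennreal_mult, auto)
    then show ?thesis by (simp only: mult_ac)
  qed
  finally show ?thesis .
qed

lemma prob_space_uniform_cball:
  fixes z :: "real ^ 'n"
  assumes "0 < r"
  shows "prob_space (uniform_measure lborel (cball z r))"
proof (rule prob_space_uniform_measure)
  have "0 < unit_ball_vol (real CARD('n))" by simp
  then show "emeasure lborel (cball z r) \<noteq> 0" "emeasure lborel (cball z r) \<noteq> \<infinity>"
    using assms by (auto simp: emeasure_cball simp del: unit_ball_vol_pos)
qed

text \<open>
  The two halves of the segments added up. The far half starts from total mass at most \<open>\<theta> r\<^sup>2\<close>, which
  cancels the factor \<open>1 / r\<^sup>2\<close> of the previous lemma.
\<close>
lemma segment_background_le:
  fixes X :: "'a \<Rightarrow> real ^ 'n"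
  assumes M: "prob_space M" and X[measurable]: "X \<in> M \<rightarrow>\<^sub>M borel" and C[measurable]: "C \<in> sets borel"
    and r: "0 < r" and c4: "0 \<le> c4" and V: "0 < V" "V \<le> measure lborel (cball z (r / 2))" and \<theta>: "0 \<le> \<theta>"
    and law: "\<And>g. g \<in> borel_measurable borel \<Longrightarrow>
      (\<integral>\<^sup>+w. g (X w) * indicator (cball z r) (X w) \<partial>M) \<le> ennreal c4 * (\<integral>\<^sup>+x. g x * indicator (cball z r) x \<partial>lborel)"
  shows "emeasure (segment_background M (uniform_measure lborel (cball z (r / 2))) X (\<lambda>w. \<theta> * (depth z r (X w))\<^sup>2)) C
    \<le> ennreal (\<theta> * (2 ^ CARD('n) * (4 * c4 + 16 / V))) * (\<integral>\<^sup>+x. ennreal ((depth z r x)\<^sup>2) * indicator C x \<partial>lborel)"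
proof -
  let ?U = "uniform_measure lborel (cball z (r / 2))"
  let ?J = "\<integral>\<^sup>+x. ennreal ((depth z r x)\<^sup>2) * indicator C x \<partial>lborel"
  interpret M: prob_space M by (rule M)
  interpret U: prob_space ?U using r by (intro prob_space_uniform_cball) simp
  have U1: "emeasure ?U UNIV = 1"
    using U.emeasure_space_1 by (simp del: emeasure_uniform_measure)
  interpret UL: pair_sigma_finite ?U "lborel :: real measure" ..
  interpret MUL: pair_sigma_finite M "?U \<Otimes>\<^sub>M (lborel :: real measure)"
    by (intro pair_sigma_finite.intro M.sigma_finite_measure_axioms UL.P.sigma_finite_measure_axioms)
  let ?D = "\<lambda>w. ennreal ((depth z r (X w))\<^sup>2)"
  let ?i = "\<lambda>w q s. indicator C (X w + s *\<^sub>R (q - X w)) :: ennreal"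
  let ?I = "\<lambda>I w. \<integral>\<^sup>+q. \<integral>\<^sup>+s. indicator (I :: real set) s * ?i w q s \<partial>lborel \<partial>?U"
  let ?N = "ennreal (4 * c4 * 2 ^ CARD('n))" and ?F = "ennreal (16 * 2 ^ CARD('n) / V)"
  have sq: "ennreal ((depth z r (X w))\<^sup>2) \<le> ennreal (r\<^sup>2)" for w
    using r by (intro ennreal_leI power_mono depth_le_radius) auto
  have near: "(\<integral>\<^sup>+w. ?D w * ?I {0..1/2::real} w \<partial>M) \<le> ?N * ?J"
  proof -
    have "(\<integral>\<^sup>+w. ?D w * ?I {0..1/2::real} w \<partial>M)
        = (\<integral>\<^sup>+w. ?D w * (\<integral>\<^sup>+v. indicator {0..1/2::real} (snd v) * ?i w (fst v) (snd v) \<partial>(?U \<Otimes>\<^sub>M lborel)) \<partial>M)"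
      by (intro nn_integral_cong, subst lborel.nn_integral_fst[symmetric]) auto
    also have "\<dots> = (\<integral>\<^sup>+w. \<integral>\<^sup>+v. ?D w * (indicator {0..1/2::real} (snd v) * ?i w (fst v) (snd v)) \<partial>(?U \<Otimes>\<^sub>M lborel) \<partial>M)"
      by (intro nn_integral_cong nn_integral_cmult[symmetric]) measurable
    also have "\<dots> = (\<integral>\<^sup>+v. \<integral>\<^sup>+w. ?D w * (indicator {0..1/2::real} (snd v) * ?i w (fst v) (snd v)) \<partial>M \<partial>(?U \<Otimes>\<^sub>M lborel))"
      by (rule MUL.Fubini'[symmetric]) measurable
    also have "\<dots> = (\<integral>\<^sup>+q. \<integral>\<^sup>+s. \<integral>\<^sup>+w. ?D w * (indicator {0..1/2::real} s * ?i w q s) \<partial>M \<partial>lborel \<partial>?U)"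
      by (subst lborel.nn_integral_fst[symmetric]) (auto intro!: M.borel_measurable_nn_integral)
    also have "\<dots> \<le> (\<integral>\<^sup>+q. \<integral>\<^sup>+s. (?N * ?J) * indicator {0..1/2::real} s \<partial>lborel \<partial>?U)"
    proof (rule nn_integral_mono_AE)
      have "AE q in ?U. q \<in> cball z (r / 2)" by (rule AE_uniform_measureI) auto
      then show "AE q in ?U. (\<integral>\<^sup>+s. \<integral>\<^sup>+w. ?D w * (indicator {0..1/2::real} s * ?i w q s) \<partial>M \<partial>lborel) \<le> (\<integral>\<^sup>+s. (?N * ?J) * indicator {0..1/2::real} s \<partial>lborel)"
      proof eventually_elim
        fix q assume q: "q \<in> cball z (r / 2)"
        show "(\<integral>\<^sup>+s. \<integral>\<^sup>+w. ?D w * (indicator {0..1/2::real} s * ?i w q s) \<partial>M \<partial>lborel) \<le> (\<integral>\<^sup>+s. (?N * ?J) * indicator {0..1/2::real} s \<partial>lborel)"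
        proof (rule nn_integral_mono)
          fix s :: real
          show "(\<integral>\<^sup>+w. ?D w * (indicator {0..1/2::real} s * ?i w q s) \<partial>M) \<le> (?N * ?J) * indicator {0..1/2::real} s"
          proof (cases "s \<in> {0..1/2::real}")
            case True
            then show ?thesis using near_part_background[OF X C r _ _ _ c4 law, of s q] q by simp
          qed simp
        qed
      qed
    qed
    also have "\<dots> = ?N * ?J * ennreal (1 / 2)"
      by (subst nn_integral_cmult_indicator) (auto simp: U1 simp del: emeasure_uniform_measure)
    also have "\<dots> \<le> ?N * ?J * ennreal 1"
      by (intro mult_left_mono ennreal_leI) auto
    finally show ?thesis by simp
  qed
  have far: "(\<integral>\<^sup>+w. ?D w * ?I {1/2<..1::real} w \<partial>M) \<le> ?F * ?J"
  proof -
    let ?K = "ennreal (16 * 2 ^ CARD('n) / (V * r\<^sup>2)) * ?J"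
    have "(\<integral>\<^sup>+w. ?D w * ?I {1/2<..1::real} w \<partial>M)
      \<le> (\<integral>\<^sup>+w. ennreal (r\<^sup>2) * ?K \<partial>M)"
    proof (rule nn_integral_mono)
      fix w assume "w \<in> space M"
      show "?D w * ?I {1/2<..1::real} w \<le> ennreal (r\<^sup>2) * ?K"
      proof (cases "dist z (X w) \<le> r")
        case True
        have "?I {1/2<..1::real} w = (\<integral>\<^sup>+s. \<integral>\<^sup>+q. indicator {1/2<..1::real} s * ?i w q s \<partial>?U \<partial>lborel)"
          by (rule UL.Fubini'[symmetric]) measurable
        also have "\<dots> \<le> (\<integral>\<^sup>+s. ?K * indicator {1/2<..1::real} s \<partial>lborel)"
        proof (rule nn_integral_mono)
          fix s :: real
          show "(\<integral>\<^sup>+q. indicator {1/2<..1::real} s * ?i w q s \<partial>?U) \<le> ?K * indicator {1/2<..1::real} s"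
          proof (cases "s \<in> {1/2<..1::real}")
            case s: True
            then show ?thesis using far_part_background[OF C r _ _ True V, of s] by simp
          qed simp
        qed
        also have "\<dots> = ?K * ennreal (1 / 2)" by (subst nn_integral_cmult_indicator) auto
        also have "\<dots> \<le> ?K * ennreal 1" by (intro mult_left_mono ennreal_leI) auto
        finally show ?thesis using sq[of w] by (intro mult_mono) auto
      qed (simp add: depth_def)
    qed
    also have "\<dots> = ennreal (r\<^sup>2) * ?K" by (simp add: M.emeasure_space_1)
    also have "\<dots> = ennreal (r\<^sup>2 * (16 * 2 ^ CARD('n) / (V * r\<^sup>2))) * ?J"
    proof -
      have "ennreal (r\<^sup>2 * (16 * 2 ^ CARD('n) / (V * r\<^sup>2))) = ennreal (r\<^sup>2) * ennreal (16 * 2 ^ CARD('n) / (V * r\<^sup>2))"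
        using V by (intro ennreal_mult) auto
      then show ?thesis by (simp only: mult.assoc)
    qed
    also have "r\<^sup>2 * (16 * 2 ^ CARD('n) / (V * r\<^sup>2)) = 16 * 2 ^ CARD('n) / V"
      using r V by (simp add: field_simps)
    finally show ?thesis .
  qed
  have inner: "(\<lambda>w. \<integral>\<^sup>+q. \<integral>\<^sup>+s. indicator I s * ?i w q s \<partial>lborel \<partial>?U) \<in> borel_measurable M" if [measurable]: "I \<in> sets borel" for I :: "real set"
    by (intro U.borel_measurable_nn_integral lborel.borel_measurable_nn_integral) measurable
  have "emeasure (segment_background M ?U X (\<lambda>w. \<theta> * (depth z r (X w))\<^sup>2)) C =
     (\<integral>\<^sup>+w. ennreal (\<theta> * (depth z r (X w))\<^sup>2) * ?I {0..1} w \<partial>M)"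
    by (rule emeasure_segment_background[OF U.prob_space_axioms]) auto
  also have "\<dots> = (\<integral>\<^sup>+w. ennreal \<theta> * (?D w * ?I {0..1/2::real} w
        + ?D w * ?I {1/2<..1::real} w) \<partial>M)"
  proof (rule nn_integral_cong)
    fix w
    have "?I {0..1} w =
       (\<integral>\<^sup>+q. \<integral>\<^sup>+s. indicator {0..1/2::real} s * ?i w q s + indicator {1/2<..1::real} s * ?i w q s \<partial>lborel \<partial>?U)"
      by (intro nn_integral_cong) (auto simp: indicator_def)
    also have "\<dots> = ?I {0..1/2::real} w + ?I {1/2<..1::real} w"
      by (subst nn_integral_add, measurable, rule nn_integral_add) (intro lborel.borel_measurable_nn_integral, measurable)+
    finally show "ennreal (\<theta> * (depth z r (X w))\<^sup>2) * ?I {0..1} w =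
      ennreal \<theta> * (?D w * ?I {0..1/2::real} w
        + ?D w * ?I {1/2<..1::real} w)"
      using \<theta> by (simp add: ennreal_mult distrib_left mult.assoc)
  qed
  also have "\<dots> = ennreal \<theta> * ((\<integral>\<^sup>+w. ?D w * ?I {0..1/2::real} w \<partial>M)
      + (\<integral>\<^sup>+w. ?D w * ?I {1/2<..1::real} w \<partial>M))"
  proof -
    have split: "(\<integral>\<^sup>+w. ennreal \<theta> * (F w + G w) \<partial>M) = ennreal \<theta> * ((\<integral>\<^sup>+w. F w \<partial>M) + (\<integral>\<^sup>+w. G w \<partial>M))"
      if "F \<in> borel_measurable M" "G \<in> borel_measurable M" for F G :: "'a \<Rightarrow> ennreal"
      using that by (simp add: nn_integral_cmult nn_integral_add)
    show ?thesis
      by (rule split) (intro borel_measurable_times_ennreal inner, measurable)+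
  qed
  also have "\<dots> \<le> ennreal \<theta> * (?N * ?J + ?F * ?J)"
    by (intro mult_left_mono add_mono near far) simp
  also have "\<dots> = ennreal (\<theta> * (4 * c4 * 2 ^ CARD('n) + 16 * 2 ^ CARD('n) / V)) * ?J"
  proof -
    have "ennreal (\<theta> * (4 * c4 * 2 ^ CARD('n) + 16 * 2 ^ CARD('n) / V)) =
        ennreal \<theta> * (?N + ?F)"
      using \<theta> c4 V by (simp only: ennreal_mult ennreal_plus add_nonneg_nonneg mult_nonneg_nonneg
          divide_nonneg_nonneg zero_le_power zero_le_numeral less_imp_le)
    then show ?thesis by (simp only: mult.assoc distrib_right)
  qed
  also have "4 * c4 * 2 ^ CARD('n) + 16 * 2 ^ CARD('n) / V = 2 ^ CARD('n) * (4 * c4 + 16 / V)"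
    by (simp add: algebra_simps)
  finally show ?thesis .
qed

text \<open>
  The constant \<open>k / K\<close> in \<open>\<theta>\<close> is chosen so that the segments weigh at most \<open>\<kappa>\<close>; the part of \<open>\<kappa>\<close> that they do
  not use stays at rest. The target depends on \<open>\<eta>\<close> only through its mass, so two excesses of equal mass
  over the same \<open>\<kappa>\<close> are both carried to the same measure.
\<close>
lemma move_excess_to_uniform:
  fixes X :: "'a \<Rightarrow> real ^ 'n"
  assumes M: "prob_space M" and X[measurable]: "X \<in> M \<rightarrow>\<^sub>M borel"
    and \<eta>[measurable]: "\<eta> \<in> borel_measurable M" and v[measurable]: "v \<in> borel_measurable M"
    and \<eta>0: "\<And>w. 0 \<le> \<eta> w" and \<eta>v: "\<And>w. \<eta> w \<le> depth z r (X w) * v w"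
    and r: "0 < r" and c4: "0 \<le> c4" and V: "0 < V" "V \<le> measure lborel (cball z (r / 2))"
    and law: "\<And>g. g \<in> borel_measurable borel \<Longrightarrow>
      (\<integral>\<^sup>+w. g (X w) * indicator (cball z r) (X w) \<partial>M) \<le> ennreal c4 * (\<integral>\<^sup>+x. g x * indicator (cball z r) x \<partial>lborel)"
    and \<kappa>: "sets \<kappa> = sets borel" "emeasure \<kappa> UNIV \<noteq> \<infinity>" and k: "0 < k"
    and \<kappa>_lower: "\<And>C. C \<in> sets borel \<Longrightarrow>
      ennreal k * (\<integral>\<^sup>+x. ennreal ((depth z r x)\<^sup>2) * indicator C x \<partial>lborel) \<le> emeasure \<kappa> C"
  shows "\<exists>\<gamma>\<in>couplings (add_measure \<kappa> (distr (density M (\<lambda>w. ennreal (\<eta> w))) borel X))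
      (add_measure \<kappa> (scale_measure (\<integral>\<^sup>+w. ennreal (\<eta> w) \<partial>M) (uniform_measure lborel (cball z (r / 2))))).
    quad_cost \<gamma> \<le> ennreal (8 * r\<^sup>2 * (2 ^ CARD('n) * (4 * c4 + 16 / V)) / k) * (\<integral>\<^sup>+w. ennreal ((v w)\<^sup>2) \<partial>M)"
proof -
  let ?U = "uniform_measure lborel (cball z (r / 2))"
  define K where "K = 2 ^ CARD('n) * (4 * c4 + 16 / V)"
  have K: "0 < K" unfolding K_def using c4 V by (intro mult_pos_pos add_nonneg_pos) auto
  define \<theta> where "\<theta> w = k / K * (depth z r (X w))\<^sup>2" for w
  define \<tau> where "\<tau> w = \<eta> w / \<theta> w" for w
  have \<theta>m[measurable]: "\<theta> \<in> borel_measurable M" unfolding \<theta>_def by measurable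
  have \<tau>m[measurable]: "\<tau> \<in> borel_measurable M" unfolding \<tau>_def by measurable
  have \<theta>0: "0 \<le> \<theta> w" for w using k K by (simp add: \<theta>_def)
  have \<tau>0: "0 \<le> \<tau> w" for w using \<theta>0 \<eta>0 by (simp add: \<tau>_def)
  have \<theta>\<tau>: "\<theta> w * \<tau> w = \<eta> w" for w
  proof (cases "depth z r (X w) = 0")
    case True
    then have "\<eta> w = 0" using \<eta>0[of w] \<eta>v[of w] by simp
    then show ?thesis by (simp add: \<tau>_def)
  next
    case False
    then show ?thesis using k K by (simp add: \<tau>_def \<theta>_def)
  qed
  let ?\<beta> = "segment_background M ?U X \<theta>"
  interpret U: prob_space ?U using r by (intro prob_space_uniform_cball) simp
  have sU: "sets ?U = sets borel" by simp
  have s\<beta>: "sets ?\<beta> = sets borel" by (simp add: segment_background_def)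
  have le: "emeasure ?\<beta> C \<le> emeasure \<kappa> C" if C: "C \<in> sets borel" for C
  proof -
    have "emeasure ?\<beta> C \<le> ennreal (k / K * K) * (\<integral>\<^sup>+x. ennreal ((depth z r x)\<^sup>2) * indicator C x \<partial>lborel)"
      unfolding K_def \<theta>_def using k K
      by (intro segment_background_le[OF M X C r c4 V _ law]) (auto simp: K_def)
    also have "k / K * K = k" using K by simp
    finally show ?thesis using \<kappa>_lower[OF C] by simp
  qed
  have sp: "space \<kappa> = UNIV" "space ?\<beta> = UNIV"
    using sets_eq_imp_space_eq[OF \<kappa>(1)] sets_eq_imp_space_eq[OF s\<beta>] by simp_all
  have f\<kappa>: "finite_measure \<kappa>" by standard (use \<kappa> sp in auto)
  have f\<beta>: "finite_measure ?\<beta>"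
  proof
    have "emeasure ?\<beta> UNIV \<le> emeasure \<kappa> UNIV" by (rule le) simp
    then show "emeasure ?\<beta> (space ?\<beta>) \<noteq> \<infinity>" using \<kappa>(2) sp by (auto simp: top_unique)
  qed
  define \<rho> where "\<rho> = diff_measure \<kappa> ?\<beta>"
  have s\<rho>: "sets \<rho> = sets borel" by (simp add: \<rho>_def \<kappa>)
  have split: "emeasure \<rho> C + emeasure ?\<beta> C = emeasure \<kappa> C" if C: "C \<in> sets borel" for C
  proof -
    have "emeasure \<rho> C = emeasure \<kappa> C - emeasure ?\<beta> C"
      unfolding \<rho>_def by (rule emeasure_diff_measure[OF f\<kappa> f\<beta>]) (use C le s\<beta> \<kappa> in auto)
    then show ?thesis using le[OF C] by (simp add: diff_add_cancel_ennreal)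
  qed
  have regroup: "add_measure \<rho> (add_measure ?\<beta> e) = add_measure \<kappa> e" if e: "sets e = sets borel" for e
    by (rule measure_eqI) (simp_all add: s\<rho> \<kappa> s\<beta> e emeasure_add_measure add.assoc[symmetric] split)
  obtain \<gamma>1 where \<gamma>1: "\<gamma>1 \<in> couplings \<rho> \<rho>" "quad_cost \<gamma>1 = 0"
    using diagonal_coupling[OF s\<rho>] by blast
  have R: "AE q in ?U. norm (q - X w) \<le> 2 * r" if "\<theta> w \<noteq> 0" for w
  proof (rule AE_uniform_measureI)
    have "depth z r (X w) \<noteq> 0" using that by (auto simp: \<theta>_def)
    then have "dist z (X w) < r" by (simp add: depth_eq_0_iff)
    moreover have "norm (q - X w) \<le> dist z q + dist z (X w)" for q
      using dist_triangle3[of q "X w" z] by (simp add: dist_norm)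
    ultimately show "AE q in lborel. q \<in> cball z (r / 2) \<longrightarrow> norm (q - X w) \<le> 2 * r"
      using r by (intro AE_I2 impI) (force intro: order_trans)
  qed simp
  obtain \<gamma>2 where \<gamma>2: "\<gamma>2 \<in> couplings (add_measure ?\<beta> (distr (density M (\<lambda>w. ennreal (\<theta> w * \<tau> w))) borel X))
      (add_measure ?\<beta> (scale_measure (\<integral>\<^sup>+w. ennreal (\<theta> w * \<tau> w) \<partial>M) ?U))"
    "quad_cost \<gamma>2 \<le> (\<integral>\<^sup>+w. ennreal (2 * (2 * r)\<^sup>2 * (\<theta> w * (\<tau> w)\<^sup>2)) \<partial>M)"
    using segment_shift_coupling[OF U.prob_space_axioms sU X \<theta>m \<tau>m \<theta>0 \<tau>0 R] by blast
  have "add_measure \<gamma>1 \<gamma>2 \<in> couplings (add_measure \<kappa> (distr (density M (\<lambda>w. ennreal (\<eta> w))) borel X))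
      (add_measure \<kappa> (scale_measure (\<integral>\<^sup>+w. ennreal (\<eta> w) \<partial>M) ?U))"
    using couplings_add[OF \<gamma>1(1) \<gamma>2(1)] by (simp add: regroup \<theta>\<tau>)
  moreover have "quad_cost (add_measure \<gamma>1 \<gamma>2) \<le> ennreal (8 * r\<^sup>2 * K / k) * (\<integral>\<^sup>+w. ennreal ((v w)\<^sup>2) \<partial>M)"
  proof -
    have "quad_cost (add_measure \<gamma>1 \<gamma>2) = quad_cost \<gamma>2"
      using quad_cost_add[of \<gamma>1 \<gamma>2] couplingsD(1)[OF \<gamma>1(1)] couplingsD(1)[OF \<gamma>2(1)] \<gamma>1(2) by simp
    also have "\<dots> \<le> (\<integral>\<^sup>+w. ennreal (2 * (2 * r)\<^sup>2 * (\<theta> w * (\<tau> w)\<^sup>2)) \<partial>M)" by (rule \<gamma>2(2))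
    also have "\<dots> \<le> (\<integral>\<^sup>+w. ennreal (8 * r\<^sup>2 * K / k) * ennreal ((v w)\<^sup>2) \<partial>M)"
    proof (rule nn_integral_mono)
      fix w
      have "\<theta> w * (\<tau> w)\<^sup>2 \<le> K / k * (v w)\<^sup>2"
      proof (cases "depth z r (X w) = 0")
        case True
        then show ?thesis using k K by (simp add: \<theta>_def)
      next
        case False
        have eq: "\<theta> w * (\<tau> w)\<^sup>2 = K / k * ((\<eta> w)\<^sup>2 / (depth z r (X w))\<^sup>2)"
          using False k K by (simp add: \<tau>_def \<theta>_def power2_eq_square field_simps)
        have "(\<eta> w)\<^sup>2 \<le> (depth z r (X w) * v w)\<^sup>2" using \<eta>0 \<eta>v by (intro power_mono) auto
        then have "(\<eta> w)\<^sup>2 / (depth z r (X w))\<^sup>2 \<le> (v w)\<^sup>2"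
          using False by (simp add: power_mult_distrib divide_le_eq mult.commute)
        then have "K / k * ((\<eta> w)\<^sup>2 / (depth z r (X w))\<^sup>2) \<le> K / k * (v w)\<^sup>2"
          using k K by (intro mult_left_mono) auto
        then show ?thesis unfolding eq .
      qed
      then have "2 * (2 * r)\<^sup>2 * (\<theta> w * (\<tau> w)\<^sup>2) \<le> 2 * (2 * r)\<^sup>2 * (K / k * (v w)\<^sup>2)"
        by (rule mult_left_mono) simp
      also have "\<dots> = (8 * r\<^sup>2 * K / k) * (v w)\<^sup>2" by (simp add: power_mult_distrib)
      finally show "ennreal (2 * (2 * r)\<^sup>2 * (\<theta> w * (\<tau> w)\<^sup>2)) \<le> ennreal (8 * r\<^sup>2 * K / k) * ennreal ((v w)\<^sup>2)"
        using k K by (subst ennreal_mult[symmetric]) (auto intro: ennreal_leI)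
    qed
    also have "\<dots> = ennreal (8 * r\<^sup>2 * K / k) * (\<integral>\<^sup>+w. ennreal ((v w)\<^sup>2) \<partial>M)"
      by (rule nn_integral_cmult) measurable
    finally show ?thesis .
  qed
  ultimately show ?thesis unfolding K_def by blast
qed

section \<open>Cutting off the marginals of a plan of small cost\<close>

lemma (in prob_space) integral_le_sqrt_second_moment:
  fixes f :: "'a \<Rightarrow> real"
  assumes "integrable M f" "integrable M (\<lambda>x. (f x)\<^sup>2)"
  shows "(\<integral>x. f x \<partial>M) \<le> sqrt (\<integral>x. (f x)\<^sup>2 \<partial>M)"
proof -
  have "0 \<le> (\<integral>x. (f x)\<^sup>2 \<partial>M) - (\<integral>x. f x \<partial>M)\<^sup>2"
    using variance_eq[OF assms] variance_positive[of f] by simp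
  then show ?thesis by (intro real_le_rsqrt) simp
qed

definition ratio_const :: "real \<Rightarrow> real \<Rightarrow> real" where
  "ratio_const c2 D = 12 * c2\<^sup>2 * sqrt c2 / D"

definition excess_const :: "real \<Rightarrow> real \<Rightarrow> real" where
  "excess_const c2 D = 9 / 2 * c2\<^sup>2 + 81 / 8 * c2 ^ 3 * (ratio_const c2 D)\<^sup>2"

definition move_const :: "nat \<Rightarrow> real \<Rightarrow> real \<Rightarrow> real \<Rightarrow> real" where
  "move_const n c2 c4 V = 64 * c2\<^sup>2 * c4 * (2 ^ n * (4 * c4 + 16 / V))"

definition transfer_const :: "real \<Rightarrow> real \<Rightarrow> real" where
  "transfer_const c2 D = 3 / 2 + 4 * c2 * (4 * c2 + 72 * c2\<^sup>2 / D)"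

text \<open>
  A coupling \<open>\<pi>\<close> seen from its first marginal. The cutoff \<open>\<phi>\<close> enters through its comparison with the squared
  depth and the increment bound derived from the gradient, the density through the two-sided comparison with
  Lebesgue measure on the ball. The number \<open>D\<close> bounds the mean squared depth from below and
  makes the assumptions \<open>small\<close> quantitative.
\<close>
locale cutoff_plan =
  fixes \<pi> :: "((real ^ 'n) \<times> (real ^ 'n)) measure" and \<phi> :: "real ^ 'n \<Rightarrow> real"
    and z :: "real ^ 'n" and r c2 c4 V D E :: real
  assumes prob: "prob_space \<pi>" and sets_\<pi>: "sets \<pi> = sets borel"
    and cost: "quad_cost \<pi> = ennreal E" and E: "0 \<le> E"
    and \<phi>_measurable: "\<phi> \<in> borel_measurable borel"
    and \<phi>_nonneg: "\<And>x. 0 \<le> \<phi> x" and \<phi>_le_1: "\<And>x. \<phi> x \<le> 1"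
    and r: "0 < r" "r\<^sup>2 \<le> c2" and c2: "0 < c2" and c4: "0 < c4"
    and \<phi>_lower: "\<And>x. (depth z r x)\<^sup>2 \<le> c2 * \<phi> x"
    and \<phi>_upper: "\<And>x. \<phi> x \<le> c2 * (depth z r x)\<^sup>2"
    and \<phi>_lipschitz: "\<And>x y. \<bar>\<phi> x - \<phi> y\<bar> \<le> c2 * max (depth z r x) (depth z r y) * norm (x - y)"
    and V: "0 < V" "V \<le> measure lborel (cball z (r / 2))"
    and law_upper: "\<And>g. g \<in> borel_measurable borel \<Longrightarrow>
      (\<integral>\<^sup>+p. g (fst p) * indicator (cball z r) (fst p) \<partial>\<pi>) \<le> ennreal c4 * (\<integral>\<^sup>+x. g x * indicator (cball z r) x \<partial>lborel)"
    and law_lower: "\<And>g. g \<in> borel_measurable borel \<Longrightarrow>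
      (\<integral>\<^sup>+x. g x * indicator (cball z r) x \<partial>lborel) \<le> ennreal c4 * (\<integral>\<^sup>+p. g (fst p) * indicator (cball z r) (fst p) \<partial>\<pi>)"
    and D: "0 < D" "D \<le> (\<integral>p. (depth z r (fst p))\<^sup>2 \<partial>\<pi>)"
    and small: "8 * E \<le> D" "ratio_const c2 D * sqrt E \<le> 1 / 2"
begin

sublocale prob_space \<pi> by (rule prob)

lemma sets_pair [measurable_cong]: "sets \<pi> = sets (borel \<Otimes>\<^sub>M borel)"
  unfolding borel_prod by (rule sets_\<pi>)

lemma const_nonneg:
  "0 \<le> move_const CARD('n) c2 c4 V" "0 \<le> excess_const c2 D" "0 \<le> transfer_const c2 D"
proof -
  show "0 \<le> move_const CARD('n) c2 c4 V"
    unfolding move_const_def using c2 c4 V by (intro mult_nonneg_nonneg add_nonneg_nonneg) auto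
  show "0 \<le> excess_const c2 D" unfolding excess_const_def using c2 by simp
  show "0 \<le> transfer_const c2 D"
    unfolding transfer_const_def using c2 D by (intro mult_nonneg_nonneg add_nonneg_nonneg) auto
qed

lemma space_\<pi> [simp]: "space \<pi> = UNIV"
  using sets_eq_imp_space_eq[OF sets_\<pi>] by simp

declare \<phi>_measurable [measurable]

abbreviation "d \<equiv> depth z r"
abbreviation "gap p \<equiv> norm (fst p - snd p)"

text \<open>
  The good pairs: the displacement is less than half the depth of the first point, so the depths of both
  points are comparable.
\<close>
definition "G = {p :: (real ^ 'n) \<times> (real ^ 'n). 2 * norm (fst p - snd p) < depth z r (fst p)}"

lemma G_measurable [measurable]: "G \<in> sets (borel \<Otimes>\<^sub>M borel)"
proof -
  have "{p \<in> space (borel \<Otimes>\<^sub>M borel). 2 * norm (fst p - snd p) < depth z r (fst p :: real ^ 'n)} \<in> sets (borel \<Otimes>\<^sub>M borel)"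
    by measurable
  then show ?thesis by (simp add: G_def space_pair_measure)
qed

lemma G_measurable' [measurable]: "G \<in> sets \<pi>"
  unfolding sets_pair by measurable

lemma on_G:
  assumes "p \<in> G"
  shows "d (snd p) \<le> 3 / 2 * d (fst p)" "d (fst p) \<le> 2 * d (snd p)"
proof -
  have "2 * gap p < d (fst p)" using assms by (simp add: G_def)
  then show "d (snd p) \<le> 3 / 2 * d (fst p)" "d (fst p) \<le> 2 * d (snd p)"
    using depth_lipschitz[of z r "fst p" "snd p"] by linarith+
qed

lemma \<phi>_diff_on_G:
  assumes "p \<in> G"
  shows "\<bar>\<phi> (fst p) - \<phi> (snd p)\<bar> \<le> 3 / 2 * c2 * d (fst p) * gap p"
proof -
  have "max (d (fst p)) (d (snd p)) \<le> 3 / 2 * d (fst p)"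
    using on_G(1)[OF assms] depth_nonneg[of z r "fst p"] by (intro max.boundedI) linarith+
  then have "c2 * max (d (fst p)) (d (snd p)) * gap p \<le> c2 * (3 / 2 * d (fst p)) * gap p"
    using c2 by (intro mult_right_mono mult_left_mono) auto
  then show ?thesis using \<phi>_lipschitz[of "fst p" "snd p"] by (simp add: mult_ac)
qed

lemma \<phi>_snd_on_G:
  assumes "p \<in> G"
  shows "\<phi> (snd p) \<le> 9 / 4 * c2 * (d (fst p))\<^sup>2" "(d (fst p))\<^sup>2 \<le> 4 * c2 * \<phi> (snd p)"
proof -
  have "(d (snd p))\<^sup>2 \<le> (3 / 2 * d (fst p))\<^sup>2" using on_G(1)[OF assms] by (intro power_mono) auto
  then have "c2 * (d (snd p))\<^sup>2 \<le> c2 * (3 / 2 * d (fst p))\<^sup>2" using c2 by (intro mult_left_mono) auto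
  then show "\<phi> (snd p) \<le> 9 / 4 * c2 * (d (fst p))\<^sup>2"
    using \<phi>_upper[of "snd p"] by (simp add: power_mult_distrib power2_eq_square mult_ac)
  have "(d (fst p))\<^sup>2 \<le> (2 * d (snd p))\<^sup>2" using on_G(2)[OF assms] by (intro power_mono) auto
  then show "(d (fst p))\<^sup>2 \<le> 4 * c2 * \<phi> (snd p)"
    using \<phi>_lower[of "snd p"] by (simp add: power_mult_distrib)
qed

text \<open>
  A bad pair moves far compared with the depth of its first point, hence also with that of the second.
  So both cutoff weights are paid for by the squared displacement.
\<close>
lemma off_G:
  assumes "p \<notin> G"
  shows "(d (fst p))\<^sup>2 \<le> 4 * (gap p)\<^sup>2" "\<phi> (fst p) \<le> 4 * c2 * (gap p)\<^sup>2" "\<phi> (snd p) \<le> 9 * c2 * (gap p)\<^sup>2"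
proof -
  have 1: "d (fst p) \<le> 2 * gap p" using assms by (simp add: G_def)
  then have "(d (fst p))\<^sup>2 \<le> (2 * gap p)\<^sup>2" by (intro power_mono) auto
  then show *: "(d (fst p))\<^sup>2 \<le> 4 * (gap p)\<^sup>2" by (simp add: power_mult_distrib)
  have "c2 * (d (fst p))\<^sup>2 \<le> c2 * (4 * (gap p)\<^sup>2)" using c2 * by (intro mult_left_mono) auto
  then show "\<phi> (fst p) \<le> 4 * c2 * (gap p)\<^sup>2" using \<phi>_upper[of "fst p"] by simp
  have "d (snd p) \<le> 3 * gap p" using depth_lipschitz[of z r "fst p" "snd p"] 1 by linarith
  then have "(d (snd p))\<^sup>2 \<le> (3 * gap p)\<^sup>2" by (intro power_mono) auto
  then have "c2 * (d (snd p))\<^sup>2 \<le> c2 * (3 * gap p)\<^sup>2" using c2 by (intro mult_left_mono) auto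
  then show "\<phi> (snd p) \<le> 9 * c2 * (gap p)\<^sup>2" using \<phi>_upper[of "snd p"] by (simp add: power_mult_distrib)
qed

lemma gap_sq: "integrable \<pi> (\<lambda>p. (gap p)\<^sup>2)" "(\<integral>p. (gap p)\<^sup>2 \<partial>\<pi>) = E"
proof -
  have nn: "(\<integral>\<^sup>+p. ennreal ((gap p)\<^sup>2) \<partial>\<pi>) = ennreal E" using cost by (simp add: quad_cost_def)
  show "integrable \<pi> (\<lambda>p. (gap p)\<^sup>2)"
    by (rule integrableI_nn_integral_finite[OF _ _ nn]) auto
  show "(\<integral>p. (gap p)\<^sup>2 \<partial>\<pi>) = E" using E nn by (subst integral_eq_nn_integral) auto
qed

lemma bounded_integrable:
  "f \<in> borel_measurable \<pi> \<Longrightarrow> (\<And>p. \<bar>f p\<bar> \<le> B) \<Longrightarrow> integrable \<pi> f" for f :: "_ \<Rightarrow> real"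
  by (rule integrable_const_bound[where B = B]) auto

lemma gap_integrable: "integrable \<pi> gap"
proof (rule Bochner_Integration.integrable_bound)
  show "integrable \<pi> (\<lambda>p. 1 + (gap p)\<^sup>2)" using gap_sq(1) by auto
  have "gap p \<le> 1 + (gap p)\<^sup>2" for p :: "(real ^ 'n) \<times> (real ^ 'n)"
  proof -
    have "0 \<le> (gap p - 1)\<^sup>2 + (gap p)\<^sup>2 + 1" by simp
    then show ?thesis by (simp add: power2_eq_square algebra_simps)
  qed
  then show "AE p in \<pi>. norm (gap p) \<le> norm (1 + (gap p)\<^sup>2)" by (auto intro: order_trans)
qed measurable

lemma gap_mean: "(\<integral>p. gap p \<partial>\<pi>) \<le> sqrt E"
  using integral_le_sqrt_second_moment[OF gap_integrable gap_sq(1)] gap_sq(2) by simp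

lemma r_le: "r \<le> sqrt c2"
  using r by (intro real_le_rsqrt)

text \<open>
  The factor \<open>b\<close> makes the weights \<open>\<phi> (fst p)\<close> and \<open>b * \<phi> (snd p)\<close> have the same mass on the good pairs.
\<close>
definition "I1 = (\<integral>p. \<phi> (fst p) * indicator G p \<partial>\<pi>)"
definition "I2 = (\<integral>p. \<phi> (snd p) * indicator G p \<partial>\<pi>)"
definition "b = I1 / I2"

lemma \<phi>_abs: "\<bar>\<phi> x * indicator A p\<bar> \<le> 1" "\<bar>\<phi> x\<bar> \<le> 1"
  using \<phi>_nonneg[of x] \<phi>_le_1[of x] by (auto simp: indicator_def)

lemma \<phi>_integrable:
  "integrable \<pi> (\<lambda>p. \<phi> (fst p) * indicator G p)" "integrable \<pi> (\<lambda>p. \<phi> (snd p) * indicator G p)"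
  "integrable \<pi> (\<lambda>p. \<phi> (fst p))" "integrable \<pi> (\<lambda>p. \<phi> (snd p))"
  by (rule bounded_integrable[where B = 1], measurable, rule \<phi>_abs)+

text \<open>
  The good pairs keep a fixed share of the mass, since the bad ones carry at most a multiple of \<open>E\<close>.
\<close>
lemma I2_lower: "D / (8 * c2) \<le> I2"
proof -
  have "(\<integral>p. (d (fst p))\<^sup>2 \<partial>\<pi>) \<le> (\<integral>p. 4 * c2 * (\<phi> (snd p) * indicator G p) + 4 * (gap p)\<^sup>2 \<partial>\<pi>)"
  proof (rule integral_mono)
    show "integrable \<pi> (\<lambda>p. (d (fst p))\<^sup>2)"
      by (rule bounded_integrable[where B = "r\<^sup>2"]) (use r in \<open>auto intro!: power_mono depth_le_radius\<close>)
    show "integrable \<pi> (\<lambda>p. 4 * c2 * (\<phi> (snd p) * indicator G p) + 4 * (gap p)\<^sup>2)"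
      using \<phi>_integrable gap_sq by auto
    fix p
    show "(d (fst p))\<^sup>2 \<le> 4 * c2 * (\<phi> (snd p) * indicator G p) + 4 * (gap p)\<^sup>2"
    proof (cases "p \<in> G")
      case True
      have "0 \<le> 4 * (gap p)\<^sup>2" "4 * c2 * (\<phi> (snd p) * indicator G p) = 4 * c2 * \<phi> (snd p)"
        using True by simp_all
      then show ?thesis using \<phi>_snd_on_G(2)[OF True] by linarith
    qed (simp add: off_G)
  qed
  also have "\<dots> = 4 * c2 * I2 + 4 * E"
    unfolding I2_def using \<phi>_integrable gap_sq by simp
  finally have "D / 2 \<le> 4 * c2 * I2" using D small by linarith
  then show ?thesis using c2 by (simp add: field_simps)
qed

lemma I2_pos: "0 < I2"
  using I2_lower D c2 by (meson divide_pos_pos mult_pos_pos less_le_trans zero_less_numeral)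

lemma b_times: "b * I2 = I1"
  using I2_pos by (simp add: b_def)

text \<open>
  On good pairs the increment of \<open>\<phi>\<close> is at most a constant times the displacement, whose mean is at most \<open>\<surd>E\<close>.
\<close>
lemma b_near_1: "\<bar>1 - b\<bar> \<le> ratio_const c2 D * sqrt E"
proof -
  have "\<bar>I1 - I2\<bar> = \<bar>\<integral>p. \<phi> (fst p) * indicator G p - \<phi> (snd p) * indicator G p \<partial>\<pi>\<bar>"
    unfolding I1_def I2_def using \<phi>_integrable by simp
  also have "\<dots> \<le> (\<integral>p. \<bar>\<phi> (fst p) * indicator G p - \<phi> (snd p) * indicator G p\<bar> \<partial>\<pi>)"
    by (rule integral_abs_bound)
  also have "\<dots> \<le> (\<integral>p. 3 / 2 * c2 * sqrt c2 * gap p \<partial>\<pi>)"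
  proof (rule integral_mono)
    show "integrable \<pi> (\<lambda>p. \<bar>\<phi> (fst p) * indicator G p - \<phi> (snd p) * indicator G p\<bar>)"
      using \<phi>_integrable by auto
    show "integrable \<pi> (\<lambda>p. 3 / 2 * c2 * sqrt c2 * gap p)" using gap_integrable by auto
    fix p
    show "\<bar>\<phi> (fst p) * indicator G p - \<phi> (snd p) * indicator G p\<bar> \<le> 3 / 2 * c2 * sqrt c2 * gap p"
    proof (cases "p \<in> G")
      case True
      have "d (fst p) \<le> sqrt c2" using depth_le_radius[of r z "fst p"] r_le r by linarith
      then have "3 / 2 * c2 * d (fst p) * gap p \<le> 3 / 2 * c2 * sqrt c2 * gap p"
        using c2 by (intro mult_right_mono mult_left_mono) auto
      then show ?thesis using \<phi>_diff_on_G[OF True] True by simp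
    qed (use c2 in simp)
  qed
  also have "\<dots> = 3 / 2 * c2 * sqrt c2 * (\<integral>p. gap p \<partial>\<pi>)" by simp
  also have "\<dots> \<le> 3 / 2 * c2 * sqrt c2 * sqrt E" using c2 gap_mean by (intro mult_left_mono) auto
  finally have *: "\<bar>I1 - I2\<bar> \<le> 3 / 2 * c2 * sqrt c2 * sqrt E" .
  have "\<bar>1 - b\<bar> = \<bar>I1 - I2\<bar> / I2"
    using I2_pos by (simp add: b_def abs_minus_commute diff_divide_distrib[symmetric] field_simps abs_divide)
  also have "\<dots> \<le> (3 / 2 * c2 * sqrt c2 * sqrt E) / (D / (8 * c2))"
    using * I2_lower I2_pos c2 D E by (intro frac_le) auto
  also have "\<dots> = ratio_const c2 D * sqrt E"
    using c2 D by (simp add: ratio_const_def power2_eq_square field_simps)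
  finally show ?thesis .
qed

lemma b_bounds: "1 / 2 \<le> b" "b \<le> 3 / 2"
  using b_near_1 small(2) by linarith+

text \<open>
  The intermediate weight. Bad pairs keep their own weight \<open>\<phi> (fst p)\<close>, so that \<open>\<psi>\<close> stays
  above a multiple of the squared depth everywhere; otherwise there would be no background to push where bad pairs
  dominate.
\<close>
definition "\<psi> p = (if p \<in> G then b * \<phi> (snd p) else \<phi> (fst p))"

lemma \<psi>_measurable [measurable]: "\<psi> \<in> borel_measurable \<pi>"
  unfolding \<psi>_def by measurable

lemma \<psi>_nonneg: "0 \<le> \<psi> p"
  using b_bounds \<phi>_nonneg by (simp add: \<psi>_def)

lemma \<psi>_integrable: "integrable \<pi> \<psi>"
proof (rule bounded_integrable[where B = 2])
  fix p :: "(real ^ 'n) \<times> (real ^ 'n)"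
  have "b * \<phi> (snd p) \<le> 3 / 2 * 1" using b_bounds \<phi>_nonneg \<phi>_le_1 by (intro mult_mono) auto
  then show "\<bar>\<psi> p\<bar> \<le> 2" using \<psi>_nonneg[of p] \<phi>_le_1[of "fst p"] by (auto simp: \<psi>_def split: if_splits)
qed measurable

lemma \<psi>_mass: "(\<integral>p. \<psi> p \<partial>\<pi>) = (\<integral>p. \<phi> (fst p) \<partial>\<pi>)"
proof -
  have "(\<integral>p. \<psi> p \<partial>\<pi>) = (\<integral>p. b * (\<phi> (snd p) * indicator G p) + (\<phi> (fst p) - \<phi> (fst p) * indicator G p) \<partial>\<pi>)"
    by (intro Bochner_Integration.integral_cong) (auto simp: \<psi>_def)
  also have "\<dots> = b * I2 + ((\<integral>p. \<phi> (fst p) \<partial>\<pi>) - I1)"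
    unfolding I1_def I2_def using \<phi>_integrable by simp
  finally show ?thesis by (simp add: b_times)
qed

text \<open>
  The excess relative to the depth: one term from the increment of \<open>\<phi>\<close> and one from \<open>|1 - b|\<close>.
\<close>
definition "v p = 3 / 2 * c2 * gap p + 9 / 4 * c2 * sqrt c2 * (ratio_const c2 D * sqrt E)"

lemma v_measurable [measurable]: "v \<in> borel_measurable \<pi>"
  unfolding v_def by measurable

lemma ratio_const_nonneg: "0 \<le> ratio_const c2 D"
  using c2 D by (simp add: ratio_const_def)

lemma v_nonneg: "0 \<le> v p"
  using c2 ratio_const_nonneg E by (simp add: v_def)

lemma excess_bound: "\<bar>\<phi> (fst p) - \<psi> p\<bar> \<le> d (fst p) * v p"
proof (cases "p \<in> G")
  case True
  let ?\<epsilon> = "ratio_const c2 D * sqrt E"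
  have \<epsilon>: "0 \<le> ?\<epsilon>" using ratio_const_nonneg E by simp
  have dr: "d (fst p) \<le> sqrt c2" using depth_le_radius[of r z "fst p"] r_le r by linarith
  have "\<phi> (fst p) - \<psi> p = (\<phi> (fst p) - \<phi> (snd p)) + (1 - b) * \<phi> (snd p)"
    using True by (simp add: \<psi>_def algebra_simps)
  then have "\<bar>\<phi> (fst p) - \<psi> p\<bar> \<le> \<bar>\<phi> (fst p) - \<phi> (snd p)\<bar> + \<bar>1 - b\<bar> * \<phi> (snd p)"
    using \<phi>_nonneg[of "snd p"] abs_triangle_ineq[of "\<phi> (fst p) - \<phi> (snd p)" "(1 - b) * \<phi> (snd p)"]
    by (simp add: abs_mult)
  also have "\<dots> \<le> 3 / 2 * c2 * d (fst p) * gap p + ?\<epsilon> * (9 / 4 * c2 * (d (fst p))\<^sup>2)"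
    using \<phi>_diff_on_G[OF True] b_near_1 \<phi>_snd_on_G(1)[OF True] \<phi>_nonneg \<epsilon>
    by (intro add_mono mult_mono) auto
  also have "(d (fst p))\<^sup>2 \<le> d (fst p) * sqrt c2"
    unfolding power2_eq_square using dr by (intro mult_left_mono) auto
  then have "?\<epsilon> * (9 / 4 * c2 * (d (fst p))\<^sup>2) \<le> ?\<epsilon> * (9 / 4 * c2 * (d (fst p) * sqrt c2))"
    using \<epsilon> c2 by (intro mult_left_mono) auto
  finally show ?thesis by (simp add: v_def algebra_simps)
next
  case False
  then show ?thesis using v_nonneg[of p] by (simp add: \<psi>_def)
qed

lemma v_sq: "(\<integral>\<^sup>+p. ennreal ((v p)\<^sup>2) \<partial>\<pi>) \<le> ennreal (excess_const c2 D * E)"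
proof -
  let ?A = "9 / 2 * c2\<^sup>2" and ?B = "81 / 8 * c2 ^ 3 * (ratio_const c2 D)\<^sup>2 * E"
  have vb: "(v p)\<^sup>2 \<le> ?A * (gap p)\<^sup>2 + ?B" for p
  proof -
    let ?s = "3 / 2 * c2 * gap p" and ?t = "9 / 4 * c2 * sqrt c2 * (ratio_const c2 D * sqrt E)"
    have sum_sq: "(s + t)\<^sup>2 \<le> 2 * s\<^sup>2 + 2 * t\<^sup>2" for s t :: real
      using zero_le_power2[of "s - t"] unfolding power2_sum power2_diff by linarith
    have "(?s + ?t)\<^sup>2 \<le> 2 * ?s\<^sup>2 + 2 * ?t\<^sup>2" by (rule sum_sq)
    also have "2 * ?s\<^sup>2 = ?A * (gap p)\<^sup>2" by (simp add: power_mult_distrib power2_eq_square)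
    also have "2 * ?t\<^sup>2 = ?B"
      using c2 E by (simp add: power_mult_distrib power2_eq_square power3_eq_cube)
    finally show ?thesis by (simp add: v_def)
  qed
  have B0: "0 \<le> ?B" using c2 E by simp
  have "(\<integral>\<^sup>+p. ennreal ((v p)\<^sup>2) \<partial>\<pi>) \<le> (\<integral>\<^sup>+p. ennreal (?A * (gap p)\<^sup>2 + ?B) \<partial>\<pi>)"
    by (intro nn_integral_mono ennreal_leI vb)
  also have "\<dots> = ennreal (\<integral>p. ?A * (gap p)\<^sup>2 + ?B \<partial>\<pi>)"
    using gap_sq B0 by (intro nn_integral_eq_integral AE_I2) (auto intro!: add_nonneg_nonneg)
  also have "(\<integral>p. ?A * (gap p)\<^sup>2 + ?B \<partial>\<pi>) = ?A * E + ?B"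
    using gap_sq prob_space by simp
  also have "\<dots> = excess_const c2 D * E" by (simp add: excess_const_def algebra_simps)
  finally show ?thesis .
qed

abbreviation "push X F \<equiv> distr (density \<pi> (\<lambda>p. ennreal (F p))) borel X"

lemma fst_snd_measurable [measurable]: "fst \<in> \<pi> \<rightarrow>\<^sub>M borel" "snd \<in> \<pi> \<rightarrow>\<^sub>M borel"
  by measurable

lemma push_mass: "emeasure (push X F) UNIV = ennreal (\<integral>p. F p \<partial>\<pi>)"
  if "X \<in> \<pi> \<rightarrow>\<^sub>M borel" "integrable \<pi> F" "\<And>p. 0 \<le> F p" for X :: "_ \<Rightarrow> real ^ 'n"
proof -
  have [measurable]: "F \<in> borel_measurable \<pi>" using that by auto
  have "UNIV \<in> sets \<pi>" using sets.top[of \<pi>] by simp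
  then have "emeasure (push X F) UNIV = (\<integral>\<^sup>+p. ennreal (F p) \<partial>\<pi>)"
    using that by (simp add: emeasure_distr emeasure_density)
  then show ?thesis using that by (simp add: nn_integral_eq_integral)
qed

text \<open>
  The background for the shifts: the minimum of the two weights still dominates the squared depth, and the first
  marginal has density bounded below on the ball.
\<close>
lemma common_part_lower:
  assumes [measurable]: "C \<in> sets borel"
  shows "ennreal (1 / (8 * c2 * c4)) * (\<integral>\<^sup>+x. ennreal ((d x)\<^sup>2) * indicator C x \<partial>lborel)
    \<le> emeasure (push fst (\<lambda>p. min (\<phi> (fst p)) (\<psi> p))) C"
proof -
  let ?g = "\<lambda>x. ennreal ((d x)\<^sup>2) * indicator C x"
  let ?m = "\<lambda>p. min (\<phi> (fst p)) (\<psi> p)"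
  have pt: "(d (fst p))\<^sup>2 \<le> 8 * c2 * ?m p" for p
  proof -
    have a: "(d (fst p))\<^sup>2 \<le> 8 * c2 * \<phi> (fst p)"
      using \<phi>_lower[of "fst p"] mult_nonneg_nonneg[OF less_imp_le[OF c2] \<phi>_nonneg[of "fst p"]] by linarith
    moreover have "(d (fst p))\<^sup>2 \<le> 8 * c2 * \<psi> p"
    proof (cases "p \<in> G")
      case True
      have "(1 / 2) * \<phi> (snd p) \<le> b * \<phi> (snd p)" using b_bounds \<phi>_nonneg by (intro mult_right_mono) auto
      then have "8 * c2 * ((1 / 2) * \<phi> (snd p)) \<le> 8 * c2 * (b * \<phi> (snd p))" using c2 by (intro mult_left_mono) auto
      moreover have "8 * c2 * ((1 / 2) * \<phi> (snd p)) = 4 * c2 * \<phi> (snd p)" by simp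
      moreover have "8 * c2 * (b * \<phi> (snd p)) = 8 * c2 * \<psi> p" using True by (simp add: \<psi>_def)
      ultimately show ?thesis using \<phi>_snd_on_G(2)[OF True] by linarith
    qed (use a in \<open>simp add: \<psi>_def\<close>)
    ultimately show ?thesis by (simp add: min_def)
  qed
  have "(\<integral>\<^sup>+x. ?g x \<partial>lborel) = (\<integral>\<^sup>+x. ?g x * indicator (cball z r) x \<partial>lborel)"
    by (intro nn_integral_cong) (auto simp: indicator_def depth_eq_0_iff)
  also have "\<dots> \<le> ennreal c4 * (\<integral>\<^sup>+p. ?g (fst p) * indicator (cball z r) (fst p) \<partial>\<pi>)"
    by (rule law_lower) measurable
  also have "(\<integral>\<^sup>+p. ?g (fst p) * indicator (cball z r) (fst p) \<partial>\<pi>) \<le>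
      (\<integral>\<^sup>+p. ennreal (8 * c2) * (ennreal (?m p) * indicator C (fst p)) \<partial>\<pi>)"
  proof (rule nn_integral_mono)
    fix p
    have "ennreal ((d (fst p))\<^sup>2) \<le> ennreal (8 * c2 * ?m p)" by (rule ennreal_leI[OF pt])
    also have "\<dots> = ennreal (8 * c2) * ennreal (?m p)"
      using c2 \<phi>_nonneg \<psi>_nonneg by (intro ennreal_mult) auto
    finally show "?g (fst p) * indicator (cball z r) (fst p) \<le> ennreal (8 * c2) * (ennreal (?m p) * indicator C (fst p))"
      by (auto simp: indicator_def)
  qed
  also have "\<dots> = ennreal (8 * c2) * (\<integral>\<^sup>+p. ennreal (?m p) * indicator C (fst p) \<partial>\<pi>)"
    by (rule nn_integral_cmult) measurable
  also have "(\<integral>\<^sup>+p. ennreal (?m p) * indicator C (fst p) \<partial>\<pi>) = emeasure (push fst ?m) C"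
    by (subst emeasure_distr_eq) (auto simp: nn_integral_density)
  finally have "(\<integral>\<^sup>+x. ?g x \<partial>lborel) \<le> ennreal c4 * (ennreal (8 * c2) * emeasure (push fst ?m) C)"
    by (simp add: mult_left_mono)
  then have "ennreal (1 / (8 * c2 * c4)) * (\<integral>\<^sup>+x. ?g x \<partial>lborel) \<le>
      ennreal (1 / (8 * c2 * c4)) * (ennreal c4 * (ennreal (8 * c2) * emeasure (push fst ?m) C))"
    by (rule mult_left_mono) simp
  also have "\<dots> = ennreal (1 / (8 * c2 * c4) * c4 * (8 * c2)) * emeasure (push fst ?m) C"
  proof -
    have "ennreal (s * t * u) = ennreal s * ennreal t * ennreal u" if "0 \<le> s" "0 \<le> t" "0 \<le> u" for s t u :: real
      using that by (simp add: ennreal_mult)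
    from this[of "1 / (8 * c2 * c4)" c4 "8 * c2"] show ?thesis
      using c2 c4 by (simp only: mult.assoc mult_nonneg_nonneg divide_nonneg_nonneg less_imp_le zero_le_numeral zero_le_one)
  qed
  also have "1 / (8 * c2 * c4) * c4 * (8 * c2) = 1" using c2 c4 by simp
  finally show ?thesis by simp
qed

lemma excess_coupling:
  assumes [measurable]: "\<eta> \<in> borel_measurable \<pi>" and \<eta>: "\<And>p. 0 \<le> \<eta> p" "\<And>p. \<eta> p \<le> \<bar>\<phi> (fst p) - \<psi> p\<bar>"
  shows "\<exists>\<gamma>\<in>couplings
      (add_measure (push fst (\<lambda>p. min (\<phi> (fst p)) (\<psi> p))) (push fst \<eta>))
      (add_measure (push fst (\<lambda>p. min (\<phi> (fst p)) (\<psi> p)))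
        (scale_measure (\<integral>\<^sup>+p. ennreal (\<eta> p) \<partial>\<pi>) (uniform_measure lborel (cball z (r / 2))))).
    quad_cost \<gamma> \<le> ennreal (move_const CARD('n) c2 c4 V * excess_const c2 D * E)"
proof -
  let ?m = "\<lambda>p. min (\<phi> (fst p)) (\<psi> p)"
  have m: "integrable \<pi> ?m" using \<phi>_integrable \<psi>_integrable by auto
  have "\<eta> p \<le> d (fst p) * v p" for p using \<eta>(2)[of p] excess_bound[of p] by linarith
  moreover have "emeasure (push fst ?m) UNIV \<noteq> \<infinity>"
    using push_mass[of fst ?m] m \<phi>_nonneg \<psi>_nonneg by simp
  moreover have "0 < 1 / (8 * c2 * c4)" using c2 c4 by simp
  ultimately obtain \<gamma> where \<gamma>: "\<gamma> \<in> couplings (add_measure (push fst ?m) (push fst \<eta>))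
      (add_measure (push fst ?m) (scale_measure (\<integral>\<^sup>+p. ennreal (\<eta> p) \<partial>\<pi>) (uniform_measure lborel (cball z (r / 2)))))"
    "quad_cost \<gamma> \<le> ennreal (8 * r\<^sup>2 * (2 ^ CARD('n) * (4 * c4 + 16 / V)) / (1 / (8 * c2 * c4))) * (\<integral>\<^sup>+p. ennreal ((v p)\<^sup>2) \<partial>\<pi>)"
    using move_excess_to_uniform[OF prob fst_snd_measurable(1) assms(1) v_measurable \<eta>(1) _ r(1) less_imp_le[OF c4] V law_upper _ _ _ common_part_lower]
    by (auto simp: less_imp_le)
  let ?K = "2 ^ CARD('n) * (4 * c4 + 16 / V)"
  have K: "0 \<le> ?K" using c4 V by (intro mult_nonneg_nonneg add_nonneg_nonneg) auto
  have "8 * r\<^sup>2 * ?K / (1 / (8 * c2 * c4)) = r\<^sup>2 * (64 * c2 * c4 * ?K)" by simp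
  also have "\<dots> \<le> c2 * (64 * c2 * c4 * ?K)" using r c2 c4 K by (intro mult_right_mono) auto
  also have "\<dots> = move_const CARD('n) c2 c4 V" by (simp add: move_const_def power2_eq_square)
  finally have mc: "8 * r\<^sup>2 * ?K / (1 / (8 * c2 * c4)) \<le> move_const CARD('n) c2 c4 V" .
  have "quad_cost \<gamma> \<le> ennreal (move_const CARD('n) c2 c4 V) * ennreal (excess_const c2 D * E)"
    using \<gamma>(2) by (rule order_trans) (intro mult_mono ennreal_leI mc v_sq, auto)
  also have "\<dots> = ennreal (move_const CARD('n) c2 c4 V * excess_const c2 D * E)"
    using const_nonneg(1) by (simp only: ennreal_mult'[symmetric] mult.assoc)
  finally show ?thesis using \<gamma>(1) by blast
qed

text \<open>
  Both weights equal their minimum plus an excess, and the two excesses have the same mass. Each excess is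
  moved to the uniform measure on the half ball, and the two couplings are glued there.
\<close>
lemma first_marginal_coupling:
  assumes e: "0 < e"
  shows "\<exists>\<gamma>\<in>couplings (push fst (\<lambda>p. \<phi> (fst p))) (push fst \<psi>).
    quad_cost \<gamma> \<le> ennreal (6 * (move_const CARD('n) c2 c4 V * excess_const c2 D * E) + e)"
proof -
  let ?m = "\<lambda>p. min (\<phi> (fst p)) (\<psi> p)"
  let ?\<eta>1 = "\<lambda>p. max 0 (\<phi> (fst p) - \<psi> p)"
  let ?\<eta>2 = "\<lambda>p. max 0 (\<psi> p - \<phi> (fst p))"
  let ?U = "uniform_measure lborel (cball z (r / 2))"
  let ?T = "add_measure (push fst ?m) (scale_measure (\<integral>\<^sup>+p. ennreal (?\<eta>2 p) \<partial>\<pi>) ?U)"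
  let ?k = "move_const CARD('n) c2 c4 V * excess_const c2 D * E"
  have k0: "0 \<le> ?k" using const_nonneg E by simp
  have i: "integrable \<pi> ?m" "integrable \<pi> ?\<eta>1" "integrable \<pi> ?\<eta>2"
    using \<phi>_integrable \<psi>_integrable by auto
  have m0: "0 \<le> ?m p" for p using \<phi>_nonneg \<psi>_nonneg by simp
  have d1: "push fst (\<lambda>p. \<phi> (fst p)) = add_measure (push fst ?m) (push fst ?\<eta>1)"
    by (rule distr_density_add[OF borel_measurable_integrable[OF i(1)] borel_measurable_integrable[OF i(2)] fst_snd_measurable(1) m0]) auto
  have d2: "push fst \<psi> = add_measure (push fst ?m) (push fst ?\<eta>2)"
    by (rule distr_density_add[OF borel_measurable_integrable[OF i(1)] borel_measurable_integrable[OF i(3)] fst_snd_measurable(1) m0]) auto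
  have "(\<integral>p. ?\<eta>1 p \<partial>\<pi>) - (\<integral>p. ?\<eta>2 p \<partial>\<pi>) = (\<integral>p. ?\<eta>1 p - ?\<eta>2 p \<partial>\<pi>)" using i by simp
  also have "\<dots> = (\<integral>p. \<phi> (fst p) - \<psi> p \<partial>\<pi>)" by (intro Bochner_Integration.integral_cong) auto
  also have "\<dots> = 0" using \<phi>_integrable \<psi>_integrable \<psi>_mass by simp
  finally have eq: "(\<integral>p. ?\<eta>1 p \<partial>\<pi>) = (\<integral>p. ?\<eta>2 p \<partial>\<pi>)" by simp
  have "(\<integral>\<^sup>+p. ennreal (?\<eta>1 p) \<partial>\<pi>) = ennreal (\<integral>p. ?\<eta>1 p \<partial>\<pi>)"
    by (rule nn_integral_eq_integral[OF i(2)]) (intro AE_I2 max.cobounded1)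
  also have "\<dots> = (\<integral>\<^sup>+p. ennreal (?\<eta>2 p) \<partial>\<pi>)"
    unfolding eq by (rule nn_integral_eq_integral[OF i(3), symmetric]) (intro AE_I2 max.cobounded1)
  finally have mass: "(\<integral>\<^sup>+p. ennreal (?\<eta>1 p) \<partial>\<pi>) = (\<integral>\<^sup>+p. ennreal (?\<eta>2 p) \<partial>\<pi>)" .
  have \<eta>m: "?\<eta>1 \<in> borel_measurable \<pi>" "?\<eta>2 \<in> borel_measurable \<pi>"
    by (rule borel_measurable_integrable[OF i(2)], rule borel_measurable_integrable[OF i(3)])
  obtain \<gamma>1 \<gamma>2 where
    \<gamma>1: "\<gamma>1 \<in> couplings (push fst (\<lambda>p. \<phi> (fst p))) ?T"
      "quad_cost \<gamma>1 \<le> ennreal ?k" and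
    \<gamma>2: "\<gamma>2 \<in> couplings (push fst \<psi>) ?T"
      "quad_cost \<gamma>2 \<le> ennreal ?k"
  proof -
    have "0 \<le> ?\<eta>1 p" "?\<eta>1 p \<le> \<bar>\<phi> (fst p) - \<psi> p\<bar>" "0 \<le> ?\<eta>2 p" "?\<eta>2 p \<le> \<bar>\<phi> (fst p) - \<psi> p\<bar>" for p
      by auto
    note * = this
    show thesis
      using excess_coupling[OF \<eta>m(1) *(1,2)] excess_coupling[OF \<eta>m(2) *(3,4)] that
      unfolding mass d1[symmetric] d2[symmetric] by blast
  qed
  obtain \<gamma>3 where \<gamma>3: "\<gamma>3 \<in> couplings ?T (push fst \<psi>)"
    "quad_cost \<gamma>3 \<le> ennreal ?k"
    using couplings_flip[OF \<gamma>2(1)] \<gamma>2(2) by auto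
  have fin: "emeasure ?T UNIV \<noteq> \<infinity>"
  proof -
    have mid: "distr \<gamma>1 borel snd = ?T"
      and fst1: "distr \<gamma>1 borel fst = push fst (\<lambda>p. \<phi> (fst p))"
      using couplingsD[OF \<gamma>1(1)] by auto
    have sg: "sets \<gamma>1 = sets (borel \<Otimes>\<^sub>M borel)" unfolding borel_prod by (rule couplingsD[OF \<gamma>1(1)])
    have [measurable_cong]: "sets \<gamma>1 = sets (borel \<Otimes>\<^sub>M borel)" by (rule sg)
    have "emeasure (distr \<gamma>1 borel snd) UNIV = emeasure (distr \<gamma>1 borel fst) UNIV"
      by (simp add: emeasure_distr)
    then show ?thesis unfolding mid fst1 using push_mass[of fst "\<lambda>p. \<phi> (fst p)"] \<phi>_integrable \<phi>_nonneg by simp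
  qed
  obtain \<gamma> where \<gamma>: "\<gamma> \<in> couplings (push fst (\<lambda>p. \<phi> (fst p))) (push fst \<psi>)"
    "quad_cost \<gamma> \<le> 3 * (quad_cost \<gamma>1 + quad_cost \<gamma>3) + ennreal e"
    using approximate_gluing[OF \<gamma>1(1) \<gamma>3(1) fin e] by blast
  have "quad_cost \<gamma> \<le> 3 * (ennreal ?k + ennreal ?k) + ennreal e"
    using \<gamma>(2) by (rule order_trans) (intro add_mono mult_left_mono \<gamma>1 \<gamma>3, auto)
  also have "\<dots> = ennreal (3 * (?k + ?k) + e)" using k0 e by (intro ennreal_glue_bound) auto
  finally show ?thesis using \<gamma>(1) by (intro bexI[of _ \<gamma>]) (simp_all add: algebra_simps)
qed

text \<open>
  The normalising factor of the theorem, expressed through the coupling.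
\<close>
definition "a = (\<integral>p. \<phi> (fst p) \<partial>\<pi>) / (\<integral>p. \<phi> (snd p) \<partial>\<pi>)"

lemma snd_mass: "I2 \<le> (\<integral>p. \<phi> (snd p) \<partial>\<pi>)"
  unfolding I2_def using \<phi>_integrable
  by (intro integral_mono) (auto simp: indicator_def \<phi>_nonneg)

lemma a_bounds: "0 \<le> a" "a \<le> 8 * c2 / D"
proof -
  have i: "0 \<le> (\<integral>p. \<phi> (fst p) \<partial>\<pi>)" "0 \<le> (\<integral>p. \<phi> (snd p) \<partial>\<pi>)"
    by (auto intro!: integral_nonneg_AE simp: \<phi>_nonneg)
  then show "0 \<le> a" by (simp add: a_def)
  have "(\<integral>p. \<phi> (fst p) \<partial>\<pi>) \<le> (\<integral>p. 1 \<partial>\<pi>)"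
    using \<phi>_integrable by (intro integral_mono) (auto simp: \<phi>_le_1)
  also have "\<dots> = 1" using prob_space by simp
  finally have "a \<le> 1 / (D / (8 * c2))"
    unfolding a_def using i I2_lower snd_mass D c2 by (intro frac_le) auto
  then show "a \<le> 8 * c2 / D" by simp
qed

lemma a_mass: "(\<integral>p. a * \<phi> (snd p) \<partial>\<pi>) = (\<integral>p. \<phi> (fst p) \<partial>\<pi>)"
  using snd_mass I2_pos by (simp add: a_def)

text \<open>
  On good pairs the common weight \<open>min a b * \<phi> (snd p)\<close> travels along \<open>\<pi>\<close> itself. For whichever of \<open>a\<close> and \<open>b\<close> is
  smaller, the remainder on its side lives on bad pairs only. The two remainders have equal mass, which is
  therefore of order \<open>E\<close>, and they are coupled by the product measure.
\<close>
lemma second_marginal_coupling: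
  shows "\<exists>\<gamma>\<in>couplings (push fst \<psi>) (push snd (\<lambda>p. a * \<phi> (snd p))).
    quad_cost \<gamma> \<le> ennreal (transfer_const c2 D * E)"
proof -
  \<comment> \<open>The part of the weight carried along \<open>\<pi>\<close>, and the remainders on the two sides.\<close>
  define t where "t p = min a b * (\<phi> (snd p) * indicator G p)" for p
  have mab: "0 \<le> min a b" "min a b \<le> 3 / 2" using a_bounds b_bounds by auto
  have t0: "0 \<le> t p" for p using mab \<phi>_nonneg by (auto simp: t_def indicator_def)
  have ti: "integrable \<pi> t" unfolding t_def using \<phi>_integrable by auto
  have t1: "t p \<le> 3 / 2" for p
  proof -
    have "t p \<le> 3 / 2 * 1" unfolding t_def using mab \<phi>_nonneg \<phi>_le_1 by (intro mult_mono) (auto simp: indicator_def)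
    then show ?thesis by simp
  qed
  define R where "R p = \<psi> p - t p" for p
  define R' where "R' p = a * \<phi> (snd p) - t p" for p
  have R0: "0 \<le> R p" for p
    using mult_right_mono[of "min a b" b "\<phi> (snd p)"] \<phi>_nonneg[of "snd p"] \<phi>_nonneg[of "fst p"]
    by (auto simp: R_def \<psi>_def t_def indicator_def)
  have R'0: "0 \<le> R' p" for p
    using mult_right_mono[of "min a b" a "\<phi> (snd p)"] \<phi>_nonneg[of "snd p"] a_bounds
    by (auto simp: R'_def t_def indicator_def)
  have Ri: "integrable \<pi> R" "integrable \<pi> R'"
    unfolding R_def R'_def using \<psi>_integrable ti \<phi>_integrable by auto
  have RR': "(\<integral>p. R p \<partial>\<pi>) = (\<integral>p. R' p \<partial>\<pi>)"
    unfolding R_def R'_def using \<psi>_integrable ti \<phi>_integrable \<psi>_mass a_mass by simp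
  let ?C = "4 * c2 + 72 * c2\<^sup>2 / D"
  have C: "4 * c2 \<le> ?C" "9 * c2 * a \<le> ?C"
  proof -
    have "9 * c2 * a \<le> 9 * c2 * (8 * c2 / D)" using c2 a_bounds by (intro mult_left_mono) auto
    also have "\<dots> = 72 * c2\<^sup>2 / D" by (simp add: power2_eq_square)
    finally show "9 * c2 * a \<le> ?C" using c2 by linarith
    show "4 * c2 \<le> ?C" using c2 D by simp
  qed
  have Rmass: "(\<integral>p. R p \<partial>\<pi>) \<le> ?C * E"
  proof -
    have gi: "integrable \<pi> (\<lambda>p. ?C * (gap p)\<^sup>2)" using gap_sq by auto
    have ge: "(\<integral>p. ?C * (gap p)\<^sup>2 \<partial>\<pi>) = ?C * E" using gap_sq by simp
    have C0: "0 \<le> ?C * (gap p)\<^sup>2" for p :: "(real ^ 'n) \<times> (real ^ 'n)" using C(1) c2 by (intro mult_nonneg_nonneg) auto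
    show ?thesis
    proof (cases "a \<le> b")
      case True
      have "R' p \<le> ?C * (gap p)\<^sup>2" for p
      proof (cases "p \<in> G")
        case pG: True
        then have "R' p = 0" using True by (simp add: R'_def t_def)
        then show ?thesis using C0[of p] by simp
      next
        case False
        have "a * \<phi> (snd p) \<le> a * (9 * c2 * (gap p)\<^sup>2)" using off_G(3)[OF False] a_bounds by (intro mult_left_mono)
        also have "\<dots> = (9 * c2 * a) * (gap p)\<^sup>2" by simp
        also have "\<dots> \<le> ?C * (gap p)\<^sup>2" using C(2) by (intro mult_right_mono) auto
        finally show ?thesis using False by (simp add: R'_def t_def)
      qed
      then show ?thesis unfolding RR' ge[symmetric] by (intro integral_mono Ri gi)
    next
      case ab: False
      have "R p \<le> ?C * (gap p)\<^sup>2" for p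
      proof (cases "p \<in> G")
        case pG: True
        then have "R p = 0" using ab by (simp add: R_def t_def \<psi>_def)
        then show ?thesis using C0[of p] by simp
      next
        case False
        have "\<phi> (fst p) \<le> (4 * c2) * (gap p)\<^sup>2" using off_G(2)[OF False] by simp
        also have "\<dots> \<le> ?C * (gap p)\<^sup>2" using C(1) by (intro mult_right_mono) auto
        finally show ?thesis using False by (simp add: R_def t_def \<psi>_def)
      qed
      then show ?thesis unfolding ge[symmetric] by (intro integral_mono Ri gi)
    qed
  qed
  have \<phi>_supp: "dist z x \<le> r" if "0 < \<phi> x" for x
  proof -
    have "d x \<noteq> 0" using \<phi>_upper[of x] that by auto
    then show ?thesis by (simp add: depth_eq_0_iff)
  qed
  have m: "emeasure (push fst R) UNIV = ennreal (\<integral>p. R p \<partial>\<pi>)" "emeasure (push snd R') UNIV = ennreal (\<integral>p. R' p \<partial>\<pi>)"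
    using push_mass Ri R0 R'0 by auto
  have "AE x in push fst R. dist z x \<le> r"
  proof (subst AE_distr_iff)
    show "AE p in density \<pi> (\<lambda>p. ennreal (R p)). dist z (fst p) \<le> r"
    proof (subst AE_density)
      have "dist z (fst p) \<le> r" if "0 < R p" for p
      proof (cases "p \<in> G")
        case True
        then have "0 < d (fst p)" using norm_ge_zero[of "fst p - snd p"] unfolding G_def by (smt (verit) mem_Collect_eq)
        then have "d (fst p) \<noteq> 0" by simp
        then show ?thesis by (simp add: depth_eq_0_iff)
      next
        case False
        then show ?thesis using that by (intro \<phi>_supp) (simp add: R_def t_def \<psi>_def)
      qed
      then show "AE p in \<pi>. 0 < ennreal (R p) \<longrightarrow> dist z (fst p) \<le> r" by auto
    qed (use Ri in auto)
  qed (auto intro: closed_Collect_le continuous_intros)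
  moreover have "AE y in push snd R'. dist z y \<le> r"
  proof (subst AE_distr_iff)
    show "AE p in density \<pi> (\<lambda>p. ennreal (R' p)). dist z (snd p) \<le> r"
    proof (subst AE_density)
      have "dist z (snd p) \<le> r" if "0 < R' p" for p
      proof (rule \<phi>_supp)
        have "0 < a * \<phi> (snd p)" using that t0[of p] by (simp add: R'_def)
        then show "0 < \<phi> (snd p)" using a_bounds(1) by (simp add: zero_less_mult_iff)
      qed
      then show "AE p in \<pi>. 0 < ennreal (R' p) \<longrightarrow> dist z (snd p) \<le> r" by auto
    qed (use Ri in auto)
  qed (auto intro: closed_Collect_le continuous_intros)
  ultimately obtain \<gamma>1 where \<gamma>1: "\<gamma>1 \<in> couplings (push fst R) (push snd R')"
    "quad_cost \<gamma>1 \<le> ennreal (4 * r\<^sup>2) * ennreal (\<integral>p. R p \<partial>\<pi>)"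
    using equal_mass_coupling_in_ball[of "push fst R" "push snd R'" z r] m RR' by auto
  let ?\<gamma>2 = "distr (density \<pi> (\<lambda>p. ennreal (t p))) borel (\<lambda>p. (fst p, snd p))"
  have fm: "fst \<in> density \<pi> (\<lambda>p. ennreal (t p)) \<rightarrow>\<^sub>M borel" "snd \<in> density \<pi> (\<lambda>p. ennreal (t p)) \<rightarrow>\<^sub>M borel"
    by measurable
  have tm: "t \<in> borel_measurable \<pi>" using ti by auto
  have Rm: "R \<in> borel_measurable \<pi>" "R' \<in> borel_measurable \<pi>" using Ri by auto
  have \<gamma>2: "?\<gamma>2 \<in> couplings (push fst t) (push snd t)" by (rule distr_pair_in_couplings[OF fm])
  have "push fst \<psi> = add_measure (push fst t) (push fst R)"
    by (rule distr_density_add[OF tm Rm(1) _ t0 R0]) (auto simp: R_def)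
  moreover have "push snd (\<lambda>p. a * \<phi> (snd p)) = add_measure (push snd t) (push snd R')"
    by (rule distr_density_add[OF tm Rm(2) _ t0 R'0]) (auto simp: R'_def)
  ultimately have "add_measure ?\<gamma>2 \<gamma>1 \<in> couplings (push fst \<psi>) (push snd (\<lambda>p. a * \<phi> (snd p)))"
    using couplings_add[OF \<gamma>2 \<gamma>1(1)] by simp
  moreover have "quad_cost (add_measure ?\<gamma>2 \<gamma>1) \<le> ennreal (transfer_const c2 D * E)"
  proof -
    have "quad_cost ?\<gamma>2 = (\<integral>\<^sup>+p. ennreal ((gap p)\<^sup>2) \<partial>density \<pi> (\<lambda>p. ennreal (t p)))"
      by (rule quad_cost_distr_pair[OF fm])
    also have "\<dots> = (\<integral>\<^sup>+p. ennreal (t p) * ennreal ((gap p)\<^sup>2) \<partial>\<pi>)"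
      using tm by (intro nn_integral_density) auto
    also have "\<dots> \<le> (\<integral>\<^sup>+p. ennreal (3 / 2) * ennreal ((gap p)\<^sup>2) \<partial>\<pi>)"
      by (intro nn_integral_mono mult_right_mono ennreal_leI t1) auto
    also have "\<dots> = ennreal (3 / 2) * quad_cost \<pi>"
      unfolding quad_cost_def by (rule nn_integral_cmult) measurable
    also have "\<dots> = ennreal (3 / 2 * E)" unfolding cost using E by (intro ennreal_mult[symmetric]) auto
    finally have c2': "quad_cost ?\<gamma>2 \<le> ennreal (3 / 2 * E)" .
    have "quad_cost \<gamma>1 \<le> ennreal (4 * c2) * ennreal (?C * E)"
      using \<gamma>1(2) by (rule order_trans) (intro mult_mono ennreal_leI Rmass, use r in auto)
    also have "\<dots> = ennreal (4 * c2 * (?C * E))" using c2 by (intro ennreal_mult'[symmetric]) auto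
    finally have c1': "quad_cost \<gamma>1 \<le> ennreal (4 * c2 * (?C * E))" .
    have "quad_cost (add_measure ?\<gamma>2 \<gamma>1) = quad_cost ?\<gamma>2 + quad_cost \<gamma>1"
      by (rule quad_cost_add) (use couplingsD(1)[OF \<gamma>1(1)] in simp_all)
    also have "\<dots> \<le> ennreal (3 / 2 * E) + ennreal (4 * c2 * (?C * E))" by (intro add_mono c1' c2')
    also have "\<dots> = ennreal (3 / 2 * E + 4 * c2 * (?C * E))"
      using E c2 C(1) by (intro ennreal_plus[symmetric] mult_nonneg_nonneg) auto
    also have "3 / 2 * E + 4 * c2 * (?C * E) = transfer_const c2 D * E"
      by (simp add: transfer_const_def algebra_simps)
    finally show ?thesis .
  qed
  ultimately show ?thesis by blast
qed

lemma small_cost_coupling: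
  assumes e: "0 < e"
  shows "\<exists>\<gamma>\<in>couplings (push fst (\<lambda>p. \<phi> (fst p))) (push snd (\<lambda>p. a * \<phi> (snd p))).
    quad_cost \<gamma> \<le> ennreal ((18 * (move_const CARD('n) c2 c4 V * excess_const c2 D) + 3 * transfer_const c2 D) * E + e)"
proof -
  let ?k = "move_const CARD('n) c2 c4 V * excess_const c2 D * E"
  let ?t = "transfer_const c2 D * E"
  have k0: "0 \<le> ?k" using const_nonneg E by simp
  have t0: "0 \<le> ?t" using const_nonneg E by simp
  obtain \<gamma>1 where \<gamma>1: "\<gamma>1 \<in> couplings (push fst (\<lambda>p. \<phi> (fst p))) (push fst \<psi>)" "quad_cost \<gamma>1 \<le> ennreal (6 * ?k + e / 6)"
    using first_marginal_coupling[of "e / 6"] e by auto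
  obtain \<gamma>2 where \<gamma>2: "\<gamma>2 \<in> couplings (push fst \<psi>) (push snd (\<lambda>p. a * \<phi> (snd p)))" "quad_cost \<gamma>2 \<le> ennreal ?t"
    using second_marginal_coupling by auto
  have fin: "emeasure (push fst \<psi>) UNIV \<noteq> \<infinity>" using push_mass[of fst \<psi>] \<psi>_integrable \<psi>_nonneg by simp
  have "e / 2 > 0" using e by simp
  then obtain \<gamma> where \<gamma>: "\<gamma> \<in> couplings (push fst (\<lambda>p. \<phi> (fst p))) (push snd (\<lambda>p. a * \<phi> (snd p)))"
    "quad_cost \<gamma> \<le> 3 * (quad_cost \<gamma>1 + quad_cost \<gamma>2) + ennreal (e / 2)"
    using approximate_gluing[OF \<gamma>1(1) \<gamma>2(1) fin] by blast
  have "quad_cost \<gamma> \<le> 3 * (ennreal (6 * ?k + e / 6) + ennreal ?t) + ennreal (e / 2)"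
    using \<gamma>(2) by (rule order_trans) (intro add_mono mult_left_mono \<gamma>1 \<gamma>2, auto)
  also have "\<dots> = ennreal (3 * ((6 * ?k + e / 6) + ?t) + e / 2)" using k0 t0 e by (intro ennreal_glue_bound) auto
  also have "3 * ((6 * ?k + e / 6) + ?t) + e / 2 = (18 * (move_const CARD('n) c2 c4 V * excess_const c2 D) + 3 * transfer_const c2 D) * E + e"
    by (simp add: algebra_simps)
  finally show ?thesis using \<gamma>(1) by blast
qed

end

lemma wasserstein_2_eq:
  "wasserstein 2 \<sigma> \<tau> = (INF \<gamma>\<in>couplings \<sigma> \<tau>. enn_root 2 (quad_cost \<gamma>))"
proof -
  have "norm v powr 2 = (norm v)\<^sup>2" for v :: "real ^ 'n"
    by (cases "v = 0") (auto simp: powr_numeral)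
  then show ?thesis unfolding wasserstein_def quad_cost_def by (simp add: case_prod_unfold)
qed

lemma enn_root_2_ennreal: "0 \<le> K \<Longrightarrow> enn_root 2 (ennreal K) = ennreal (sqrt K)"
  by (simp add: enn_root_def powr_half_sqrt)

lemma wasserstein_2_le:
  assumes "\<gamma> \<in> couplings \<sigma> \<tau>" "quad_cost \<gamma> \<le> ennreal K" "0 \<le> K"
  shows "wasserstein 2 \<sigma> \<tau> \<le> ennreal (sqrt K)"
proof -
  obtain Q where Q: "quad_cost \<gamma> = ennreal Q" "0 \<le> Q" "Q \<le> K"
    using assms(2,3) by (cases "quad_cost \<gamma>") (auto simp: top_unique)
  have "wasserstein 2 \<sigma> \<tau> \<le> enn_root 2 (quad_cost \<gamma>)"
    unfolding wasserstein_2_eq using assms(1) by (rule INF_lower)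
  also have "\<dots> \<le> ennreal (sqrt K)" using Q by (simp add: enn_root_2_ennreal ennreal_leI)
  finally show ?thesis .
qed

lemma cutoff_plan_wasserstein:
  fixes \<pi> :: "((real ^ 'n) \<times> (real ^ 'n)) measure"
  assumes "cutoff_plan \<pi> \<phi> z r c2 c4 V D E"
  shows "wasserstein 2 (distr (density \<pi> (\<lambda>p. ennreal (\<phi> (fst p)))) borel fst)
      (distr (density \<pi> (\<lambda>p. ennreal ((\<integral>p. \<phi> (fst p) \<partial>\<pi>) / (\<integral>p. \<phi> (snd p) \<partial>\<pi>) * \<phi> (snd p)))) borel snd)
    \<le> ennreal (sqrt ((18 * (move_const CARD('n) c2 c4 V * excess_const c2 D) + 3 * transfer_const c2 D) * E))"
proof -
  interpret cutoff_plan \<pi> \<phi> z r c2 c4 V D E by (rule assms)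
  let ?K = "(18 * (move_const CARD('n) c2 c4 V * excess_const c2 D) + 3 * transfer_const c2 D) * E"
  let ?W = "wasserstein 2 (push fst (\<lambda>p. \<phi> (fst p))) (push snd (\<lambda>p. a * \<phi> (snd p)))"
  have K0: "0 \<le> ?K" using const_nonneg E by simp
  have "?W \<le> ennreal (sqrt ?K)"
  proof (rule ennreal_le_epsilon)
    fix e :: real assume e: "0 < e"
    obtain \<gamma> where \<gamma>: "\<gamma> \<in> couplings (push fst (\<lambda>p. \<phi> (fst p))) (push snd (\<lambda>p. a * \<phi> (snd p)))"
      "quad_cost \<gamma> \<le> ennreal (?K + e\<^sup>2)"
      using small_cost_coupling[of "e\<^sup>2"] e by auto
    have "?W \<le> ennreal (sqrt (?K + e\<^sup>2))"
      by (rule wasserstein_2_le[OF \<gamma>]) (use K0 in simp)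
    also have "\<dots> \<le> ennreal (sqrt ?K + e)"
      using sqrt_add_le_add_sqrt[OF K0, of "e\<^sup>2"] e by (intro ennreal_leI) simp
    also have "\<dots> = ennreal (sqrt ?K) + ennreal e" using K0 e by (intro ennreal_plus) auto
    finally show "?W \<le> ennreal (sqrt ?K) + ennreal e" .
  qed
  then show ?thesis unfolding a_def .
qed

section \<open>Increments of Lipschitz functions and radial cutoffs\<close>

lemma has_field_derivative_if_one_sided_quotients:
  fixes F :: "real \<Rightarrow> real"
  assumes r: "\<And>e. 0 < e \<Longrightarrow> \<exists>d>0. \<forall>k. 0 < k \<and> k < d \<longrightarrow> \<bar>(F (x + k) - F x) / k - D\<bar> < e"
    and l: "\<And>e. 0 < e \<Longrightarrow> \<exists>d>0. \<forall>k. 0 < k \<and> k < d \<longrightarrow> \<bar>(F x - F (x - k)) / k - D\<bar> < e"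
  shows "(F has_field_derivative D) (at x)"
  unfolding DERIV_def
proof (rule LIM_I)
  fix e :: real assume e: "0 < e"
  obtain d1 where d1: "d1 > 0" "\<And>k. 0 < k \<Longrightarrow> k < d1 \<Longrightarrow> \<bar>(F (x + k) - F x) / k - D\<bar> < e"
    using r[OF e] by blast
  obtain d2 where d2: "d2 > 0" "\<And>k. 0 < k \<Longrightarrow> k < d2 \<Longrightarrow> \<bar>(F x - F (x - k)) / k - D\<bar> < e"
    using l[OF e] by blast
  show "\<exists>s>0. \<forall>h. h \<noteq> 0 \<and> norm (h - 0) < s \<longrightarrow> norm ((F (x + h) - F x) / h - D) < e"
  proof (intro exI conjI allI impI)
    show "min d1 d2 > 0" using d1 d2 by simp
    fix h :: real assume h: "h \<noteq> 0 \<and> norm (h - 0) < min d1 d2"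
    show "norm ((F (x + h) - F x) / h - D) < e"
    proof (cases "h > 0")
      case True then show ?thesis using d1(2)[of h] h by simp
    next
      case False
      have "(F x - F (x - (- h))) / (- h) = (F (x + h) - F x) / h"
        using h by (simp add: divide_simps)
      then show ?thesis using d2(2)[of "- h"] h False by simp
    qed
  qed
qed

text \<open>
  The measures with distribution functions \<open>F\<close> and \<open>t - F t\<close> add up to Lebesgue measure, so the former is absolutely
  continuous and has a density \<open>h\<close>. Lebesgue differentiation is applied to \<open>h\<close> for the right difference
  quotients and to its reflection for the left ones.
\<close>
lemma monotone_lipschitz_derivative_AE:
  fixes F :: "real \<Rightarrow> real"
  assumes F: "\<And>s t. s \<le> t \<Longrightarrow> F s \<le> F t" and F': "\<And>s t. s \<le> t \<Longrightarrow> F t - F s \<le> t - s"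
  obtains h N where "\<And>x. 0 \<le> h x" "negligible N"
    "\<And>x. x \<notin> N \<Longrightarrow> (F has_field_derivative h x) (at x)"
    "\<And>s t. s \<le> t \<Longrightarrow> (h has_integral (F t - F s)) {s..t}"
proof -
  define F2 where "F2 t = t - F t" for t
  have F2: "F2 s \<le> F2 t" if "s \<le> t" for s t using F'[OF that] by (simp add: F2_def)
  have lip: "\<bar>F s - F t\<bar> \<le> \<bar>s - t\<bar>" for s t
    using F[of s t] F'[of s t] F[of t s] F'[of t s] by linarith
  have "1-lipschitz_on UNIV F" by (rule lipschitz_onI) (auto simp: dist_real_def lip)
  then have cF: "continuous_on UNIV F" by (rule lipschitz_on_continuous_on)
  then have cF2: "continuous_on UNIV F2" unfolding F2_def by (intro continuous_intros)
  define M1 where "M1 = interval_measure F"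
  define M2 where "M2 = interval_measure F2"
  have box: "emeasure (interval_measure H) {l<..<u} = ennreal (H u - H l)"
    if H: "\<And>s t. s \<le> t \<Longrightarrow> H s \<le> H t" and c: "continuous_on UNIV H" and lu: "l \<le> u" for H :: "real \<Rightarrow> real" and l u
  proof -
    have cu: "continuous_on S H" for S using c continuous_on_subset by blast
    have 1: "emeasure (interval_measure H) {l..u} = ennreal (H u - H l)"
      by (rule emeasure_interval_measure_Icc) (use H cu lu in auto)
    have 0: "emeasure (interval_measure H) {t} = 0" for t
      using emeasure_interval_measure_Icc[of t t H] H cu by auto
    have n: "{l, u} \<in> null_sets (interval_measure H)"
    proof -
      have "{l} \<union> {u} \<in> null_sets (interval_measure H)" by (intro null_sets.Un) (auto simp: 0 null_sets_def)
      then show ?thesis by (simp add: insert_commute)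
    qed
    have "{l<..<u} = {l..u} - {l, u}" using lu by auto
    then show ?thesis using emeasure_Diff_null_set[OF n, of "{l..u}"] 1 by simp
  qed
  have eq: "lborel = add_measure M1 M2"
  proof (rule lborel_eqI)
    fix l u :: real assume "\<And>b. b \<in> Basis \<Longrightarrow> l \<bullet> b \<le> u \<bullet> b"
    then have lu: "l \<le> u" by simp
    have "emeasure (add_measure M1 M2) {l<..<u} = ennreal (F u - F l) + ennreal (F2 u - F2 l)"
      using box[of F, OF F cF lu] box[of F2, OF F2 cF2 lu]
      by (simp add: emeasure_add_measure M1_def M2_def)
    also have "\<dots> = ennreal (u - l)"
      using F[OF lu] F2[OF lu] by (subst ennreal_plus[symmetric]) (auto simp: F2_def)
    finally show "emeasure (add_measure M1 M2) (box l u) = ennreal (\<Prod>b\<in>Basis. (u - l) \<bullet> b)" by simp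
  qed (simp add: M1_def)
  have sets1: "sets M1 = sets borel" "sets M2 = sets M1" by (simp_all add: M1_def M2_def)
  have ac: "absolutely_continuous lborel M1"
    unfolding absolutely_continuous_def
  proof
    fix A :: "real set" assume A: "A \<in> null_sets lborel"
    then have "A \<in> sets M1" "emeasure (add_measure M1 M2) A = 0"
      by (auto simp: null_sets_def sets1 eq[symmetric])
    then show "A \<in> null_sets M1" using sets1 by (auto simp: emeasure_add_measure null_sets_def)
  qed
  interpret S1: sigma_finite_measure M1
    unfolding M1_def by (rule sigma_finite_interval_measure) (use F cF in \<open>auto simp: continuous_on_eq_continuous_within intro: continuous_within_subset\<close>)
  define R where "R = RN_deriv lborel M1"
  have R: "density lborel R = M1" unfolding R_def
    by (rule sigma_finite_measure.density_RN_deriv[OF sigma_finite_lborel ac]) (simp add: sets1)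
  have Rm[measurable]: "R \<in> borel_measurable borel"
    using borel_measurable_RN_deriv[of lborel M1] by (simp add: R_def)
  have Rf: "AE x in lborel. R x \<noteq> \<infinity>" unfolding R_def
    by (rule sigma_finite_measure.RN_deriv_finite[OF sigma_finite_lborel _ ac]) (auto simp: sets1 S1.sigma_finite_measure_axioms)
  define h where "h x = enn2real (R x)" for x
  have hm[measurable]: "h \<in> borel_measurable borel" unfolding h_def by measurable
  have h0: "0 \<le> h x" for x by (simp add: h_def)
  have hi: "(h has_integral (F t - F s)) {s..t}" if st: "s \<le> t" for s t
  proof -
    have "(\<integral>\<^sup>+x. ennreal (h x * indicator {s..t} x) \<partial>lborel) = (\<integral>\<^sup>+x. R x * indicator {s..t} x \<partial>lborel)"
      using Rf by (intro nn_integral_cong_AE) (auto simp: h_def less_top indicator_def elim!: eventually_mono)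
    also have "\<dots> = emeasure (density lborel R) {s..t}" by (simp add: emeasure_density)
    also have "\<dots> = ennreal (F t - F s)"
      unfolding R M1_def by (rule emeasure_interval_measure_Icc) (use F cF st continuous_on_subset in auto)
    finally have "((\<lambda>x. h x * indicator {s..t} x) has_integral (F t - F s)) UNIV"
      using F[OF st] h0 by (intro nn_integral_has_integral) auto
    then have "((\<lambda>x. if x \<in> {s..t} then h x else 0) has_integral (F t - F s)) UNIV"
      by (rule has_integral_eq[rotated]) (auto simp: indicator_def)
    then show ?thesis by (simp only: has_integral_restrict_UNIV)
  qed
  have hio: "h integrable_on cbox s t" for s t
    using hi[of s t] by (cases "s \<le> t") (auto simp: integrable_on_def)
  obtain N1 where N1: "negligible N1" "\<And>x e. \<lbrakk>x \<notin> N1; 0 < e\<rbrakk> \<Longrightarrow> \<exists>d>0. \<forall>k. 0 < k \<and> k < d \<longrightarrow>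
      norm (integral (cbox x (x + k *\<^sub>R One)) h /\<^sub>R k ^ DIM(real) - h x) < e"
    using integrable_ccontinuous_explicit[of h] hio by blast
  have "(\<lambda>x. h (- x)) integrable_on cbox s t" for s t :: real
    using hio[of "-t" "-s"] integrable_reflect[where f = h and a = "-t" and b = "-s"] by simp
  then obtain N2 where N2: "negligible N2" "\<And>x e. \<lbrakk>x \<notin> N2; 0 < e\<rbrakk> \<Longrightarrow> \<exists>d>0. \<forall>k. 0 < k \<and> k < d \<longrightarrow>
      norm (integral (cbox x (x + k *\<^sub>R One)) (\<lambda>x. h (- x)) /\<^sub>R k ^ DIM(real) - h (- x)) < e"
    using integrable_ccontinuous_explicit[of "\<lambda>x. h (- x)"] by blast
  show ?thesis
  proof
    show "negligible (N1 \<union> uminus ` N2)"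
      using N1(1) N2(1)
      by (intro negligible_Un negligible_differentiable_image_negligible)
        (auto intro!: differentiable_on_minus differentiable_on_ident)
    fix x assume x: "x \<notin> N1 \<union> uminus ` N2"
    then have x1: "x \<notin> N1" and x2: "- x \<notin> N2" by (auto simp: image_iff)
    show "(F has_field_derivative h x) (at x)"
    proof (rule has_field_derivative_if_one_sided_quotients)
      fix e :: real assume e: "0 < e"
      let ?I = "\<lambda>k. integral (cbox x (x + k *\<^sub>R One)) h"
      have I: "?I k = F (x + k) - F x" if "k > 0" for k
        using hi[of x "x + k"] that by (auto simp: integral_unique)
      show "\<exists>d>0. \<forall>k. 0 < k \<and> k < d \<longrightarrow> \<bar>(F (x + k) - F x) / k - h x\<bar> < e"
      proof -
        obtain d where "d > 0" and d: "\<And>k. 0 < k \<Longrightarrow> k < d \<Longrightarrow> norm (?I k /\<^sub>R k ^ DIM(real) - h x) < e"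
          using N1(2)[OF x1 e] by auto
        then show ?thesis using I by (intro exI[of _ d]) (auto simp: divide_inverse_commute)
      qed
      let ?I = "\<lambda>k. integral (cbox (-x) (-x + k *\<^sub>R One)) (\<lambda>x. h (- x))"
      have I: "?I k = F x - F (x - k)" if "k > 0" for k
        using hi[of "x - k" "x"] integral_reflect[where f = h and a = "x - k" and b = x] that by (auto simp: integral_unique)
      show "\<exists>d>0. \<forall>k. 0 < k \<and> k < d \<longrightarrow> \<bar>(F x - F (x - k)) / k - h x\<bar> < e"
      proof -
        obtain d where "d > 0" and d: "\<And>k. 0 < k \<Longrightarrow> k < d \<Longrightarrow> norm (?I k /\<^sub>R k ^ DIM(real) - h x) < e"
          using N2(2)[OF x2 e] by auto
        then show ?thesis using I by (intro exI[of _ d]) (auto simp: divide_inverse_commute)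
      qed
    qed
  qed (use h0 hi in auto)
qed

text \<open>
  A Lipschitz function is the integral of its almost everywhere derivative, so a bound for the derivative at the
  points of differentiability is enough.
\<close>
lemma lipschitz_increment_bound:
  fixes g :: "real \<Rightarrow> real"
  assumes L: "L-lipschitz_on UNIV g" and ab: "a \<le> b"
    and K: "\<And>t D. a < t \<Longrightarrow> t < b \<Longrightarrow> (g has_field_derivative D) (at t) \<Longrightarrow> D \<le> K"
  shows "g b - g a \<le> K * (b - a)"
proof -
  define L' where "L' = max L 1"
  have L': "L' > 0" by (simp add: L'_def)
  have lip: "\<bar>g s - g t\<bar> \<le> L' * \<bar>s - t\<bar>" for s t
  proof -
    have "\<bar>g s - g t\<bar> \<le> L * \<bar>s - t\<bar>" using lipschitz_onD[OF L, of s t] by (simp add: dist_real_def)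
    also have "\<dots> \<le> L' * \<bar>s - t\<bar>" by (intro mult_right_mono) (auto simp: L'_def)
    finally show ?thesis .
  qed
  \<comment> \<open>Increasing with slopes at most 1.\<close>
  define F where "F t = (t + g t / L') / 2" for t
  have lip': "\<bar>g t / L' - g s / L'\<bar> \<le> t - s" if "s \<le> t" for s t
    using lip[of t s] that L' by (simp add: diff_divide_distrib[symmetric] abs_divide divide_simps mult.commute)
  have "F s \<le> F t" "F t - F s \<le> t - s" if "s \<le> t" for s t
    using lip'[OF that] unfolding F_def by (argo, argo)
  then obtain h N where h: "\<And>x. 0 \<le> h x" and N: "negligible N"
    and D: "\<And>x. x \<notin> N \<Longrightarrow> (F has_field_derivative h x) (at x)"
    and I: "\<And>s t. s \<le> t \<Longrightarrow> (h has_integral (F t - F s)) {s..t}"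
    using monotone_lipschitz_derivative_AE[of F] by metis
  have g: "g = (\<lambda>t. L' * (2 * F t - t))" using L' by (auto simp: F_def fun_eq_iff field_simps)
  have hK: "h x \<le> (1 + K / L') / 2" if "x \<notin> N" "a < x" "x < b" for x
  proof -
    have "(g has_field_derivative (L' * (2 * h x - 1))) (at x)"
      unfolding g using D[OF that(1)] by (auto intro!: derivative_eq_intros)
    then have "L' * (2 * h x - 1) \<le> K" by (rule K[OF that(2,3)])
    then show ?thesis using L' by (simp add: field_simps)
  qed
  have "F b - F a \<le> ((1 + K / L') / 2) * (b - a)"
  proof (rule has_integral_le)
    let ?k = "(1 + K / L') / 2"
    show "((\<lambda>x. if x \<in> N \<union> {a, b} then ?k else h x) has_integral F b - F a) {a..b}"
      by (rule has_integral_spike[where S = "N \<union> {a, b}" and f = h]) (use N I[OF ab] in auto)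
    show "((\<lambda>_. ?k) has_integral ?k * (b - a)) {a..b}"
      using has_integral_const_real[of ?k a b] ab by (simp add: mult.commute)
  qed (use hK in auto)
  then have "L' * (2 * (F b - F a) - (b - a)) \<le> L' * (2 * (((1 + K / L') / 2) * (b - a)) - (b - a))"
    using L' by (intro mult_left_mono diff_right_mono) (assumption | simp)+
  moreover have "g b - g a = L' * (2 * (F b - F a) - (b - a))"
    using fun_cong[OF g, of a] fun_cong[OF g, of b] by (simp only: right_diff_distrib)
  ultimately have "g b - g a \<le> L' * (2 * (((1 + K / L') / 2) * (b - a)) - (b - a))" by simp
  also have "\<dots> = K * (b - a)" using L' by (simp add: field_simps)
  finally show ?thesis .
qed

lemma infdist_frontier_cball:
  fixes x z :: "real ^ 'n"
  assumes r: "0 < r" and x: "x \<in> cball z r"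
  shows "infdist x (frontier (cball z r)) = depth z r x"
proof -
  have fr: "frontier (cball z r) = sphere z r" using r by simp
  obtain e :: "real ^ 'n" where e: "norm e = 1" using norm_axis_1 by blast
  define u where "u = (if x = z then e else (1 / dist z x) *\<^sub>R (x - z))"
  have u: "norm u = 1" using e by (auto simp: u_def dist_norm norm_minus_commute)
  have xu: "x = z + dist z x *\<^sub>R u" by (simp add: u_def)
  have w: "z + r *\<^sub>R u \<in> sphere z r" using r u by (simp add: dist_norm)
  have "x - (z + r *\<^sub>R u) = (dist z x - r) *\<^sub>R u" by (subst (1) xu) (simp add: algebra_simps)
  then have "dist x (z + r *\<^sub>R u) = depth z r x"
    using u x by (simp add: dist_norm[of x] depth_def)
  then have "infdist x (sphere z r) \<le> depth z r x" using infdist_le2[OF w] by simp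
  moreover have "depth z r x \<le> infdist x (sphere z r)"
  proof -
    have ne: "sphere z r \<noteq> {}" using w by blast
    show ?thesis unfolding infdist_notempty[OF ne]
    proof (rule cINF_greatest[OF ne])
      fix y assume "y \<in> sphere z r"
      then have "r \<le> dist z x + dist x y" using dist_triangle[of z y x] by simp
      then show "depth z r x \<le> dist x y" using x by (simp add: depth_def)
    qed
  qed
  ultimately show ?thesis unfolding fr by simp
qed

text \<open>
  The profile \<open>g\<close> of \<open>\<phi>\<close> along a ray is Lipschitz, and where it is differentiable away from 0, \<open>\<phi>\<close> has a gradient of the same
  length. Between two radii the gradient bound is largest at the smaller radius, that is, at the point of larger depth.
\<close>
lemma radial_cutoff_increment:
  fixes \<phi> :: "real ^ 'n \<Rightarrow> real"
  assumes rad: "radial_about z \<phi>" and lip: "L-lipschitz_on UNIV \<phi>"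
    and supp: "\<And>x. x \<notin> cball z r \<Longrightarrow> \<phi> x = 0" and c2: "0 < c2"
    and grad: "\<And>x D. x \<in> cball z r \<Longrightarrow> GDERIV \<phi> x :> D \<Longrightarrow> norm D \<le> c2 * depth z r x"
  shows "\<bar>\<phi> x - \<phi> y\<bar> \<le> c2 * max (depth z r x) (depth z r y) * norm (x - y)"
proof -
  obtain e :: "real ^ 'n" where e: "norm e = 1" using norm_axis_1 by blast
  define g where "g t = \<phi> (z + t *\<^sub>R e)" for t
  have g: "\<phi> x = g (dist z x)" for x
  proof -
    obtain h where h: "\<And>x. \<phi> x = h (dist z x)" using rad unfolding radial_about_def by blast
    show ?thesis unfolding g_def h using e by (simp add: dist_norm)
  qed
  have gL: "L-lipschitz_on UNIV g"
  proof (rule lipschitz_onI)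
    show "0 \<le> L" using lip by (rule lipschitz_on_nonneg)
    fix s t :: real
    have "dist (z + s *\<^sub>R e) (z + t *\<^sub>R e) = dist s t"
      using e by (simp add: dist_norm scaleR_left_diff_distrib[symmetric])
    then show "dist (g s) (g t) \<le> L * dist s t"
      unfolding g_def using lipschitz_onD[OF lip, of "z + s *\<^sub>R e" "z + t *\<^sub>R e"] by simp
  qed
  have slope: "\<bar>D\<bar> \<le> c2 * max 0 (r - s)"
    if s: "0 \<le> s" and t: "s < t" and D: "(g has_field_derivative D) (at t)" for s t D
  proof (cases "t \<le> r")
    case True
    let ?x = "z + t *\<^sub>R e"
    have t0: "0 < t" and e0: "e \<noteq> 0" using s t e by auto
    have dx: "dist z ?x = t" using e t0 by (simp add: dist_norm)
    have shift: "((\<lambda>y. y - z) has_derivative (\<lambda>h. h)) (at ?x)"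
      by (auto intro!: derivative_eq_intros)
    have "GDERIV norm (?x - z) :> sgn (?x - z)" using t0 e0 by (intro GDERIV_norm) auto
    then have "((\<lambda>y. norm (y - z)) has_derivative (\<lambda>h. inner h (sgn (?x - z)))) (at ?x)"
      unfolding gderiv_def by (rule has_derivative_compose[OF shift])
    then have "GDERIV (\<lambda>y. norm (y - z)) ?x :> sgn (?x - z)" by (simp add: gderiv_def)
    moreover have "(g has_field_derivative D) (at (norm (?x - z)))" using D e t0 by simp
    ultimately have "GDERIV (\<lambda>y. g (norm (y - z))) ?x :> D *\<^sub>R sgn (?x - z)"
      by (rule GDERIV_DERIV_compose)
    moreover have "(\<lambda>y. g (norm (y - z))) = \<phi>" by (auto simp: g fun_eq_iff dist_norm norm_minus_commute)
    ultimately have "norm (D *\<^sub>R sgn (?x - z)) \<le> c2 * depth z r ?x"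
      using True dx by (intro grad) auto
    moreover have "norm (sgn (?x - z)) = 1" using t0 e0 by (simp add: norm_sgn)
    ultimately have "\<bar>D\<bar> \<le> c2 * max 0 (r - t)" by (simp add: depth_def dx)
    also have "\<dots> \<le> c2 * max 0 (r - s)" using c2 t by (intro mult_left_mono) auto
    finally show ?thesis .
  next
    case False
    have "(g has_field_derivative 0) (at t)"
    proof (rule has_field_derivative_transform_within_open[of "\<lambda>_. 0"])
      show "open {r<..}" "t \<in> {r<..}" using False by auto
      fix u assume u: "u \<in> {r<..}"
      have "z + u *\<^sub>R e \<notin> cball z r" using u e by (auto simp: dist_norm)
      then show "0 = g u" unfolding g_def by (rule supp[symmetric])
    qed simp
    then have "D = 0" using D DERIV_unique by blast
    then show ?thesis using c2 by simp
  qed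
  have ordered: "\<bar>\<phi> x - \<phi> y\<bar> \<le> c2 * max (depth z r x) (depth z r y) * norm (x - y)"
    if le: "dist z x \<le> dist z y" for x y
  proof -
    let ?K = "c2 * max 0 (r - dist z x)"
    have "g (dist z y) - g (dist z x) \<le> ?K * (dist z y - dist z x)"
      by (rule lipschitz_increment_bound[OF gL le]) (use slope[of "dist z x"] in force)
    moreover have "- g (dist z y) - - g (dist z x) \<le> ?K * (dist z y - dist z x)"
    proof (rule lipschitz_increment_bound[OF _ le])
      show "L-lipschitz_on UNIV (\<lambda>t. - g t)" using gL by (rule lipschitz_on_minus)
      fix t D assume t: "dist z x < t" and D: "((\<lambda>t. - g t) has_field_derivative D) (at t)"
      have "(g has_field_derivative - D) (at t)" using DERIV_minus[OF D] by simp
      then show "D \<le> ?K" using slope[of "dist z x" t "- D"] t by simp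
    qed
    ultimately have "\<bar>\<phi> x - \<phi> y\<bar> \<le> ?K * (dist z y - dist z x)" unfolding g[of x] g[of y] by simp
    also have "\<dots> \<le> (c2 * max (depth z r x) (depth z r y)) * norm (x - y)"
    proof (rule mult_mono)
      show "?K \<le> c2 * max (depth z r x) (depth z r y)" using c2 by (intro mult_left_mono) (auto simp: depth_def)
      show "dist z y - dist z x \<le> norm (x - y)" using dist_triangle[of z y x] by (simp add: dist_norm[symmetric])
      show "0 \<le> c2 * max (depth z r x) (depth z r y)" using c2 by (auto simp: le_max_iff_disj)
      show "0 \<le> dist z y - dist z x" using le by simp
    qed
    finally show ?thesis .
  qed
  show ?thesis
  proof (cases "dist z x \<le> dist z y")
    case True then show ?thesis by (rule ordered)
  next
    case False
    then show ?thesis using ordered[of y x] by (simp add: max.commute norm_minus_commute abs_minus_commute)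
  qed
qed

section \<open>The estimate for cut-off measures\<close>

text \<open>
  The density on the ball enters the argument through integrals over the ball.
\<close>
lemma density_ball_law:
  fixes \<mu> :: "(real ^ 'n) measure"
  assumes [measurable_cong]: "sets \<mu> = sets borel" and [measurable]: "f \<in> borel_measurable borel"
    and dens: "density \<mu> (indicator B) = density lborel (\<lambda>x. ennreal (f x))"
    and B[measurable]: "B \<in> sets borel" and [measurable]: "g \<in> borel_measurable borel"
  shows "(\<integral>\<^sup>+x. g x * indicator B x \<partial>\<mu>) = (\<integral>\<^sup>+x. g x * indicator B x * ennreal (f x) \<partial>lborel)"
proof -
  have "(\<integral>\<^sup>+x. g x * indicator B x \<partial>\<mu>) = (\<integral>\<^sup>+x. indicator B x * (g x * indicator B x) \<partial>\<mu>)"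
    by (intro nn_integral_cong) (auto simp: indicator_def)
  also have "\<dots> = (\<integral>\<^sup>+x. g x * indicator B x \<partial>density \<mu> (indicator B))"
    by (rule nn_integral_density[symmetric]) measurable
  also have "\<dots> = (\<integral>\<^sup>+x. ennreal (f x) * (g x * indicator B x) \<partial>lborel)"
    unfolding dens by (rule nn_integral_density) measurable
  finally show ?thesis by (simp add: mult_ac)
qed

lemma density_ball_law_upper:
  fixes \<mu> :: "(real ^ 'n) measure"
  assumes s: "sets \<mu> = sets borel" and f: "f \<in> borel_measurable borel"
    and dens: "density \<mu> (indicator B) = density lborel (\<lambda>x. ennreal (f x))"
    and B: "B \<in> sets borel" and g: "g \<in> borel_measurable borel" and c: "0 \<le> c"
    and up: "AE x in lborel. x \<in> B \<longrightarrow> f x \<le> c"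
  shows "(\<integral>\<^sup>+x. g x * indicator B x \<partial>\<mu>) \<le> ennreal c * (\<integral>\<^sup>+x. g x * indicator B x \<partial>lborel)"
proof -
  have "(\<integral>\<^sup>+x. g x * indicator B x * ennreal (f x) \<partial>lborel) \<le> (\<integral>\<^sup>+x. ennreal c * (g x * indicator B x) \<partial>lborel)"
    using up
  proof (intro nn_integral_mono_AE, eventually_elim)
    fix x assume "x \<in> B \<longrightarrow> f x \<le> c"
    then show "g x * indicator B x * ennreal (f x) \<le> ennreal c * (g x * indicator B x)"
      by (cases "x \<in> B") (simp_all add: mult.commute[of _ "g x"] mult_left_mono ennreal_leI)
  qed
  then show ?thesis unfolding density_ball_law[OF s f dens B g]
    using g B by (subst nn_integral_cmult[symmetric]) auto
qed

lemma density_ball_law_lower: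
  fixes \<mu> :: "(real ^ 'n) measure"
  assumes s: "sets \<mu> = sets borel" and f: "f \<in> borel_measurable borel"
    and dens: "density \<mu> (indicator B) = density lborel (\<lambda>x. ennreal (f x))"
    and B: "B \<in> sets borel" and g: "g \<in> borel_measurable borel" and c: "0 \<le> c"
    and low: "AE x in lborel. x \<in> B \<longrightarrow> 1 \<le> c * f x"
  shows "(\<integral>\<^sup>+x. g x * indicator B x \<partial>lborel) \<le> ennreal c * (\<integral>\<^sup>+x. g x * indicator B x \<partial>\<mu>)"
proof -
  have "(\<integral>\<^sup>+x. g x * indicator B x \<partial>lborel) \<le> (\<integral>\<^sup>+x. ennreal c * (g x * indicator B x * ennreal (f x)) \<partial>lborel)"
    using low
  proof (intro nn_integral_mono_AE, eventually_elim)
    fix x assume h: "x \<in> B \<longrightarrow> 1 \<le> c * f x"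
    show "g x * indicator B x \<le> ennreal c * (g x * indicator B x * ennreal (f x))"
    proof (cases "x \<in> B")
      case True
      have "ennreal 1 \<le> ennreal (c * f x)" using h True by (intro ennreal_leI) auto
      then have "g x * 1 \<le> g x * (ennreal c * ennreal (f x))"
        using c by (intro mult_left_mono) (auto simp: ennreal_mult')
      then show ?thesis using True by (simp add: mult_ac)
    qed simp
  qed
  also have "\<dots> = ennreal c * (\<integral>\<^sup>+x. g x * indicator B x * ennreal (f x) \<partial>lborel)"
    using f g B by (intro nn_integral_cmult) auto
  finally show ?thesis unfolding density_ball_law[OF s f dens B g] .
qed

text \<open>
  The crude bound, for plans whose cost is bounded below.
\<close>
lemma bounded_support_wasserstein:
  fixes \<mu> \<nu> :: "(real ^ 'n) measure"
  assumes s: "sets \<mu> = sets borel" "sets \<nu> = sets borel" and P: "prob_space \<mu>" "prob_space \<nu>"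
    and [measurable]: "\<phi> \<in> borel_measurable borel" and \<phi>: "\<And>x. 0 \<le> \<phi> x" "\<And>x. \<phi> x \<le> 1"
    and supp: "\<And>x. x \<notin> cball z r \<Longrightarrow> \<phi> x = 0" and pos: "(\<integral>x. \<phi> x \<partial>\<nu>) \<noteq> 0"
  shows "wasserstein 2 (density \<mu> (\<lambda>x. ennreal (\<phi> x)))
     (density \<nu> (\<lambda>x. ennreal ((\<integral>x. \<phi> x \<partial>\<mu>) / (\<integral>x. \<phi> x \<partial>\<nu>) * \<phi> x))) \<le> ennreal (sqrt (4 * r\<^sup>2))"
proof -
  interpret \<mu>: prob_space \<mu> by (rule P)
  interpret \<nu>: prob_space \<nu> by (rule P)
  note [measurable_cong] = s
  let ?a = "(\<integral>x. \<phi> x \<partial>\<mu>) / (\<integral>x. \<phi> x \<partial>\<nu>)"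
  have i: "integrable \<mu> \<phi>" "integrable \<nu> \<phi>"
    using \<phi> by (auto intro!: \<mu>.integrable_const_bound[where B = 1] \<nu>.integrable_const_bound[where B = 1])
  have n: "0 \<le> (\<integral>x. \<phi> x \<partial>\<mu>)" "0 \<le> (\<integral>x. \<phi> x \<partial>\<nu>)" using \<phi> by (auto intro!: integral_nonneg_AE)
  have le1: "(\<integral>x. \<phi> x \<partial>\<mu>) \<le> 1"
    using \<mu>.integral_le_const[OF i(1), of 1] \<phi> by simp
  have a0: "0 \<le> ?a" using n by simp
  have U: "UNIV \<in> sets \<mu>" "UNIV \<in> sets \<nu>" using s by auto
  have m1: "emeasure (density \<mu> (\<lambda>x. ennreal (\<phi> x))) UNIV = ennreal (\<integral>x. \<phi> x \<partial>\<mu>)"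
    using i \<phi> U by (simp add: emeasure_density nn_integral_eq_integral)
  have m2: "emeasure (density \<nu> (\<lambda>x. ennreal (?a * \<phi> x))) UNIV = ennreal (\<integral>x. \<phi> x \<partial>\<mu>)"
  proof -
    have "emeasure (density \<nu> (\<lambda>x. ennreal (?a * \<phi> x))) UNIV = (\<integral>\<^sup>+x. ennreal (?a * \<phi> x) \<partial>\<nu>)"
      using U by (simp add: emeasure_density)
    also have "\<dots> = ennreal (\<integral>x. ?a * \<phi> x \<partial>\<nu>)"
      using i a0 \<phi> by (intro nn_integral_eq_integral) (auto intro!: AE_I2 mult_nonneg_nonneg)
    also have "(\<integral>x. ?a * \<phi> x \<partial>\<nu>) = (\<integral>x. \<phi> x \<partial>\<mu>)" using pos by simp
    finally show ?thesis .
  qed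
  have c: "dist z x \<le> r" if "\<phi> x \<noteq> 0" for x using supp[of x] that by (auto simp: mem_cball)
  have A1: "AE x in density \<mu> (\<lambda>x. ennreal (\<phi> x)). dist z x \<le> r"
    by (subst AE_density) (auto intro!: AE_I2 c)
  have A2: "AE x in density \<nu> (\<lambda>x. ennreal (?a * \<phi> x)). dist z x \<le> r"
  proof (subst AE_density)
    have "0 < ennreal (?a * \<phi> x) \<longrightarrow> dist z x \<le> r" for x
      using c[of x] by (cases "\<phi> x = 0") auto
    then show "AE x in \<nu>. 0 < ennreal (?a * \<phi> x) \<longrightarrow> dist z x \<le> r" by (rule AE_I2)
  qed simp
  obtain \<gamma> where \<gamma>: "\<gamma> \<in> couplings (density \<mu> (\<lambda>x. ennreal (\<phi> x))) (density \<nu> (\<lambda>x. ennreal (?a * \<phi> x)))"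
    "quad_cost \<gamma> \<le> ennreal (4 * r\<^sup>2) * ennreal (\<integral>x. \<phi> x \<partial>\<mu>)"
    using equal_mass_coupling_in_ball[of "density \<mu> (\<lambda>x. ennreal (\<phi> x))" "density \<nu> (\<lambda>x. ennreal (?a * \<phi> x))" z r]
      m1 m2 A1 A2 s by auto
  have "ennreal (4 * r\<^sup>2) * ennreal (\<integral>x. \<phi> x \<partial>\<mu>) \<le> ennreal (4 * r\<^sup>2) * ennreal 1"
    using le1 by (intro mult_left_mono ennreal_leI) auto
  then have "quad_cost \<gamma> \<le> ennreal (4 * r\<^sup>2)" using \<gamma>(2) by (simp add: order_trans)
  then show ?thesis by (intro wasserstein_2_le[OF \<gamma>(1)]) auto
qed

theorem theorem1p1:
  fixes c2 c3 c4 :: real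
  assumes "c2 > 0" and "c3 > 0" and "c4 > 0"
  shows "\<exists>c::real. c > 0 \<and>
    (\<forall>(\<mu> :: (real ^ 'n) measure) (\<nu> :: (real ^ 'n) measure) (z :: real ^ 'n) (r :: real)
      (B :: (real ^ 'n) set) (f :: real ^ 'n \<Rightarrow> real) (\<phi> :: real ^ 'n \<Rightarrow> real) (a :: real).
      borel_prob_second_moment \<mu> \<longrightarrow>
      borel_prob_second_moment \<nu> \<longrightarrow>
      B = cball z r \<longrightarrow>
      r \<ge> inverse c3 \<longrightarrow>
      measure \<mu> (interior B) > 0 \<longrightarrow>
      measure \<nu> (interior B) > 0 \<longrightarrow>
      f \<in> borel_measurable borel \<longrightarrow>
      density \<mu> (indicator B) = density lborel (\<lambda>x. ennreal (f x)) \<longrightarrow>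
      (AE x in lborel. x \<in> B \<longrightarrow>
         inverse c4 * indicator B x \<le> f x \<and> f x \<le> c4 * indicator B x) \<longrightarrow>
      (\<forall>x. \<phi> x \<in> {0..1}) \<longrightarrow>
      radial_about z \<phi> \<longrightarrow>
      (\<exists>L. L-lipschitz_on UNIV \<phi>) \<longrightarrow>
      (\<forall>x. x \<notin> B \<longrightarrow> \<phi> x = 0) \<longrightarrow>
      (\<forall>x\<in>B. inverse c2 * (infdist x (frontier B))\<^sup>2 \<le> \<phi> x \<and>
              \<phi> x \<le> c2 * (infdist x (frontier B))\<^sup>2) \<longrightarrow>
      (\<forall>x\<in>B. \<forall>D. GDERIV \<phi> x :> D \<longrightarrow> norm D \<le> c2 * infdist x (frontier B)) \<longrightarrow>
      a = (\<integral>x. \<phi> x \<partial>\<mu>) / (\<integral>x. \<phi> x \<partial>\<nu>) \<longrightarrow>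
      wasserstein 2 (density \<mu> (\<lambda>x. ennreal (\<phi> x))) (density \<nu> (\<lambda>x. ennreal (a * \<phi> x)))
        \<le> ennreal c * wasserstein 2 \<mu> \<nu>)"
proof -
  note c2 = assms(1) and c3 = assms(2) and c4 = assms(3)
  \<comment> \<open>\<open>V\<close> bounds the volume of the half ball from below, and \<open>D\<close> the integral of the squared depth: the half ball
    has depth at least \<open>1 / (2 * c3)\<close>, and \<open>\<mu>\<close> has density at least \<open>1 / c4\<close> there.\<close>
  define V where "V = measure lborel (cball (0 :: real ^ 'n) (1 / (2 * c3)))"
  define D where "D = V / (4 * c3\<^sup>2 * c4)"
  define \<rho> where "\<rho> = ratio_const c2 D"
  \<comment> \<open>Below \<open>E0\<close> the assumptions of \<open>cutoff_plan\<close> hold; above it the crude bound \<open>4 * c2\<close> for the squared distance is at most \<open>K * E\<close>.\<close>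
  define E0 where "E0 = min (D / 8) (1 / (4 * \<rho>\<^sup>2))"
  define K1 where "K1 = 18 * (move_const CARD('n) c2 c4 V * excess_const c2 D) + 3 * transfer_const c2 D"
  define K where "K = max K1 (4 * c2 / E0)"
  have V: "0 < V" unfolding V_def using c3 by simp
  have D: "0 < D" unfolding D_def using V c3 c4 by simp
  have \<rho>: "0 < \<rho>" unfolding \<rho>_def ratio_const_def using c2 D by simp
  have E0: "0 < E0" unfolding E0_def using D \<rho> by simp
  have K: "0 < K" unfolding K_def using c2 E0 by (simp add: less_max_iff_disj)
  have main: "wasserstein 2 (density \<mu> (\<lambda>x. ennreal (\<phi> x))) (density \<nu> (\<lambda>x. ennreal (a * \<phi> x)))
        \<le> ennreal (sqrt K) * wasserstein 2 \<mu> \<nu>"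
    if \<mu>: "borel_prob_second_moment \<mu>" and \<nu>: "borel_prob_second_moment \<nu>"
      and B: "B = cball z r" and r: "r \<ge> inverse c3"
      and \<nu>B: "measure \<nu> (interior B) > 0"
      and f[measurable]: "f \<in> borel_measurable borel"
      and dens: "density \<mu> (indicator B) = density lborel (\<lambda>x. ennreal (f x))"
      and fb: "AE x in lborel. x \<in> B \<longrightarrow> inverse c4 * indicator B x \<le> f x \<and> f x \<le> c4 * indicator B x"
      and \<phi>01: "\<forall>x. \<phi> x \<in> {0..1}" and rad: "radial_about z \<phi>"
      and lip: "\<exists>L. L-lipschitz_on UNIV \<phi>" and supp: "\<forall>x. x \<notin> B \<longrightarrow> \<phi> x = 0"
      and \<phi>b: "\<forall>x\<in>B. inverse c2 * (infdist x (frontier B))\<^sup>2 \<le> \<phi> x \<and> \<phi> x \<le> c2 * (infdist x (frontier B))\<^sup>2"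
      and grad: "\<forall>x\<in>B. \<forall>D. GDERIV \<phi> x :> D \<longrightarrow> norm D \<le> c2 * infdist x (frontier B)"
      and a: "a = (\<integral>x. \<phi> x \<partial>\<mu>) / (\<integral>x. \<phi> x \<partial>\<nu>)"
    for \<mu> \<nu> :: "(real ^ 'n) measure" and z r B f \<phi> a
  proof -
    let ?W = "wasserstein 2 (density \<mu> (\<lambda>x. ennreal (\<phi> x))) (density \<nu> (\<lambda>x. ennreal (a * \<phi> x)))"
    have s: "sets \<mu> = sets borel" "sets \<nu> = sets borel" and P: "prob_space \<mu>" "prob_space \<nu>"
      using \<mu> \<nu> by (auto simp: borel_prob_second_moment_def)
    interpret \<mu>: prob_space \<mu> by (rule P)
    interpret \<nu>: prob_space \<nu> by (rule P)
    note [measurable_cong] = s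
    have r0: "0 < r" using r c3 by (meson less_le_trans positive_imp_inverse_positive)
    have Bm: "B \<in> sets borel" using B by simp
    obtain L where L: "L-lipschitz_on UNIV \<phi>" using lip by blast
    have \<phi>m[measurable]: "\<phi> \<in> borel_measurable borel"
      using lipschitz_on_continuous_on[OF L] by (rule borel_measurable_continuous_onI)
    have \<phi>0: "0 \<le> \<phi> x" and \<phi>1: "\<phi> x \<le> 1" for x using \<phi>01 by auto
    have inf: "infdist x (frontier B) = depth z r x" if "x \<in> B" for x
      using infdist_frontier_cball[OF r0] that B by simp
    have d0: "depth z r x = 0" if "x \<notin> B" for x using that B by (simp add: depth_def)
    have lower: "(depth z r x)\<^sup>2 \<le> c2 * \<phi> x" for x
    proof (cases "x \<in> B")
      case True
      then have "inverse c2 * (depth z r x)\<^sup>2 \<le> \<phi> x" using \<phi>b inf by auto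
      then show ?thesis using c2 by (simp add: field_simps)
    qed (simp add: d0 c2 \<phi>0 less_imp_le)
    have upper: "\<phi> x \<le> c2 * (depth z r x)\<^sup>2" for x
      using \<phi>b inf[of x] supp by (cases "x \<in> B") (auto simp: d0)
    have r2: "r\<^sup>2 \<le> c2"
    proof -
      have "r\<^sup>2 \<le> c2 * \<phi> z" using lower[of z] r0 by (simp add: depth_def)
      also have "\<dots> \<le> c2 * 1" using c2 \<phi>1 by (intro mult_left_mono) auto
      finally show ?thesis by simp
    qed
    have lips: "\<bar>\<phi> x - \<phi> y\<bar> \<le> c2 * max (depth z r x) (depth z r y) * norm (x - y)" for x y
      by (rule radial_cutoff_increment[OF rad L _ c2]) (use supp grad inf B in auto)
    have r3: "1 / (2 * c3) \<le> r / 2" using r c3 by (simp add: field_simps)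
    have Vr: "V \<le> measure lborel (cball z (r / 2))"
      unfolding V_def using r3 c3 r0
      by (simp add: content_cball mult_left_mono power_mono)
    have up: "AE x in lborel. x \<in> B \<longrightarrow> f x \<le> c4" using fb by eventually_elim auto
    have low: "AE x in lborel. x \<in> B \<longrightarrow> 1 \<le> c4 * f x"
      using fb
    proof eventually_elim
      fix x assume h: "x \<in> B \<longrightarrow> inverse c4 * indicator B x \<le> f x \<and> f x \<le> c4 * indicator B x"
      show "x \<in> B \<longrightarrow> 1 \<le> c4 * f x"
      proof
        assume "x \<in> B"
        then have "c4 * inverse c4 \<le> c4 * f x" using h c4 by (intro mult_left_mono) auto
        then show "1 \<le> c4 * f x" using c4 by simp
      qed
    qed
    note law_up = density_ball_law_upper[OF s(1) f dens Bm _ less_imp_le[OF c4] up]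
    note law_low = density_ball_law_lower[OF s(1) f dens Bm _ less_imp_le[OF c4] low]
    have \<mu>D: "D \<le> (\<integral>x. (depth z r x)\<^sup>2 \<partial>\<mu>)"
    proof -
      have di: "integrable \<mu> (\<lambda>x. (depth z r x)\<^sup>2)"
        using r0 by (intro \<mu>.integrable_const_bound[where B = "r\<^sup>2"]) (auto intro!: power_mono depth_le_radius)
      have "ennreal (1 / (4 * c3\<^sup>2) * V) \<le> ennreal ((r / 2)\<^sup>2) * emeasure lborel (cball z (r / 2))"
      proof -
        have "(1 / (2 * c3))\<^sup>2 \<le> (r / 2)\<^sup>2" using r3 c3 by (intro power_mono) auto
        then have "1 / (4 * c3\<^sup>2) * V \<le> (r / 2)\<^sup>2 * measure lborel (cball z (r / 2))"
          using Vr V by (intro mult_mono) (auto simp: power_divide power_mult_distrib)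
        then have "ennreal (1 / (4 * c3\<^sup>2) * V) \<le> ennreal ((r / 2)\<^sup>2 * measure lborel (cball z (r / 2)))"
          by (rule ennreal_leI)
        also have "\<dots> = ennreal ((r / 2)\<^sup>2) * ennreal (measure lborel (cball z (r / 2)))"
          by (rule ennreal_mult) auto
        also have "ennreal (measure lborel (cball z (r / 2))) = emeasure lborel (cball z (r / 2))"
          by (rule emeasure_eq_ennreal_measure[symmetric]) (use emeasure_lborel_cball_finite[of z "r / 2"] in auto)
        finally show ?thesis .
      qed
      also have "\<dots> = (\<integral>\<^sup>+x. ennreal ((r / 2)\<^sup>2) * indicator (cball z (r / 2)) x \<partial>lborel)"
        by (rule nn_integral_cmult_indicator[symmetric]) simp
      also have "\<dots> \<le> (\<integral>\<^sup>+x. ennreal ((depth z r x)\<^sup>2) * indicator B x \<partial>lborel)"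
      proof (rule nn_integral_mono)
        fix x
        show "ennreal ((r / 2)\<^sup>2) * indicator (cball z (r / 2)) x \<le> ennreal ((depth z r x)\<^sup>2) * indicator B x"
        proof (cases "x \<in> cball z (r / 2)")
          case True
          then have "x \<in> B" "r / 2 \<le> depth z r x" using r0 B by (auto simp: depth_def)
          moreover have "(r / 2)\<^sup>2 \<le> (depth z r x)\<^sup>2" using calculation r0 by (intro power_mono) auto
          ultimately show ?thesis using True by (simp add: ennreal_leI)
        qed simp
      qed
      also have "\<dots> \<le> ennreal c4 * (\<integral>\<^sup>+x. ennreal ((depth z r x)\<^sup>2) * indicator B x \<partial>\<mu>)"
        by (rule law_low) measurable
      also have "(\<integral>\<^sup>+x. ennreal ((depth z r x)\<^sup>2) * indicator B x \<partial>\<mu>) = (\<integral>\<^sup>+x. ennreal ((depth z r x)\<^sup>2) \<partial>\<mu>)"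
        by (intro nn_integral_cong) (auto simp: indicator_def d0)
      also have "\<dots> = ennreal (\<integral>x. (depth z r x)\<^sup>2 \<partial>\<mu>)" using di by (intro nn_integral_eq_integral) auto
      also have "ennreal c4 * \<dots> = ennreal (c4 * (\<integral>x. (depth z r x)\<^sup>2 \<partial>\<mu>))" using c4 by (intro ennreal_mult'[symmetric]) auto
      finally have "1 / (4 * c3\<^sup>2) * V \<le> c4 * (\<integral>x. (depth z r x)\<^sup>2 \<partial>\<mu>)"
        using c4 by (subst (asm) ennreal_le_iff) (auto intro!: mult_nonneg_nonneg integral_nonneg_AE)
      then show ?thesis using c3 c4 by (simp add: D_def field_simps)
    qed
    have \<nu>pos: "(\<integral>x. \<phi> x \<partial>\<nu>) \<noteq> 0"
    proof
      assume 0: "(\<integral>x. \<phi> x \<partial>\<nu>) = 0"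
      have "integrable \<nu> \<phi>" using \<phi>0 \<phi>1 by (intro \<nu>.integrable_const_bound[where B = 1]) auto
      then have "AE x in \<nu>. \<phi> x = 0" using 0 \<phi>0 by (subst (asm) integral_nonneg_eq_0_iff_AE) auto
      then have "AE x in \<nu>. x \<notin> ball z r"
      proof eventually_elim
        fix x assume "\<phi> x = 0"
        then have "depth z r x = 0" using lower[of x] by simp
        then show "x \<notin> ball z r" by (simp add: depth_eq_0_iff)
      qed
      then have "\<nu>.prob (ball z r) = 0" by (subst \<nu>.prob_eq_0) auto
      then show False using \<nu>B B by simp
    qed
    have step: "?W
        \<le> ennreal (sqrt K) * enn_root 2 (quad_cost \<pi>)" if \<pi>: "\<pi> \<in> couplings \<mu> \<nu>" for \<pi>
    proof (cases "quad_cost \<pi>")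
      case top
      then have "ennreal (sqrt K) * enn_root 2 (quad_cost \<pi>) = \<top>"
        using K by (simp add: enn_root_def ennreal_mult_top)
      then show ?thesis by simp
    next
      case (real E)
      note p = couplingsD[OF \<pi>]
      have [measurable_cong]: "sets \<pi> = sets (borel \<Otimes>\<^sub>M borel)" unfolding borel_prod by (rule p(1))
      have fm: "fst \<in> \<pi> \<rightarrow>\<^sub>M borel" and sm: "snd \<in> \<pi> \<rightarrow>\<^sub>M borel" by measurable
      have int1: "(\<integral>p. h (fst p) \<partial>\<pi>) = (\<integral>x. h x \<partial>\<mu>)" if "h \<in> borel_measurable borel" for h :: "real ^ 'n \<Rightarrow> real"
        unfolding p(2)[symmetric] using that by (subst integral_distr[OF fm]) auto
      have int2: "(\<integral>p. h (snd p) \<partial>\<pi>) = (\<integral>x. h x \<partial>\<nu>)" if "h \<in> borel_measurable borel" for h :: "real ^ 'n \<Rightarrow> real"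
        unfolding p(3)[symmetric] using that by (subst integral_distr[OF sm]) auto
      have nn1: "(\<integral>\<^sup>+p. h (fst p) \<partial>\<pi>) = (\<integral>\<^sup>+x. h x \<partial>\<mu>)" if "h \<in> borel_measurable borel" for h :: "real ^ 'n \<Rightarrow> ennreal"
        unfolding p(2)[symmetric] using that by (subst nn_integral_distr[OF fm]) auto
      have d1: "density \<mu> (\<lambda>x. ennreal (\<phi> x)) = distr (density \<pi> (\<lambda>p. ennreal (\<phi> (fst p)))) borel fst"
        unfolding p(2)[symmetric] by (rule density_distr) (use fm in auto)
      have d2: "density \<nu> (\<lambda>x. ennreal (a * \<phi> x)) = distr (density \<pi> (\<lambda>p. ennreal (a * \<phi> (snd p)))) borel snd"
        unfolding p(3)[symmetric] by (rule density_distr) (use sm in auto)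
      have "?W \<le> ennreal (sqrt (K * E))"
      proof (cases "E \<le> E0")
        case True
        have "cutoff_plan \<pi> \<phi> z r c2 c4 V D E"
        proof (rule cutoff_plan.intro)
          show "prob_space \<pi>"
            using P(1) fm unfolding p(2)[symmetric] by (rule prob_space_distrD[rotated])
          show "sets \<pi> = sets borel" by (rule p(1))
          show "quad_cost \<pi> = ennreal E" "0 \<le> E" using real by auto
          fix g :: "real ^ 'n \<Rightarrow> ennreal" assume g[measurable]: "g \<in> borel_measurable borel"
          have gB: "(\<lambda>x. g x * indicator (cball z r) x) \<in> borel_measurable borel"
            by (intro borel_measurable_times_ennreal g borel_measurable_indicator) simp
          show "(\<integral>\<^sup>+p. g (fst p) * indicator (cball z r) (fst p) \<partial>\<pi>) \<le> ennreal c4 * (\<integral>\<^sup>+x. g x * indicator (cball z r) x \<partial>lborel)"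
            using law_up[OF g] nn1[OF gB] B by simp
          show "(\<integral>\<^sup>+x. g x * indicator (cball z r) x \<partial>lborel) \<le> ennreal c4 * (\<integral>\<^sup>+p. g (fst p) * indicator (cball z r) (fst p) \<partial>\<pi>)"
            using law_low[OF g] nn1[OF gB] B by simp
        next
          show "D \<le> (\<integral>p. (depth z r (fst p))\<^sup>2 \<partial>\<pi>)" using \<mu>D int1[of "\<lambda>x. (depth z r x)\<^sup>2"] by simp
          show "8 * E \<le> D" using True by (simp add: E0_def)
          have "sqrt E \<le> sqrt (1 / (4 * \<rho>\<^sup>2))" using True by (simp add: E0_def)
          also have "\<dots> = 1 / (2 * \<rho>)" using \<rho> by (simp add: real_sqrt_divide real_sqrt_mult)
          finally show "ratio_const c2 D * sqrt E \<le> 1 / 2"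
            using \<rho> by (simp add: \<rho>_def[symmetric] field_simps)
        qed (use \<phi>m \<phi>0 \<phi>1 r0 r2 c2 c4 lower upper lips V Vr D in auto)
        from cutoff_plan_wasserstein[OF this]
        have "?W \<le> ennreal (sqrt (K1 * E))"
          unfolding int1[OF \<phi>m] int2[OF \<phi>m] a[symmetric] d1[symmetric] d2[symmetric] K1_def .
        also have "\<dots> \<le> ennreal (sqrt (K * E))"
          using real by (intro ennreal_leI real_sqrt_le_mono mult_right_mono) (auto simp: K_def)
        finally show ?thesis .
      next
        case False
        have "?W \<le> ennreal (sqrt (4 * r\<^sup>2))"
          unfolding a using supp B by (intro bounded_support_wasserstein[OF s P \<phi>m \<phi>0 \<phi>1 _ \<nu>pos]) auto
        also have "\<dots> \<le> ennreal (sqrt (K * E))"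
        proof (intro ennreal_leI real_sqrt_le_mono)
          have "4 * r\<^sup>2 \<le> 4 * c2 / E0 * E0" using r2 E0 by simp
          also have "\<dots> \<le> K * E" using False K E0 by (intro mult_mono) (auto simp: K_def)
          finally show "4 * r\<^sup>2 \<le> K * E" .
        qed
        finally show ?thesis .
      qed
      also have "\<dots> = ennreal (sqrt K) * enn_root 2 (quad_cost \<pi>)"
        using real K by (simp add: enn_root_2_ennreal real_sqrt_mult ennreal_mult)
      finally show ?thesis .
    qed
    have kp: "0 < ennreal (sqrt K)" using K by simp
    have "?W / ennreal (sqrt K) \<le> wasserstein 2 \<mu> \<nu>"
      unfolding wasserstein_2_eq[of \<mu> \<nu>]
    proof (rule INF_greatest)
      fix \<pi> assume "\<pi> \<in> couplings \<mu> \<nu>"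
      from step[OF this]
      show "?W / ennreal (sqrt K) \<le> enn_root 2 (quad_cost \<pi>)"
        by (intro divide_le_posI_ennreal kp) (simp add: mult.commute)
    qed
    then have "?W / ennreal (sqrt K) * ennreal (sqrt K)
        \<le> wasserstein 2 \<mu> \<nu> * ennreal (sqrt K)" by (rule mult_right_mono) simp
    moreover have "ennreal (sqrt K) / ennreal (sqrt K) = 1" using kp by (intro ennreal_divide_self) auto
    ultimately show ?thesis unfolding ennreal_divide_times by (simp add: mult.commute)
  qed
  show ?thesis
  proof (intro exI[of _ "sqrt K"] conjI allI impI)
    show "0 < sqrt K" using K by simp
  qed (rule main; assumption)
qed

end
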